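(* Let $H$ be an infinite dimensional real separable Hilbert space, $G$ a compact Lie group acting orthogonally on $H$, and $I=[0,1]$. If $L=\{L_\lambda\}_{\lambda\in I}$ is a path in $\mathcal{FS}_G(H)\cap\mathcal{FS}_+(H)$, then $$\operatorname{sf}_G(L)=[E^-(L_0)]-[E^-(L_1)]\in RO(G).$$
   Context: $\mathcal{FS}(H)$ is the set of bounded selfadjoint Fredholm operators on $H$ with the operator norm topology; $\mathcal{FS}_G(H)$ is the subset of $G$-equivariant operators ($T(gu)=g(Tu)$), and $\mathcal{FS}_+(H)=\{T\in\mathcal{FS}(H):\sigma_{ess}(T)\subset(0,+\infty)\}$. A path is a continuous family. For $T\in\mathcal{FS}_+(H)$, $E^-(T)=\bigoplus_{\mu<0}\{u\in H: Tu=\mu u\}$, which is finite dimensional, and is a $G$-representation if $T$ is $G$-equivariant. $RO(G)$ is the Grothendieck group (used only as an abelian group) of isomorphism classes of finite dimensional real linear representations of $G$: formal differences $[U]-[V]$ modulo the relation generated by $[U]-[V]\sim[U\oplus W]-[V\oplus W]$. $G$-equivariant spectral flow: for a selfadjoint $T$ and an interval $[a,b]$ with $[a,b]\cap\sigma_{ess}(T)=\emptyset$, let $E(T,[a,b])$ be the direct sum of the eigenspaces of $T$ for eigenvalues in $[a,b]$. For a path $\mathcal{A}=\{\mathcal{A}_\lambda\}_{\lambda\in I}$ in $\mathcal{FS}_G(H)$ there are a partition $0=\lambda_0<\lambda_1<\ldots<\lambda_N=1$ and numbers $a_i>0$ such that $\pm a_i\notin\sigma(\mathcal{A}_\lambda)$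 and $[-a_i,a_i]\cap\sigma_{ess}(\mathcal{A}_\lambda)=\emptyset$ for all $\lambda\in[\lambda_{i-1},\lambda_i]$, $i=1,\ldots,N$. Then $\operatorname{sf}_G(\mathcal{A})=\sum_{i=1}^N([E(\mathcal{A}_{\lambda_i},[0,a_i])]-[E(\mathcal{A}_{\lambda_{i-1}},[0,a_i])])\in RO(G)$, which does not depend on the choices. *)

theory Defs
  imports
    "HOL-Analysis.Analysis"
    "HOL-Algebra.Group_Action"
    "Jordan_Normal_Form.Matrix"
begin

section \<open>Compact Lie groups\<close>

text \<open>
  Charts take values in \<^term>\<open>Euclidean_space n\<close>, the space of all \<open>x :: nat \<Rightarrow> real\<close> with
  \<open>x i = 0\<close> for \<open>i \<ge> n\<close>. Unlike the types of class \<open>euclidean_space\<close> this includes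
  dimension 0, i.e. finite groups are Lie groups.
\<close>

text \<open>
  \<open>C_diff n k W f\<close>: all iterated partial derivatives of \<open>f\<close> of order at most \<open>k\<close> in the
  coordinates \<open>0, \<dots>, n - 1\<close> exist and are continuous on \<open>W\<close>, an open subset of
  \<^term>\<open>Euclidean_space n\<close>.
\<close>

primrec C_diff :: "nat \<Rightarrow> nat \<Rightarrow> (nat \<Rightarrow> real) set \<Rightarrow> ((nat \<Rightarrow> real) \<Rightarrow> real) \<Rightarrow> bool" where
  "C_diff n 0 W f \<longleftrightarrow> continuous_map (subtopology (Euclidean_space n) W) euclideanreal f"
| "C_diff n (Suc k) W f \<longleftrightarrow>
     continuous_map (subtopology (Euclidean_space n) W) euclideanreal f \<and>
     (\<forall>i<n. \<exists>f'. (\<forall>x\<in>W. ((\<lambda>t. f (x(i := t))) has_real_derivative f' x) (at (x i))) \<and>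
                 C_diff n k W f')"

definition smooth_on :: "nat \<Rightarrow> nat \<Rightarrow> (nat \<Rightarrow> real) set \<Rightarrow> ((nat \<Rightarrow> real) \<Rightarrow> (nat \<Rightarrow> real)) \<Rightarrow> bool"
  where "smooth_on n m W F \<longleftrightarrow> (\<forall>j<m. \<forall>k. C_diff n k W (\<lambda>x. F x j))"

type_synonym 'p atlas = "('p set \<times> ('p \<Rightarrow> nat \<Rightarrow> real)) set"

definition smooth_atlas :: "nat \<Rightarrow> 'p topology \<Rightarrow> 'p atlas \<Rightarrow> bool" where
  "smooth_atlas n X A \<longleftrightarrow>
     (\<forall>(U, \<phi>)\<in>A. openin X U \<and> openin (Euclidean_space n) (\<phi> ` U) \<and>
        homeomorphic_map (subtopology X U) (subtopology (Euclidean_space n) (\<phi> ` U)) \<phi>) \<and>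
     (\<Union>(U, \<phi>)\<in>A. U) = topspace X \<and>
     (\<forall>(U, \<phi>)\<in>A. \<forall>(V, \<psi>)\<in>A. smooth_on n n (\<phi> ` (U \<inter> V)) (\<psi> \<circ> inv_into U \<phi>))"

definition smooth_manifold :: "nat \<Rightarrow> 'p topology \<Rightarrow> 'p atlas \<Rightarrow> bool" where
  "smooth_manifold n X A \<longleftrightarrow>
     Hausdorff_space X \<and> second_countable X \<and> smooth_atlas n X A"

definition smooth_map ::
  "nat \<Rightarrow> 'p topology \<Rightarrow> 'p atlas \<Rightarrow> nat \<Rightarrow> 'q topology \<Rightarrow> 'q atlas \<Rightarrow> ('p \<Rightarrow> 'q) \<Rightarrow> bool" where
  "smooth_map n X A m Y B F \<longleftrightarrow>
     continuous_map X Y F \<and>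
     (\<forall>(U, \<phi>)\<in>A. \<forall>(V, \<psi>)\<in>B.
        smooth_on n m (\<phi> ` {x \<in> U. F x \<in> V}) (\<psi> \<circ> F \<circ> inv_into U \<phi>))"

definition prod_atlas :: "nat \<Rightarrow> 'p atlas \<Rightarrow> 'q atlas \<Rightarrow> ('p \<times> 'q) atlas" where
  "prod_atlas n A B =
     {(U \<times> V, \<lambda>(p, q) i. if i < n then \<phi> p i else \<psi> q (i - n)) | U \<phi> V \<psi>.
        (U, \<phi>) \<in> A \<and> (V, \<psi>) \<in> B}"

definition lie_group :: "'g monoid \<Rightarrow> 'g topology \<Rightarrow> bool" where
  "lie_group G X \<longleftrightarrow>
     group G \<and> topspace X = carrier G \<and>
     (\<exists>n A. smooth_manifold n X A \<and>
        smooth_map (n + n) (prod_topology X X) (prod_atlas n A A) n X A (\<lambda>(g, h). g \<otimes>\<^bsub>G\<^esub> h) \<and>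
        smooth_map n X A n X A (\<lambda>g. inv\<^bsub>G\<^esub> g))"

definition compact_lie_group :: "'g monoid \<Rightarrow> 'g topology \<Rightarrow> bool" where
  "compact_lie_group G X \<longleftrightarrow> lie_group G X \<and> compact_space X"

definition orthogonal_action ::
  "'g monoid \<Rightarrow> 'g topology \<Rightarrow> ('g \<Rightarrow> 'h \<Rightarrow> 'h::real_inner) \<Rightarrow> bool" where
  "orthogonal_action G X act \<longleftrightarrow>
     group_action G UNIV act \<and>
     (\<forall>g\<in>carrier G. orthogonal_transformation (act g)) \<and>
     continuous_map (prod_topology X euclidean) euclidean (\<lambda>(g, u). act g u)"


section \<open>The group RO(G)\<close>

text \<open>
  A finite dimensional real linear representation of \<open>G\<close> is given, up to isomorphism, by
  a dimension \<open>n\<close> (possibly 0) and a continuous homomorphism \<open>\<rho>\<close> from \<open>G\<close> to the invertible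
  \<open>n \<times> n\<close> matrices; \<open>\<rho>\<close> is arbitrary outside \<^term>\<open>carrier G\<close>.
\<close>

type_synonym 'g matrix_rep = "nat \<times> ('g \<Rightarrow> real mat)"

definition matrix_reps :: "'g monoid \<Rightarrow> 'g topology \<Rightarrow> 'g matrix_rep set" where
  "matrix_reps G X = {(n, \<rho>).
     (\<forall>g\<in>carrier G. \<rho> g \<in> carrier_mat n n) \<and>
     \<rho> \<one>\<^bsub>G\<^esub> = 1\<^sub>m n \<and>
     (\<forall>g\<in>carrier G. \<forall>h\<in>carrier G. \<rho> (g \<otimes>\<^bsub>G\<^esub> h) = \<rho> g * \<rho> h) \<and>
     (\<forall>i<n. \<forall>j<n. continuous_map X euclideanreal (\<lambda>g. \<rho> g $$ (i, j)))}"

definition rep_iso :: "'g monoid \<Rightarrow> 'g topology \<Rightarrow> 'g matrix_rep rel" where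
  "rep_iso G X = {((n, \<rho>), (m, \<sigma>)).
     (n, \<rho>) \<in> matrix_reps G X \<and> (m, \<sigma>) \<in> matrix_reps G X \<and> n = m \<and>
     (\<exists>P\<in>carrier_mat n n. invertible_mat P \<and> (\<forall>g\<in>carrier G. P * \<rho> g = \<sigma> g * P))}"

fun rep_sum :: "'g matrix_rep \<Rightarrow> 'g matrix_rep \<Rightarrow> 'g matrix_rep" where
  "rep_sum (n, \<rho>) (m, \<sigma>) =
     (n + m, \<lambda>g. four_block_mat (\<rho> g) (0\<^sub>m n m) (0\<^sub>m m n) (\<sigma> g))"

text \<open>The commutative monoid of isomorphism classes under direct sum, written multiplicatively.\<close>

definition rep_monoid :: "'g monoid \<Rightarrow> 'g topology \<Rightarrow> 'g matrix_rep set monoid" where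
  "rep_monoid G X =
     \<lparr>carrier = matrix_reps G X // rep_iso G X,
      mult = (\<lambda>u v. \<Union>r\<in>u. \<Union>s\<in>v. rep_iso G X `` {rep_sum r s}),
      one = rep_iso G X `` {(0, \<lambda>g. 1\<^sub>m 0)}\<rparr>"

text \<open>The Grothendieck group: formal differences \<open>u - v\<close> are pairs \<open>(u, v)\<close>, taken modulo the
  equivalence relation generated by \<open>u - v \<sim> (u + w) - (v + w)\<close>.\<close>

definition groth_rel :: "'a monoid \<Rightarrow> ('a \<times> 'a) rel" where
  "groth_rel M = {(p, q). equivclp (\<lambda>p q. \<exists>u\<in>carrier M. \<exists>v\<in>carrier M. \<exists>w\<in>carrier M.
       p = (u, v) \<and> q = (u \<otimes>\<^bsub>M\<^esub> w, v \<otimes>\<^bsub>M\<^esub> w)) p q}"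

definition formal_diff :: "'a monoid \<Rightarrow> 'a \<Rightarrow> 'a \<Rightarrow> ('a \<times> 'a) set" where
  "formal_diff M u v = groth_rel M `` {(u, v)}"

definition grothendieck_group :: "'a monoid \<Rightarrow> ('a \<times> 'a) set monoid" where
  "grothendieck_group M =
     \<lparr>carrier = (carrier M \<times> carrier M) // groth_rel M,
      mult = (\<lambda>x y. \<Union>(u, v)\<in>x. \<Union>(u', v')\<in>y. formal_diff M (u \<otimes>\<^bsub>M\<^esub> u') (v \<otimes>\<^bsub>M\<^esub> v')),
      one = formal_diff M \<one>\<^bsub>M\<^esub> \<one>\<^bsub>M\<^esub>\<rparr>"

definition RO :: "'g monoid \<Rightarrow> 'g topology \<Rightarrow> ('g matrix_rep set \<times> 'g matrix_rep set) set monoid"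
  where "RO G X = grothendieck_group (rep_monoid G X)"

text \<open>
  The isomorphism class of a finite dimensional invariant subspace \<open>E\<close> consists of the matrix
  representations of the action on \<open>E\<close> in all bases \<open>b 0, \<dots>, b (n - 1)\<close> of \<open>E\<close>.
\<close>

definition rep_class ::
  "'g monoid \<Rightarrow> 'g topology \<Rightarrow> ('g \<Rightarrow> 'h \<Rightarrow> 'h::real_vector) \<Rightarrow> 'h set \<Rightarrow> 'g matrix_rep set" where
  "rep_class G X act E = {(n, \<rho>) \<in> matrix_reps G X.
     \<exists>b. inj_on b {..<n} \<and> independent (b ` {..<n}) \<and> span (b ` {..<n}) = E \<and>
         (\<forall>g\<in>carrier G. \<forall>j<n. act g (b j) = (\<Sum>i<n. \<rho> g $$ (i, j) *\<^sub>R b i))}"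

definition rep_diff ::
  "'g monoid \<Rightarrow> 'g topology \<Rightarrow> ('g \<Rightarrow> 'h \<Rightarrow> 'h::real_vector) \<Rightarrow> 'h set \<Rightarrow> 'h set \<Rightarrow>
     ('g matrix_rep set \<times> 'g matrix_rep set) set" where
  "rep_diff G X act E F = formal_diff (rep_monoid G X) (rep_class G X act E) (rep_class G X act F)"


section \<open>Selfadjoint Fredholm operators\<close>

definition finite_dim :: "'h::real_vector set \<Rightarrow> bool" where
  "finite_dim S \<longleftrightarrow> (\<exists>B. finite B \<and> S \<subseteq> span B)"

definition selfadjoint :: "('h::real_inner \<Rightarrow>\<^sub>L 'h) \<Rightarrow> bool" where
  "selfadjoint T \<longleftrightarrow> (\<forall>u v. T u \<bullet> v = u \<bullet> T v)"

definition fredholm :: "('h::real_normed_vector \<Rightarrow>\<^sub>L 'h) \<Rightarrow> bool" where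
  "fredholm T \<longleftrightarrow> finite_dim {u. T u = 0} \<and> closed (range T) \<and>
     (\<exists>B. finite B \<and> span (range T \<union> B) = UNIV)"

text \<open>For selfadjoint operators the spectrum (of the complexification) is real.\<close>

definition op_spectrum :: "('h::real_normed_vector \<Rightarrow>\<^sub>L 'h) \<Rightarrow> real set" where
  "op_spectrum T = {\<mu>. \<not> (\<exists>S. S o\<^sub>L (T - \<mu> *\<^sub>R id_blinfun) = id_blinfun \<and>
                              (T - \<mu> *\<^sub>R id_blinfun) o\<^sub>L S = id_blinfun)}"

definition ess_spectrum :: "('h::real_normed_vector \<Rightarrow>\<^sub>L 'h) \<Rightarrow> real set" where
  "ess_spectrum T = {\<mu>. \<not> fredholm (T - \<mu> *\<^sub>R id_blinfun)}"

definition FS :: "('h::real_inner \<Rightarrow>\<^sub>L 'h) set" where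
  "FS = {T. selfadjoint T \<and> fredholm T}"

definition FS_G :: "'g monoid \<Rightarrow> ('g \<Rightarrow> 'h \<Rightarrow> 'h) \<Rightarrow> ('h::real_inner \<Rightarrow>\<^sub>L 'h) set" where
  "FS_G G act = {T \<in> FS. \<forall>g\<in>carrier G. \<forall>u. T (act g u) = act g (T u)}"

definition FS_plus :: "('h::real_inner \<Rightarrow>\<^sub>L 'h) set" where
  "FS_plus = {T \<in> FS. ess_spectrum T \<subseteq> {0<..}}"

text \<open>Eigenspaces of a selfadjoint operator for distinct eigenvalues are orthogonal, so the span
  of the union of eigenspaces is their direct sum.\<close>

definition eigen_sum :: "('h::real_normed_vector \<Rightarrow>\<^sub>L 'h) \<Rightarrow> real set \<Rightarrow> 'h set" where
  "eigen_sum T M = span (\<Union>\<mu>\<in>M. {u. T u = \<mu> *\<^sub>R u})"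

definition E_minus :: "('h::real_normed_vector \<Rightarrow>\<^sub>L 'h) \<Rightarrow> 'h set" where
  "E_minus T = eigen_sum T {..<0}"


section \<open>Equivariant spectral flow\<close>

definition sf_partition ::
  "(real \<Rightarrow> 'h::real_normed_vector \<Rightarrow>\<^sub>L 'h) \<Rightarrow> nat \<Rightarrow> (nat \<Rightarrow> real) \<Rightarrow> (nat \<Rightarrow> real) \<Rightarrow> bool" where
  "sf_partition A N t a \<longleftrightarrow>
     t 0 = 0 \<and> t N = 1 \<and> (\<forall>i\<in>{1..N}. t (i - 1) < t i) \<and>
     (\<forall>i\<in>{1..N}. a i > 0 \<and> (\<forall>s\<in>{t (i - 1)..t i}.
        a i \<notin> op_spectrum (A s) \<and> - a i \<notin> op_spectrum (A s) \<and>
        {- a i..a i} \<inter> ess_spectrum (A s) = {}))"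

definition sf_sum ::
  "'g monoid \<Rightarrow> 'g topology \<Rightarrow> ('g \<Rightarrow> 'h \<Rightarrow> 'h) \<Rightarrow> (real \<Rightarrow> 'h::real_normed_vector \<Rightarrow>\<^sub>L 'h) \<Rightarrow>
     nat \<Rightarrow> (nat \<Rightarrow> real) \<Rightarrow> (nat \<Rightarrow> real) \<Rightarrow> ('g matrix_rep set \<times> 'g matrix_rep set) set" where
  "sf_sum G X act A N t a =
     finprod (RO G X)
       (\<lambda>i. rep_diff G X act (eigen_sum (A (t i)) {0..a i}) (eigen_sum (A (t (i - 1))) {0..a i}))
       {1..N}"

text \<open>The sum does not depend on the partition and the numbers \<open>a i\<close>, so the description is
  definite.\<close>

definition sf_G ::
  "'g monoid \<Rightarrow> 'g topology \<Rightarrow> ('g \<Rightarrow> 'h \<Rightarrow> 'h) \<Rightarrow> (real \<Rightarrow> 'h::real_normed_vector \<Rightarrow>\<^sub>L 'h) \<Rightarrow>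
     ('g matrix_rep set \<times> 'g matrix_rep set) set" where
  "sf_G G X act A =
     (THE x. \<exists>N t a. sf_partition A N t a \<and> x = sf_sum G X act A N t a)"

end

theory Submission
  imports Defs
begin

text \<open>
  Let \<open>T\<close> be an operator of the path and let \<open>a > 0\<close> be such that \<open>\<plusminus>a\<close> is not in the spectrum and
  \<open>[-a, a]\<close> does not meet the essential spectrum. Since the essential spectrum is positive, the sum
  \<open>F(T)\<close> of all eigenspaces for eigenvalues \<open>\<le> a\<close> is finite dimensional, and it is the
  direct sum of \<open>E\<^sup>-(T)\<close> and \<open>E(T, [0, a])\<close>. Moreover \<open>T \<le> a - \<epsilon>\<close> on \<open>F(T)\<close> and \<open>T \<ge> a + \<epsilon>\<close> on
  \<open>F(T)\<^sup>\<bottom>\<close> for some \<open>\<epsilon> > 0\<close>, so for a nearby operator \<open>T'\<close> of the same kind \<open>F(T)\<close> meets \<open>F(T')\<^sup>\<bottom>\<close>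
  trivially, and conversely; hence the orthogonal projection maps \<open>F(T)\<close> equivariantly and
  isomorphically onto \<open>F(T')\<close>. Thus the class of \<open>F\<close> is constant on every interval of a partition,
  which turns the summand \<open>[E(L\<^sub>i, [0, a])] - [E(L\<^sub>i\<^sub>-\<^sub>1, [0, a])]\<close> of the spectral flow into
  \<open>[E\<^sup>-(L\<^sub>i\<^sub>-\<^sub>1)] - [E\<^sup>-(L\<^sub>i)]\<close>, and the sum telescopes.

  The spectral facts are obtained without a spectral theorem: the infimum of the Rayleigh quotient on
  a closed invariant subspace is an approximate eigenvalue, and for a selfadjoint operator whose range has
  finite codimension a bounded approximate kernel sequence has a convergent subsequence.
\<close>

text \<open>The Fredholm property enters through uniform boundedness. If the range of a selfadjoint
  \<open>S\<close> together with finitely many vectors \<open>b\<close> spans the space, then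
  \<open>norm u\<close> is controlled by \<open>norm (S u)\<close> and the scalars
  \<open>u \<bullet> b\<close>, and extracting convergent subsequences of these scalars replaces
  compactness of bounded sets. Conversely, operators near a given one are shown to be Fredholm by
  coercivity off a finite dimensional subspace, which rests on the Banach fixed point theorem.

  Transversality is needed in both directions because one trivial intersection yields only an
  inequality of dimensions. The size of the neighbourhood is dictated by the gap of \<open>T\<close>
  alone, however small the gap of \<open>T'\<close> is; this gives local constancy of the class, and
  connectedness of the interval does the rest.

  The spectral flow is a definite description. No common refinement of partitions is required, since
  every admissible partition evaluates to the same difference of classes; what remains is the
  existence of one, by compactness of the unit interval.\<close>

no_notation scalar_prod (infix "\<bullet>" 70)


section \<open>Approximate kernels of selfadjoint operators with range of finite codimension\<close>

text \<open>Gliding hump: the sign of the \<open>n\<close>-th step, of length \<open>3\<^sup>-\<^sup>n\<close>, is chosen such that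
  \<open>\<bar>u n \<bullet> x (Suc n)\<bar> \<ge> 3\<^sup>-\<^sup>n * norm (u n)\<close>, and the later steps cannot cancel more than half of this.\<close>

lemma pointwise_bounded_inner_imp_bounded:
  fixes v :: "nat \<Rightarrow> 'h::{real_inner, complete_space}"
  assumes bdd: "\<And>w. \<exists>K. \<forall>n. \<bar>v n \<bullet> w\<bar> \<le> K"
  shows "\<exists>K. \<forall>n. norm (v n) \<le> K"
proof (rule ccontr)
  assume "\<not> ?thesis"
  then have "\<forall>n::nat. \<exists>k. norm (v k) > 4 ^ n"
    by (meson not_le)
  \<comment> \<open>\<open>4 ^ n\<close> has to outgrow the factor \<open>3 ^ n\<close> lost through
    the step lengths.\<close>
  then obtain k where k: "\<And>n::nat. norm (v (k n)) > 4 ^ n"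
    by metis
  define u where "u n = v (k n)" for n
  define d where "d n = ((1/3) ^ n / norm (u n)) *\<^sub>R u n" for n
  have un: "norm (u n) > 4 ^ n" for n
    using k by (simp add: u_def)
  have upos: "norm (u n) > 0" for n
    by (rule less_trans[OF _ un]) simp
  have nd: "norm (d n) = (1/3) ^ n" for n
    using upos[of n] by (simp add: d_def)
  have ud: "u n \<bullet> d n = (1/3) ^ n * norm (u n)" for n
    using upos[of n] by (simp add: d_def power2_norm_eq_inner[symmetric] power2_eq_square)
  define s where "s n y = (if \<bar>u n \<bullet> (y + d n)\<bar> \<ge> \<bar>u n \<bullet> (y - d n)\<bar> then d n else - d n)" for n y
  define x where "x = rec_nat 0 (\<lambda>n y. y + s n y)"
  define e where "e n = s n (x n)" for n
  have x0: "x 0 = 0" and xS: "x (Suc n) = x n + e n" for n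
    by (simp_all add: x_def e_def)
  have ne: "norm (e n) = (1/3) ^ n" for n
    by (simp add: e_def s_def nd)
  have big: "\<bar>u n \<bullet> x (Suc n)\<bar> \<ge> (1/3) ^ n * norm (u n)" for n
  proof -
    \<comment> \<open>The larger of the two values is at least their mean, hence at least
      \<open>u n \<bullet> d n\<close>.\<close>
    have "2 * (u n \<bullet> d n) \<le> \<bar>u n \<bullet> (x n + d n)\<bar> + \<bar>u n \<bullet> (x n - d n)\<bar>"
      by (simp add: inner_simps)
    then show ?thesis
      by (auto simp: xS e_def s_def ud)
  qed
  \<comment> \<open>The right hand side is the sum of the step lengths from \<open>n\<close> to
    \<open>n + k - 1\<close>. For large \<open>k\<close> it approaches
    \<open>(1/3) ^ n * (3/2)\<close>; started one index later it stays below
    \<open>(1/3) ^ n / 2\<close>, half the length of step \<open>n\<close>.\<close>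
  have diff: "norm (x (n + k) - x n) \<le> (1/3) ^ n * (3/2) - (1/3) ^ (n + k) * (3/2)" for n k
  proof (induction k)
    case (Suc k)
    have "norm (x (n + Suc k) - x n) \<le> norm (x (n + k) - x n) + norm (e (n + k))"
      using norm_triangle_ineq[of "x (n + k) - x n" "e (n + k)"] by (simp add: xS algebra_simps)
    with Suc show ?case
      by (simp add: ne)
  qed simp
  have diff': "norm (x m - x n) \<le> (1/3) ^ n * (3/2)" if "n \<le> m" for m n
  proof -
    have "(0::real) \<le> (1/3) ^ m * (3/2)" by simp
    moreover have "norm (x m - x n) \<le> (1/3) ^ n * (3/2) - (1/3) ^ m * (3/2)"
      using diff[of n "m - n"] that by simp
    ultimately show ?thesis by linarith
  qed
  have "Cauchy x"
  proof (rule CauchyI')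
    fix \<epsilon> :: real assume "\<epsilon> > 0"
    then obtain M where M: "(1/3 :: real) ^ M < \<epsilon> / (3/2)"
      using real_arch_pow_inv[of "\<epsilon> / (3/2)" "1/3"] by auto
    have "dist (x m) (x n) < \<epsilon>" if "m \<ge> M" "n > m" for m n
    proof -
      have "norm (x n - x m) \<le> (1/3) ^ m * (3/2)"
        using that by (intro diff') simp
      also have "\<dots> \<le> (1/3) ^ M * (3/2)"
        using that by (intro mult_right_mono power_decreasing) auto
      also have "\<dots> < \<epsilon>" using M by simp
      finally show ?thesis by (simp add: dist_norm norm_minus_commute)
    qed
    then show "\<exists>M. \<forall>m\<ge>M. \<forall>n>m. dist (x m) (x n) < \<epsilon>" by blast
  qed
  then obtain l where l: "x \<longlonglongrightarrow> l"
    using Cauchy_convergent_iff convergent_def by blast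
  have tail: "norm (l - x (Suc n)) \<le> (1/3) ^ n / 2" for n
  proof (rule LIMSEQ_le_const2)
    show "(\<lambda>m. norm (x m - x (Suc n))) \<longlonglongrightarrow> norm (l - x (Suc n))"
      using l by (intro tendsto_intros)
    show "\<exists>N. \<forall>m\<ge>N. norm (x m - x (Suc n)) \<le> (1/3) ^ n / 2"
      using diff'[of "Suc n"] by (intro exI[of _ "Suc n"]) auto
  qed
  obtain K where K: "\<And>n. \<bar>v n \<bullet> l\<bar> \<le> K"
    using bdd[of l] by blast
  have "(4/3) ^ n / 2 \<le> K" for n
  proof -
    have "\<bar>u n \<bullet> (l - x (Suc n))\<bar> \<le> norm (u n) * norm (l - x (Suc n))"
      by (rule Cauchy_Schwarz_ineq2)
    also have "\<dots> \<le> norm (u n) * ((1/3) ^ n / 2)"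
      by (intro mult_left_mono tail) simp
    finally have "\<bar>u n \<bullet> l\<bar> \<ge> (1/3) ^ n * norm (u n) / 2"
      using big[of n] unfolding inner_diff_right by argo
    moreover have "(1/3) ^ n * norm (u n) \<ge> (1/3) ^ n * 4 ^ n"
      using un[of n] by (intro mult_left_mono) auto
    moreover have "(1/3) ^ n * 4 ^ n = ((4/3) ^ n :: real)"
      by (simp add: power_mult_distrib[symmetric])
    ultimately show ?thesis
      using K[of "k n"] by (simp add: u_def)
  qed
  moreover obtain n where "(4/3 :: real) ^ n > 2 * K"
    using real_arch_pow[of "4/3 :: real" "2 * K"] by auto
  ultimately show False
    by (smt (verit) field_sum_of_halves)
qed

lemma bounded_inner_span:
  fixes w :: "nat \<Rightarrow> 'h::real_inner"
  assumes "\<And>y. y \<in> A \<Longrightarrow> \<exists>K. \<forall>n. \<bar>w n \<bullet> y\<bar> \<le> K" and "y \<in> span A"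
  shows "\<exists>K. \<forall>n. \<bar>w n \<bullet> y\<bar> \<le> K"
  using assms(2)
proof (rule span_induct)
  show "subspace {y. \<exists>K. \<forall>n. \<bar>w n \<bullet> y\<bar> \<le> K}"
  proof (rule subspaceI; clarsimp)
    show "\<exists>K. K \<ge> (0::real)" by (rule exI[of _ 0]) simp
  next
    fix x y K1 K2 assume "\<forall>n. \<bar>w n \<bullet> x\<bar> \<le> K1" "\<forall>n. \<bar>w n \<bullet> y\<bar> \<le> K2"
    then have "\<forall>n. \<bar>w n \<bullet> (x + y)\<bar> \<le> K1 + K2"
      by (metis abs_triangle_ineq add_mono inner_add_right order_trans)
    then show "\<exists>K. \<forall>n. \<bar>w n \<bullet> (x + y)\<bar> \<le> K" ..
  next
    fix c x K assume "\<forall>n. \<bar>w n \<bullet> x\<bar> \<le> K"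
    then have "\<forall>n. \<bar>c * (w n \<bullet> x)\<bar> \<le> \<bar>c\<bar> * K"
      by (simp add: abs_mult mult_left_mono)
    then show "\<exists>K. \<forall>n. \<bar>c * (w n \<bullet> x)\<bar> \<le> K" ..
  qed
qed (use assms(1) in blast)

text \<open>Uniform boundedness: if no \<open>C\<close> works, there are vectors \<open>w n\<close>
  of unbounded norm with \<open>norm (S (w n))\<close> and all
  \<open>\<bar>w n \<bullet> b\<bar>\<close> at most 1. Selfadjointness turns
  \<open>w n \<bullet> S z\<close> into \<open>S (w n) \<bullet> z\<close>, so the inner products
  with the range and with \<open>B\<close>, hence with every vector, stay bounded.\<close>

lemma finite_codim_estimate:
  fixes S :: "'h::{real_inner, complete_space} \<Rightarrow>\<^sub>L 'h"
  assumes sa: "selfadjoint S" and fin: "finite B" and sp: "span (range S \<union> B) = UNIV"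
  shows "\<exists>C\<ge>0. \<forall>u. norm u \<le> C * (norm (S u) + (\<Sum>b\<in>B. \<bar>u \<bullet> b\<bar>))"
proof (rule ccontr)
  define q where "q u = norm (S u) + (\<Sum>b\<in>B. \<bar>u \<bullet> b\<bar>)" for u
  have q0: "q u \<ge> 0" for u
    by (simp add: q_def sum_nonneg)
  have qs: "q (c *\<^sub>R u) = \<bar>c\<bar> * q u" for c u
    by (simp add: q_def blinfun.scaleR_right abs_mult sum_distrib_left[symmetric] distrib_left)
  assume "\<not> ?thesis"
  then have "\<exists>u. norm u > real n * q u" for n
    unfolding q_def by (metis not_le of_nat_0_le_iff)
  \<comment> \<open>Rescaling brings \<open>q\<close> down to at most 1 and keeps the norm large; a
    vector with \<open>q u = 0\<close> can be stretched at will.\<close>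
  moreover have "\<exists>w. norm w > real n \<and> q w \<le> 1" if u: "norm u > real n * q u" for n u
  proof (cases "q u = 0")
    case True
    with u have "norm u > 0" by simp
    with True show ?thesis
      by (intro exI[of _ "((real n + 1) / norm u) *\<^sub>R u"]) (simp add: qs)
  next
    case False
    with q0[of u] have "q u > 0" by simp
    with u show ?thesis
      by (intro exI[of _ "(1 / q u) *\<^sub>R u"]) (simp add: qs field_simps)
  qed
  ultimately obtain w where w: "\<And>n. norm (w n) > real n" "\<And>n. q (w n) \<le> 1"
    by metis
  have "\<exists>K. \<forall>n. \<bar>w n \<bullet> y\<bar> \<le> K" for y
  proof (rule bounded_inner_span)
    show "y \<in> span (range S \<union> B)"
      by (simp add: sp)
    fix y assume "y \<in> range S \<union> B"
    then show "\<exists>K. \<forall>n. \<bar>w n \<bullet> y\<bar> \<le> K"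
    proof
      assume "y \<in> range S"
      then obtain z where z: "y = S z" by blast
      have "\<bar>w n \<bullet> y\<bar> \<le> norm z" for n
      proof -
        have "\<bar>w n \<bullet> y\<bar> = \<bar>S (w n) \<bullet> z\<bar>"
          using sa by (simp add: z selfadjoint_def)
        also have "\<dots> \<le> norm (S (w n)) * norm z"
          by (rule Cauchy_Schwarz_ineq2)
        also have "\<dots> \<le> 1 * norm z"
        proof (rule mult_right_mono)
          have "(\<Sum>b\<in>B. \<bar>w n \<bullet> b\<bar>) \<ge> 0" by (simp add: sum_nonneg)
          with w(2)[of n] show "norm (S (w n)) \<le> 1" unfolding q_def by linarith
        qed simp
        finally show ?thesis by simp
      qed
      then show ?thesis by blast
    next
      assume y: "y \<in> B"
      have "\<bar>w n \<bullet> y\<bar> \<le> 1" for n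
        using w(2)[of n] member_le_sum[OF y, of "\<lambda>b. \<bar>w n \<bullet> b\<bar>"] fin norm_ge_zero[of "S (w n)"]
        unfolding q_def by linarith
      then show ?thesis by blast
    qed
  qed
  from pointwise_bounded_inner_imp_bounded[OF this] obtain K where "\<And>n. norm (w n) \<le> K"
    by blast
  with w(1) have "real n < K" for n
    by (meson less_le_trans)
  then show False
    by (metis less_asym reals_Archimedean2)
qed

lemma bounded_inner_convergent_subseq:
  fixes u :: "nat \<Rightarrow> 'h::real_inner"
  assumes "finite B" and bdd: "\<And>n. norm (u n) \<le> K"
  shows "\<exists>r::nat \<Rightarrow> nat. strict_mono r \<and> (\<forall>b\<in>B. convergent (\<lambda>n. u (r n) \<bullet> b))"
  using assms(1)
proof induction
  case empty
  then show ?case by (auto intro: exI[of _ id] strict_mono_id)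
next
  case (insert b B)
  then obtain r where r: "strict_mono r" "\<And>b. b \<in> B \<Longrightarrow> convergent (\<lambda>n. u (r n) \<bullet> b)"
    by blast
  have "\<bar>u (r n) \<bullet> b\<bar> \<le> K * norm b" for n
    by (meson Cauchy_Schwarz_ineq2 bdd mult_right_mono norm_ge_zero order_trans)
  then have "bounded (range (\<lambda>n. u (r n) \<bullet> b))"
    by (auto simp: bounded_iff)
  then obtain l q where q: "strict_mono q" "((\<lambda>n. u (r n) \<bullet> b) \<circ> q) \<longlonglongrightarrow> l"
    using bounded_imp_convergent_subsequence by blast
  have "convergent (\<lambda>n. u ((r \<circ> q) n) \<bullet> b')" if "b' \<in> insert b B" for b'
  proof (cases "b' = b")
    case True
    with q(2) show ?thesis by (auto simp: convergent_def o_def)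
  next
    case False
    with that r(2) have "convergent (\<lambda>n. u (r n) \<bullet> b')" by blast
    from convergent_subseq_convergent[OF this q(1)] show ?thesis by (simp add: o_def)
  qed
  with strict_mono_o[OF r(1) q(1)] show ?case by blast
qed

text \<open>Along a subsequence the finitely many scalar sequences \<open>u n \<bullet> b\<close>
  converge. The estimate, applied to differences of members, then makes this subsequence Cauchy,
  because both \<open>S (u n)\<close> and the deviations from the scalar limits tend to 0.\<close>

lemma finite_codim_approx_kernel_convergent:
  fixes S :: "'h::{real_inner, complete_space} \<Rightarrow>\<^sub>L 'h"
  assumes sa: "selfadjoint S" and fin: "finite B" and sp: "span (range S \<union> B) = UNIV"
    and bdd: "\<And>n. norm (u n) \<le> K" and lim: "(\<lambda>n. S (u n)) \<longlonglongrightarrow> 0"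
  obtains r l where "strict_mono (r :: nat \<Rightarrow> nat)" "(\<lambda>n. u (r n)) \<longlonglongrightarrow> l"
proof -
  obtain C where C: "C \<ge> 0" "\<And>u. norm u \<le> C * (norm (S u) + (\<Sum>b\<in>B. \<bar>u \<bullet> b\<bar>))"
    using finite_codim_estimate[OF sa fin sp] by blast
  obtain r :: "nat \<Rightarrow> nat" where r: "strict_mono r" "\<And>b. b \<in> B \<Longrightarrow> convergent (\<lambda>n. u (r n) \<bullet> b)"
    using bounded_inner_convergent_subseq[of B u K] fin bdd by blast
  define c where "c b = lim (\<lambda>n. u (r n) \<bullet> b)" for b
  have c: "(\<lambda>n. u (r n) \<bullet> b) \<longlonglongrightarrow> c b" if "b \<in> B" for b
    using r(2)[OF that] by (simp add: c_def convergent_LIMSEQ_iff)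
  define \<epsilon> where "\<epsilon> n = C * (norm (S (u (r n))) + (\<Sum>b\<in>B. \<bar>u (r n) \<bullet> b - c b\<bar>))" for n
  have "(\<lambda>n. S (u (r n))) \<longlonglongrightarrow> 0"
    using LIMSEQ_subseq_LIMSEQ[OF lim r(1)] by (simp add: o_def)
  then have "\<epsilon> \<longlonglongrightarrow> C * (norm (0::'h) + (\<Sum>b\<in>B. \<bar>c b - c b\<bar>))"
    unfolding \<epsilon>_def by (intro tendsto_intros c)
  then have \<epsilon>: "\<epsilon> \<longlonglongrightarrow> 0" by simp
  have "norm (u (r m) - u (r n)) \<le> \<epsilon> m + \<epsilon> n" for m n
  proof -
    have "norm (u (r m) - u (r n)) \<le> C * (norm (S (u (r m) - u (r n))) + (\<Sum>b\<in>B. \<bar>(u (r m) - u (r n)) \<bullet> b\<bar>))"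
      by (rule C)
    also have "\<dots> \<le> C * ((norm (S (u (r m))) + norm (S (u (r n)))) +
        (\<Sum>b\<in>B. \<bar>u (r m) \<bullet> b - c b\<bar> + \<bar>u (r n) \<bullet> b - c b\<bar>))"
      by (intro mult_left_mono C(1) add_mono sum_mono)
         (auto simp: blinfun.diff_right inner_diff_left norm_triangle_ineq4)
    also have "\<dots> = \<epsilon> m + \<epsilon> n"
      by (simp add: \<epsilon>_def sum.distrib algebra_simps)
    finally show ?thesis .
  qed
  then have "Cauchy (\<lambda>n. u (r n))"
  proof (intro CauchyI)
    fix e :: real assume "e > 0"
    and le: "\<And>m n. norm (u (r m) - u (r n)) \<le> \<epsilon> m + \<epsilon> n"
    then obtain N where "\<And>n. n \<ge> N \<Longrightarrow> \<bar>\<epsilon> n\<bar> < e / 2"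
      using \<epsilon> by (metis LIMSEQ_D diff_zero half_gt_zero real_norm_def)
    then show "\<exists>M. \<forall>m\<ge>M. \<forall>n\<ge>M. norm (u (r m) - u (r n)) < e"
      by (intro exI[of _ N]) (smt (verit) le field_sum_of_halves)
  qed
  then obtain l where "(\<lambda>n. u (r n)) \<longlonglongrightarrow> l"
    using Cauchy_convergent_iff convergent_def by blast
  with r(1) show ?thesis by (rule that)
qed

section \<open>The Rayleigh quotient and eigenspaces below a level\<close>

lemma mem_orthogonal_comp: "u \<in> W\<^sup>\<bottom> \<longleftrightarrow> (\<forall>y\<in>W. y \<bullet> u = 0)"
  by (simp add: orthogonal_comp_def real_inner_class.orthogonal_def)

lemma shift_apply [simp]: "blinfun_apply (T - \<mu> *\<^sub>R id_blinfun) u = T u - \<mu> *\<^sub>R u"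
  by (simp add: blinfun.diff_left blinfun.scaleR_left)

lemma selfadjoint_shift: "selfadjoint T \<Longrightarrow> selfadjoint (T - \<mu> *\<^sub>R id_blinfun)"
  by (simp add: selfadjoint_def inner_diff_left inner_diff_right)

text \<open>The limit may be 0; that it is a true eigenvector has to come from a lower bound on the
  norms, which the applications have because they use unit vectors.\<close>

lemma fredholm_approx_eigenvector:
  fixes T :: "'h::{real_inner, complete_space} \<Rightarrow>\<^sub>L 'h"
  assumes sa: "selfadjoint T" and fr: "fredholm (T - \<mu> *\<^sub>R id_blinfun)"
    and bdd: "\<And>n. norm (u n) \<le> K" and lim: "(\<lambda>n. T (u n) - \<mu> *\<^sub>R u n) \<longlonglongrightarrow> 0"
  obtains r l where "strict_mono (r :: nat \<Rightarrow> nat)" "(\<lambda>n. u (r n)) \<longlonglongrightarrow> l" "T l = \<mu> *\<^sub>R l"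
proof -
  let ?S = "T - \<mu> *\<^sub>R id_blinfun"
  obtain B where B: "finite B" "span (range ?S \<union> B) = UNIV"
    using fr by (auto simp: fredholm_def)
  have "(\<lambda>n. ?S (u n)) \<longlonglongrightarrow> 0"
    using lim by simp
  then obtain r l where r: "strict_mono (r :: nat \<Rightarrow> nat)" "(\<lambda>n. u (r n)) \<longlonglongrightarrow> l"
    by (rule finite_codim_approx_kernel_convergent[OF selfadjoint_shift[OF sa] B bdd])
  have "(\<lambda>n. T (u (r n)) - \<mu> *\<^sub>R u (r n)) \<longlonglongrightarrow> T l - \<mu> *\<^sub>R l"
    by (intro tendsto_intros r(2))
  moreover have "(\<lambda>n. T (u (r n)) - \<mu> *\<^sub>R u (r n)) \<longlonglongrightarrow> 0"
    using LIMSEQ_subseq_LIMSEQ[OF lim r(1)] by (simp add: o_def)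
  ultimately have "T l - \<mu> *\<^sub>R l = 0"
    by (rule LIMSEQ_unique)
  with r show ?thesis by (intro that) auto
qed

text \<open>A Cauchy-Schwarz inequality for the nonnegative form of \<open>S\<close> on
  \<open>W\<close>. It converts smallness of \<open>S u \<bullet> u\<close>, all that a minimising
  sequence provides, into smallness of \<open>S u\<close>.\<close>

lemma norm_image_le_form:
  fixes S :: "'h::real_inner \<Rightarrow>\<^sub>L 'h"
  assumes sa: "selfadjoint S" and W: "subspace W" "S ` W \<subseteq> W"
    and pos: "\<And>u. u \<in> W \<Longrightarrow> S u \<bullet> u \<ge> 0" and M: "norm S \<le> M" "M > 0" and u: "u \<in> W"
  shows "(norm (S u))\<^sup>2 \<le> M * (S u \<bullet> u)"
proof -
  have Su: "S u \<in> W" using W u by blast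
  have "S (S u) \<bullet> S u \<le> norm (S (S u)) * norm (S u)"
    by (rule norm_cauchy_schwarz)
  also have "\<dots> \<le> (norm S * norm (S u)) * norm (S u)"
    by (intro mult_right_mono norm_blinfun) simp
  also have "\<dots> \<le> (M * norm (S u)) * norm (S u)"
    by (intro mult_right_mono M(1)) auto
  finally have 1: "S (S u) \<bullet> S u \<le> M * (norm (S u))\<^sup>2"
    by (simp add: power2_eq_square mult_ac)
  \<comment> \<open>The form at this vector equals \<open>M * M * (S u \<bullet> u)\<close> minus
    \<open>2 * M\<close> times the square of \<open>norm (S u)\<close> plus
    \<open>S (S u) \<bullet> S u\<close>; the last term is at most \<open>M\<close> times that
    square, so one of the two copies survives.\<close>
  let ?v = "M *\<^sub>R u - S u"
  have "0 \<le> S ?v \<bullet> ?v"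
    using W(1) Su u by (intro pos subspace_diff subspace_scale)
  also have "S ?v \<bullet> ?v = M\<^sup>2 * (S u \<bullet> u) - 2 * M * (norm (S u))\<^sup>2 + S (S u) \<bullet> S u"
  proof -
    have "S (S u) \<bullet> u = S u \<bullet> S u" using sa by (simp add: selfadjoint_def)
    moreover have "(norm (S u))\<^sup>2 = S u \<bullet> S u" by (rule power2_norm_eq_inner)
    ultimately show ?thesis
      by (simp add: blinfun.diff_right blinfun.scaleR_right inner_diff_left inner_diff_right
        power2_eq_square algebra_simps)
  qed
  finally have "M * (norm (S u))\<^sup>2 \<le> M * (M * (S u \<bullet> u))"
    using 1 by (simp add: power2_eq_square algebra_simps)
  with M(2) show ?thesis by simp
qed

text \<open>On a closed invariant subspace the infimum of the Rayleigh quotient is an approximate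
  eigenvalue, hence an eigenvalue unless it lies in the essential spectrum.\<close>

lemma rayleigh_infimum:
  fixes T :: "'h::{real_inner, complete_space} \<Rightarrow>\<^sub>L 'h"
  assumes sa: "selfadjoint T" and W: "subspace W" "closed W" "T ` W \<subseteq> W"
    and w: "w \<in> W" "w \<noteq> 0"
  shows "\<exists>m. (\<forall>u\<in>W. T u \<bullet> u \<ge> m * (norm u)\<^sup>2) \<and>
    (fredholm (T - m *\<^sub>R id_blinfun) \<longrightarrow> (\<exists>v\<in>W. v \<noteq> 0 \<and> T v = m *\<^sub>R v))"
proof -
  define Q where "Q = (\<lambda>u. T u \<bullet> u) ` {u \<in> W. norm u = 1}"
  define m where "m = Inf Q"
  have "(1 / norm w) *\<^sub>R w \<in> {u \<in> W. norm u = 1}"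
    using w W(1) by (simp add: subspace_scale)
  then have ne: "Q \<noteq> {}" by (auto simp: Q_def)
  have bb: "bdd_below Q"
  proof (rule bdd_belowI)
    fix x assume "x \<in> Q"
    then obtain u where u: "norm u = 1" "x = T u \<bullet> u" by (auto simp: Q_def)
    have "\<bar>T u \<bullet> u\<bar> \<le> norm (T u) * norm u" by (rule Cauchy_Schwarz_ineq2)
    also have "\<dots> \<le> norm T" using norm_blinfun[of T u] u by simp
    finally show "- norm T \<le> x" using u by simp
  qed
  have le: "T u \<bullet> u \<ge> m * (norm u)\<^sup>2" if u: "u \<in> W" for u
  proof (cases "u = 0")
    case False
    let ?e = "(1 / norm u) *\<^sub>R u"
    have "?e \<in> {u \<in> W. norm u = 1}"
      using u False W(1) by (simp add: subspace_scale)
    then have "m \<le> T ?e \<bullet> ?e"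
      unfolding m_def by (intro cInf_lower bb) (unfold Q_def, rule imageI)
    also have "\<dots> = (T u \<bullet> u) / (norm u)\<^sup>2"
      by (simp add: blinfun.scaleR_right power2_eq_square)
    finally show ?thesis using False by (simp add: field_simps)
  qed simp
  have "\<exists>v\<in>W. v \<noteq> 0 \<and> T v = m *\<^sub>R v" if fr: "fredholm (T - m *\<^sub>R id_blinfun)"
  proof -
    have "\<exists>u. u \<in> W \<and> norm u = 1 \<and> T u \<bullet> u < m + 1 / real (Suc n)" for n
    proof -
      have "\<exists>x\<in>Q. x < m + 1 / real (Suc n)"
        unfolding m_def using ne by (intro cInf_lessD) auto
      then show ?thesis by (auto simp: Q_def)
    qed
    then have "\<exists>u. \<forall>n. u n \<in> W \<and> norm (u n) = 1 \<and> T (u n) \<bullet> u n < m + 1 / real (Suc n)"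
      by (intro choice allI)
    then obtain u where u: "\<And>n. u n \<in> W" "\<And>n. norm (u n) = 1"
      "\<And>n. T (u n) \<bullet> u n < m + 1 / real (Suc n)" by blast
    let ?S = "T - m *\<^sub>R id_blinfun"
    have nS: "(norm (?S (u n)))\<^sup>2 \<le> (norm ?S + 1) * (1 / real (Suc n))" for n
    proof -
      \<comment> \<open>By the choice of \<open>m\<close> the shifted form is nonnegative on
        \<open>W\<close>. The summand 1 keeps the constant positive even if \<open>?S\<close>
        vanishes.\<close>
      have "(norm (?S (u n)))\<^sup>2 \<le> (norm ?S + 1) * (?S (u n) \<bullet> u n)"
      proof (rule norm_image_le_form[OF selfadjoint_shift[OF sa] W(1)])
        show "?S ` W \<subseteq> W"
        proof (rule image_subsetI)
          fix x assume "x \<in> W"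
          moreover from this have "T x \<in> W" using W(3) by blast
          ultimately show "?S x \<in> W"
            unfolding shift_apply using W(1) by (intro subspace_diff subspace_scale)
        qed
        show "?S x \<bullet> x \<ge> 0" if "x \<in> W" for x
          using le[OF that] unfolding power2_norm_eq_inner shift_apply inner_diff_left inner_scaleR_left
          by linarith
        show "norm ?S + 1 > 0" using norm_ge_zero[of ?S] by linarith
      qed (use u(1) in simp_all)
      also have "?S (u n) \<bullet> u n = T (u n) \<bullet> u n - m"
        using u(2)[of n] unfolding shift_apply inner_diff_left inner_scaleR_left
        by (metis dot_square_norm mult_1_right power_one)
      also have "(norm ?S + 1) * (T (u n) \<bullet> u n - m) \<le> (norm ?S + 1) * (1 / real (Suc n))"
        using u(3)[of n] by (intro mult_left_mono) (auto simp: add_nonneg_nonneg)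
      finally show ?thesis .
    qed
    define h where "h n = (norm ?S + 1) * (1 / real (Suc n))" for n
    have "(\<lambda>n. 1 / real (Suc n)) \<longlonglongrightarrow> 0"
      by (rule LIMSEQ_Suc[OF lim_1_over_n])
    from tendsto_mult_right_zero[OF this, of "norm ?S + 1"] have h: "h \<longlonglongrightarrow> 0"
      unfolding h_def .
    have "(\<lambda>n. (norm (?S (u n)))\<^sup>2) \<longlonglongrightarrow> 0"
    proof (rule tendsto_sandwich[OF _ _ tendsto_const h])
      show "\<forall>\<^sub>F n in sequentially. 0 \<le> (norm (?S (u n)))\<^sup>2"
        by simp
      show "\<forall>\<^sub>F n in sequentially. (norm (?S (u n)))\<^sup>2 \<le> h n"
        using nS by (simp add: h_def)
    qed
    then have "(\<lambda>n. norm (?S (u n))) \<longlonglongrightarrow> 0"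
      by simp
    then have lim: "(\<lambda>n. T (u n) - m *\<^sub>R u n) \<longlonglongrightarrow> 0"
      by (simp add: tendsto_norm_zero_iff)
    have bdd: "norm (u n) \<le> 1" for n using u(2) by simp
    obtain r l where rl: "strict_mono (r :: nat \<Rightarrow> nat)" "(\<lambda>n. u (r n)) \<longlonglongrightarrow> l" "T l = m *\<^sub>R l"
      by (rule fredholm_approx_eigenvector[OF sa fr bdd lim])
    \<comment> \<open>The convergence is in norm, so the limit stays in the closed subspace and
      remains a unit vector.\<close>
    have "l \<in> W"
      using W(2) u(1) rl(2) by (rule closed_sequentially)
    moreover have "l \<noteq> 0"
    proof
      assume "l = 0"
      with tendsto_norm[OF rl(2)] show False by (simp add: u(2) LIMSEQ_const_iff)
    qed
    ultimately show ?thesis using rl(3) by blast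
  qed
  with le show ?thesis by blast
qed

section \<open>Orthogonality and forms on sums of eigenspaces\<close>

lemma eigen_sum_invariant:
  assumes "u \<in> eigen_sum T M" shows "T u \<in> eigen_sum T M"
  using assms unfolding eigen_sum_def
proof (induction rule: span_induct_alt)
  case base
  then show ?case by (simp add: span_zero)
next
  case (step c x y)
  then obtain \<mu> where "\<mu> \<in> M" "T x = \<mu> *\<^sub>R x" by blast
  then have "T x \<in> span (\<Union>\<mu>\<in>M. {u. T u = \<mu> *\<^sub>R u})"
    using step by (simp add: span_scale span_base)
  with step show ?case by (simp add: blinfun.add_right blinfun.scaleR_right span_add span_scale)
qed

lemma eigenvectors_orthogonal:
  assumes "selfadjoint T" "T u = \<mu> *\<^sub>R u" "T v = \<nu> *\<^sub>R v" "\<mu> \<noteq> \<nu>"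
  shows "u \<bullet> v = 0"
proof -
  have "\<mu> * (u \<bullet> v) = \<nu> * (u \<bullet> v)"
    using assms by (metis inner_scaleR_left inner_scaleR_right selfadjoint_def)
  with assms(4) show ?thesis by simp
qed

lemma closed_orthogonal_comp: "closed (W\<^sup>\<bottom>)"
proof -
  have "W\<^sup>\<bottom> = (\<Inter>y\<in>W. {x. y \<bullet> x = 0})"
    by (auto simp: mem_orthogonal_comp)
  moreover have "closed {x. y \<bullet> x = 0}" for y :: 'a
    by (intro closed_Collect_eq continuous_intros)
  ultimately show ?thesis by (simp add: closed_INT)
qed

text \<open>The complement is invariant by selfadjointness. If the infimum \<open>m\<close> of the
  Rayleigh quotient there belonged to \<open>M\<close>, it would be an eigenvalue, with an
  eigenvector both in the sum of eigenspaces and orthogonal to it. The form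
  \<open>m \<notin> M\<close> serves two uses: it means \<open>m > a\<close> for
  \<open>M = {..a}\<close> and \<open>m \<ge> 0\<close> for \<open>M = {..<0}\<close>.\<close>

lemma rayleigh_above_eigen_sum:
  fixes T :: "'h::{real_inner, complete_space} \<Rightarrow>\<^sub>L 'h"
  assumes sa: "selfadjoint T" and fr: "\<And>\<mu>. \<mu> \<le> a \<Longrightarrow> fredholm (T - \<mu> *\<^sub>R id_blinfun)"
    and M: "M \<subseteq> {..a}"
  shows "\<exists>m. m \<notin> M \<and> (\<forall>u\<in>(eigen_sum T M)\<^sup>\<bottom>. T u \<bullet> u \<ge> m * (norm u)\<^sup>2)"
proof (cases "\<exists>w. w \<in> (eigen_sum T M)\<^sup>\<bottom> \<and> w \<noteq> 0")
  case True
  then obtain w where w: "w \<in> (eigen_sum T M)\<^sup>\<bottom>" "w \<noteq> 0" by blast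
  have inv: "T ` ((eigen_sum T M)\<^sup>\<bottom>) \<subseteq> (eigen_sum T M)\<^sup>\<bottom>"
  proof (rule image_subsetI)
    fix u assume u: "u \<in> (eigen_sum T M)\<^sup>\<bottom>"
    have "f \<bullet> T u = 0" if "f \<in> eigen_sum T M" for f
    proof -
      have "f \<bullet> T u = T f \<bullet> u" using sa by (simp add: selfadjoint_def)
      also have "\<dots> = 0"
        using u eigen_sum_invariant[OF that] by (simp add: mem_orthogonal_comp)
      finally show ?thesis .
    qed
    then show "T u \<in> (eigen_sum T M)\<^sup>\<bottom>"
      by (simp add: mem_orthogonal_comp)
  qed
  obtain m where m: "\<forall>u\<in>(eigen_sum T M)\<^sup>\<bottom>. T u \<bullet> u \<ge> m * (norm u)\<^sup>2"
    "fredholm (T - m *\<^sub>R id_blinfun) \<longrightarrow> (\<exists>v\<in>(eigen_sum T M)\<^sup>\<bottom>. v \<noteq> 0 \<and> T v = m *\<^sub>R v)"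
    using rayleigh_infimum[OF sa subspace_orthogonal_comp closed_orthogonal_comp inv w] by blast
  have "m \<notin> M"
  proof
    assume "m \<in> M"
    then have "fredholm (T - m *\<^sub>R id_blinfun)"
      using M by (intro fr) auto
    with m(2) obtain v where v: "v \<in> (eigen_sum T M)\<^sup>\<bottom>" "v \<noteq> 0" "T v = m *\<^sub>R v"
      by blast
    with \<open>m \<in> M\<close> have "v \<in> eigen_sum T M"
      unfolding eigen_sum_def by (intro span_base UN_I[of m]) simp_all
    with v(1,2) show False by (auto simp: mem_orthogonal_comp)
  qed
  with m(1) show ?thesis by blast
next
  case False
  show ?thesis
  \<comment> \<open>The complement is zero, so the bound is trivial and any number outside
    \<open>M\<close> will do.\<close>
  proof (intro exI[of _ "a + 1"] conjI ballI)
    show "a + 1 \<notin> M" using M by force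
    show "T u \<bullet> u \<ge> (a + 1) * (norm u)\<^sup>2" if "u \<in> (eigen_sum T M)\<^sup>\<bottom>" for u
      using False that by auto
  qed
qed

lemma eigen_sum_decompose:
  assumes "f \<in> eigen_sum T M"
  obtains J u where "finite J" "J \<subseteq> M" "f = (\<Sum>\<mu>\<in>J. u \<mu>)" "\<And>\<mu>. \<mu> \<in> J \<Longrightarrow> T (u \<mu>) = \<mu> *\<^sub>R u \<mu>"
    "\<And>\<mu>. \<mu> \<in> J \<Longrightarrow> u \<mu> \<noteq> 0"
proof -
  from assms have "\<exists>J u. finite J \<and> J \<subseteq> M \<and> f = (\<Sum>\<mu>\<in>J. u \<mu>) \<and> (\<forall>\<mu>\<in>J. T (u \<mu>) = \<mu> *\<^sub>R u \<mu>)"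
    unfolding eigen_sum_def
  proof (induction rule: span_induct_alt)
    case base
    show ?case by (rule exI[of _ "{}"]) simp
  next
    case (step c x y)
    then obtain \<mu> J u where x: "\<mu> \<in> M" "T x = \<mu> *\<^sub>R x" and
      y: "finite J" "J \<subseteq> M" "y = (\<Sum>\<mu>\<in>J. u \<mu>)" "\<And>\<mu>. \<mu> \<in> J \<Longrightarrow> T (u \<mu>) = \<mu> *\<^sub>R u \<mu>" by blast
    \<comment> \<open>The new eigenvector is merged with a component for the same eigenvalue, so
      that each eigenvalue keeps a single component and distinct components are orthogonal.\<close>
    define v where "v = u(\<mu> := c *\<^sub>R x + (if \<mu> \<in> J then u \<mu> else 0))"
    have "(\<Sum>\<mu>\<in>insert \<mu> J. v \<mu>) = v \<mu> + (\<Sum>\<mu>\<in>J - {\<mu>}. v \<mu>)"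
      using y(1) by (simp add: sum.insert_remove)
    also have "(\<Sum>\<mu>\<in>J - {\<mu>}. v \<mu>) = (\<Sum>\<mu>\<in>J - {\<mu>}. u \<mu>)"
      by (intro sum.cong) (auto simp: v_def)
    also have "v \<mu> + \<dots> = c *\<^sub>R x + y"
      using y(1) by (auto simp: v_def y(3) sum.remove[of J \<mu> u])
    finally have "c *\<^sub>R x + y = (\<Sum>\<mu>\<in>insert \<mu> J. v \<mu>)" ..
    moreover have "T (v \<nu>) = \<nu> *\<^sub>R v \<nu>" if "\<nu> \<in> insert \<mu> J" for \<nu>
      using that x y(4) by (auto simp: v_def blinfun.add_right blinfun.scaleR_right scaleR_add_right)
    ultimately show ?case
      using x y by (intro exI[of _ "insert \<mu> J"] exI[of _ v]) auto
  qed
  then obtain J u where J: "finite J" "J \<subseteq> M" "f = (\<Sum>\<mu>\<in>J. u \<mu>)" "\<And>\<mu>. \<mu> \<in> J \<Longrightarrow> T (u \<mu>) = \<mu> *\<^sub>R u \<mu>"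
    by blast
  \<comment> \<open>Zero components are dropped because their indices need not be
    eigenvalues.\<close>
  have "f = (\<Sum>\<mu>\<in>{\<mu>\<in>J. u \<mu> \<noteq> 0}. u \<mu>)"
    unfolding J(3) using J(1) by (intro sum.mono_neutral_right) auto
  with J show ?thesis
    by (intro that[of "{\<mu>\<in>J. u \<mu> \<noteq> 0}" u]) auto
qed

text \<open>Orthogonality of the components reduces both sides to weighted sums of their squared
  norms. The bound is asked only at actual eigenvalues, since \<open>M\<close> is typically a whole
  interval reaching beyond them.\<close>

lemma eigen_sum_form_le:
  assumes sa: "selfadjoint T" and f: "f \<in> eigen_sum T M"
    and le: "\<And>\<mu> u. \<mu> \<in> M \<Longrightarrow> T u = \<mu> *\<^sub>R u \<Longrightarrow> u \<noteq> 0 \<Longrightarrow> \<mu> \<le> \<alpha>"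
  shows "T f \<bullet> f \<le> \<alpha> * (norm f)\<^sup>2"
proof -
  obtain J u where J: "finite J" "J \<subseteq> M" "f = (\<Sum>\<mu>\<in>J. u \<mu>)" "\<And>\<mu>. \<mu> \<in> J \<Longrightarrow> T (u \<mu>) = \<mu> *\<^sub>R u \<mu>"
    "\<And>\<mu>. \<mu> \<in> J \<Longrightarrow> u \<mu> \<noteq> 0"
    using eigen_sum_decompose[OF f] by metis
  have o: "u \<mu> \<bullet> u \<nu> = (if \<mu> = \<nu> then (norm (u \<mu>))\<^sup>2 else 0)" if "\<mu> \<in> J" "\<nu> \<in> J" for \<mu> \<nu>
    using eigenvectors_orthogonal[OF sa J(4) J(4)] that by (simp add: power2_norm_eq_inner)
  have "T f \<bullet> f = (\<Sum>\<mu>\<in>J. \<Sum>\<nu>\<in>J. \<mu> * (u \<mu> \<bullet> u \<nu>))"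
  proof -
    have "T f = (\<Sum>\<mu>\<in>J. \<mu> *\<^sub>R u \<mu>)"
      by (simp add: J(3) blinfun.sum_right J(4) cong: sum.cong)
    then show ?thesis
      unfolding inner_sum_left by (simp add: J(3) inner_sum_left inner_sum_right sum_distrib_left) (rule sum.swap)
  qed
  also have "\<dots> = (\<Sum>\<mu>\<in>J. \<mu> * (norm (u \<mu>))\<^sup>2)"
    using J(1) by (intro sum.cong refl) (simp add: o if_distrib cong: if_cong sum.cong)
  also have "\<dots> \<le> (\<Sum>\<mu>\<in>J. \<alpha> * (norm (u \<mu>))\<^sup>2)"
    using J(2) le[OF _ J(4) J(5)] by (intro sum_mono mult_right_mono) auto
  also have "\<dots> = \<alpha> * (\<Sum>\<mu>\<in>J. \<Sum>\<nu>\<in>J. u \<mu> \<bullet> u \<nu>)"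
    using J(1) by (simp add: sum_distrib_left o cong: sum.cong)
  also have "\<dots> = \<alpha> * (norm f)\<^sup>2"
    unfolding power2_norm_eq_inner J(3) inner_sum_left inner_sum_right
    by (rule arg_cong[OF sum.swap])
  finally show ?thesis .
qed

lemma finite_eigenvalues:
  assumes sa: "selfadjoint T" and fd: "finite_dim (eigen_sum T M)"
  shows "finite {\<mu> \<in> M. \<exists>u. u \<noteq> 0 \<and> T u = \<mu> *\<^sub>R u}"
proof -
  define \<Lambda> where "\<Lambda> = {\<mu> \<in> M. \<exists>u. u \<noteq> 0 \<and> T u = \<mu> *\<^sub>R u}"
  have "\<forall>\<mu>\<in>\<Lambda>. \<exists>u. u \<noteq> 0 \<and> T u = \<mu> *\<^sub>R u"
    by (simp add: \<Lambda>_def)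
  then obtain v where v: "\<forall>\<mu>\<in>\<Lambda>. v \<mu> \<noteq> 0 \<and> T (v \<mu>) = \<mu> *\<^sub>R v \<mu>"
    by (rule bchoice[THEN exE])
  have inj: "inj_on v \<Lambda>"
  proof (rule inj_onI)
    fix \<mu> \<nu> assume "\<mu> \<in> \<Lambda>" "\<nu> \<in> \<Lambda>" "v \<mu> = v \<nu>"
    with v have "\<mu> *\<^sub>R v \<mu> = \<nu> *\<^sub>R v \<mu>" "v \<mu> \<noteq> 0" by metis+
    then show "\<mu> = \<nu>" by simp
  qed
  have "v \<mu> \<bullet> v \<nu> = 0" if "\<mu> \<in> \<Lambda>" "\<nu> \<in> \<Lambda>" "\<mu> \<noteq> \<nu>" for \<mu> \<nu>
    using eigenvectors_orthogonal[OF sa _ _ that(3)] v that(1,2) by blast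
  then have "pairwise real_inner_class.orthogonal (v ` \<Lambda>)"
    unfolding pairwise_def real_inner_class.orthogonal_def by blast
  moreover have "0 \<notin> v ` \<Lambda>" using v by force
  ultimately have "independent (v ` \<Lambda>)"
    by (rule pairwise_orthogonal_independent)
  moreover obtain B where B: "finite B" "eigen_sum T M \<subseteq> span B"
    using fd unfolding finite_dim_def by blast
  moreover have "v ` \<Lambda> \<subseteq> eigen_sum T M"
  proof (rule image_subsetI)
    fix \<mu> assume "\<mu> \<in> \<Lambda>"
    then show "v \<mu> \<in> eigen_sum T M"
      using v unfolding eigen_sum_def by (intro span_base UN_I[of \<mu>]) (simp_all add: \<Lambda>_def)
  qed
  ultimately have "finite (v ` \<Lambda>)"
    using independent_span_bound[OF B(1)] by blast
  then show ?thesis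
    using inj unfolding \<Lambda>_def by (rule finite_imageD)
qed

text \<open>Finite dimension leaves finitely many eigenvalues in \<open>M\<close>, so a strict bound
  holds with a uniform margin.\<close>

lemma eigen_sum_form_less:
  assumes sa: "selfadjoint T" and fd: "finite_dim (eigen_sum T M)"
    and less: "\<And>\<mu> u. \<mu> \<in> M \<Longrightarrow> T u = \<mu> *\<^sub>R u \<Longrightarrow> u \<noteq> 0 \<Longrightarrow> \<mu> < b"
  shows "\<exists>\<alpha><b. \<forall>f\<in>eigen_sum T M. T f \<bullet> f \<le> \<alpha> * (norm f)\<^sup>2"
proof -
  \<comment> \<open>\<open>b - 1\<close> guarantees a nonempty set below \<open>b\<close>, so
    \<open>Max\<close> is meaningful even without eigenvalues.\<close>
  define \<Lambda> where "\<Lambda> = insert (b - 1) {\<mu> \<in> M. \<exists>u. u \<noteq> 0 \<and> T u = \<mu> *\<^sub>R u}"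
  have fin: "finite \<Lambda>" unfolding \<Lambda>_def using finite_eigenvalues[OF sa fd] by simp
  have "\<Lambda> \<noteq> {}" by (simp add: \<Lambda>_def)
  with fin have "Max \<Lambda> < b"
    using less by (auto simp: \<Lambda>_def)
  moreover have "T f \<bullet> f \<le> Max \<Lambda> * (norm f)\<^sup>2" if "f \<in> eigen_sum T M" for f
    using sa that by (rule eigen_sum_form_le) (auto intro!: Max_ge fin, auto simp: \<Lambda>_def)
  ultimately show ?thesis by blast
qed

text \<open>Each eigenspace is finite dimensional as the kernel of a Fredholm operator, so only
  finiteness of the set of eigenvalues is at stake. Infinitely many would accumulate at some
  \<open>\<mu> \<le> a\<close>, being bounded by \<open>norm T\<close>; their orthonormal
  eigenvectors would then be an approximate kernel sequence at \<open>\<mu>\<close> and have a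
  convergent subsequence.\<close>

lemma finite_dim_eigen_sum:
  fixes T :: "'h::{real_inner, complete_space} \<Rightarrow>\<^sub>L 'h"
  assumes sa: "selfadjoint T" and fr: "\<And>\<mu>. \<mu> \<le> a \<Longrightarrow> fredholm (T - \<mu> *\<^sub>R id_blinfun)"
  shows "finite_dim (eigen_sum T {..a})"
proof -
  define \<Lambda> where "\<Lambda> = {\<mu>. \<mu> \<le> a \<and> (\<exists>u. u \<noteq> 0 \<and> T u = \<mu> *\<^sub>R u)}"
  have fin: "finite \<Lambda>"
  proof (rule ccontr)
    assume "infinite \<Lambda>"
    then obtain f :: "nat \<Rightarrow> real" where f: "inj f" "range f \<subseteq> \<Lambda>"
      using infinite_countable_subset by blast
    have "\<exists>e. norm e = 1 \<and> T e = f n *\<^sub>R e" for n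
    proof -
      obtain u where "u \<noteq> 0" "T u = f n *\<^sub>R u" using f(2) by (auto simp: \<Lambda>_def)
      then show ?thesis
        by (intro exI[of _ "(1 / norm u) *\<^sub>R u"]) (simp add: blinfun.scaleR_right mult.commute)
    qed
    then obtain e where e: "\<And>n. norm (e n) = 1" "\<And>n. T (e n) = f n *\<^sub>R e n" by metis
    have "\<bar>f n\<bar> \<le> norm T" for n
      using norm_blinfun[of T "e n"] e by simp
    then have "bounded (range f)" by (auto simp: bounded_iff)
    then obtain \<mu> q where q: "strict_mono q" "(f \<circ> q) \<longlonglongrightarrow> \<mu>"
      using bounded_imp_convergent_subsequence by blast
    have "\<mu> \<le> a"
      using q(2) by (rule LIMSEQ_le_const2) (use f(2) in \<open>auto simp: \<Lambda>_def\<close>)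
    have "(\<lambda>n. norm ((f (q n) - \<mu>) *\<^sub>R e (q n))) \<longlonglongrightarrow> \<bar>\<mu> - \<mu>\<bar>"
      unfolding norm_scaleR e(1) mult_1_right using q(2) by (intro tendsto_intros) (simp add: o_def)
    then have lim: "(\<lambda>n. T (e (q n)) - \<mu> *\<^sub>R e (q n)) \<longlonglongrightarrow> 0"
      by (simp add: tendsto_norm_zero_iff e(2) scaleR_diff_left)
    have bdd: "norm (e (q n)) \<le> 1" for n using e(1) by simp
    obtain r l where rl: "strict_mono (r :: nat \<Rightarrow> nat)" "(\<lambda>n. e (q (r n))) \<longlonglongrightarrow> l" "T l = \<mu> *\<^sub>R l"
      by (rule fredholm_approx_eigenvector[OF sa fr[OF \<open>\<mu> \<le> a\<close>] bdd lim])
    \<comment> \<open>Neighbouring terms have the same limit but are orthogonal, which contradicts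
      \<open>norm l = 1\<close>.\<close>
    have "(\<lambda>n. e (q (r (Suc n))) \<bullet> e (q (r n))) \<longlonglongrightarrow> l \<bullet> l"
      by (intro tendsto_inner rl(2) LIMSEQ_Suc[OF rl(2)])
    moreover have "e (q (r (Suc n))) \<bullet> e (q (r n)) = 0" for n
    proof (rule eigenvectors_orthogonal[OF sa e(2) e(2)])
      show "f (q (r (Suc n))) \<noteq> f (q (r n))"
        using f(1) q(1) rl(1) by (metis injD lessI strict_mono_less less_irrefl)
    qed
    ultimately have "l \<bullet> l = 0"
      by (simp add: LIMSEQ_const_iff)
    moreover have "norm l = 1"
      using tendsto_norm[OF rl(2)] e(1) by (simp add: LIMSEQ_const_iff)
    ultimately show False by simp
  qed
  have "\<forall>\<mu>\<in>\<Lambda>. \<exists>B. finite B \<and> {u. T u = \<mu> *\<^sub>R u} \<subseteq> span B"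
    using fr by (simp add: \<Lambda>_def fredholm_def finite_dim_def)
  then obtain B where B: "\<And>\<mu>. \<mu> \<in> \<Lambda> \<Longrightarrow> finite (B \<mu>) \<and> {u. T u = \<mu> *\<^sub>R u} \<subseteq> span (B \<mu>)"
    by metis
  have "eigen_sum T {..a} \<subseteq> span (\<Union>\<mu>\<in>\<Lambda>. B \<mu>)"
    unfolding eigen_sum_def
  proof (intro span_minimal subspace_span UN_least subsetI)
    fix \<mu> u assume \<mu>: "\<mu> \<in> {..a}" and u: "u \<in> {u. T u = \<mu> *\<^sub>R u}"
    show "u \<in> span (\<Union>\<mu>\<in>\<Lambda>. B \<mu>)"
    proof (cases "u = 0")
      case False
      with \<mu> u have "\<mu> \<in> \<Lambda>" by (auto simp: \<Lambda>_def)
      with B[OF this] u span_mono[of "B \<mu>" "\<Union>\<mu>\<in>\<Lambda>. B \<mu>"] show ?thesis by blast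
    qed (simp add: span_zero)
  qed
  with fin B show ?thesis
    unfolding finite_dim_def by (intro exI[of _ "\<Union>\<mu>\<in>\<Lambda>. B \<mu>"]) auto
qed

section \<open>Orthogonal projections and coercive operators\<close>

definition orthonormal :: "nat \<Rightarrow> (nat \<Rightarrow> 'h::real_inner) \<Rightarrow> bool" where
  "orthonormal n b \<longleftrightarrow> (\<forall>i<n. \<forall>j<n. b i \<bullet> b j = (if i = j then 1 else 0))"

definition oproj :: "nat \<Rightarrow> (nat \<Rightarrow> 'h) \<Rightarrow> 'h \<Rightarrow> 'h::real_inner" where
  "oproj n b u = (\<Sum>i<n. (u \<bullet> b i) *\<^sub>R b i)"

lemma orthonormal_basis_exists:
  fixes F :: "'h::real_inner set"
  assumes F: "subspace F" "finite_dim F"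
  obtains n b where "orthonormal n b" "span (b ` {..<n}) = F"
proof -
  obtain B where B: "finite B" "F \<subseteq> span B"
    using F(2) unfolding finite_dim_def by blast
  obtain I where I: "I \<subseteq> F" "independent I" "F \<subseteq> span I"
    by (rule maximal_independent_subset)
  have "finite I"
    using independent_span_bound[OF B(1) I(2)] I(1) B(2) by blast
  then obtain C where C: "finite C" "span C = span I" "pairwise real_inner_class.orthogonal C"
    using basis_orthogonal by blast
  have spF: "span I = F"
    using I(1,3) F(1) by (metis span_minimal subset_antisym)
  \<comment> \<open>An orthogonal set may contain 0, which cannot be normalised.\<close>
  let ?C = "C - {0}"
  obtain h where h: "bij_betw h {..<card ?C} ?C"
    using C(1) ex_bij_betw_nat_finite[of ?C] by (auto simp: atLeast0LessThan)
  define b where "b i = (1 / norm (h i)) *\<^sub>R h i" for i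
  have hC: "h i \<in> ?C" if "i < card ?C" for i
    using h that by (auto simp: bij_betw_def)
  have "b i \<bullet> b j = (if i = j then 1 else 0)" if ij: "i < card ?C" "j < card ?C" for i j
  proof (cases "i = j")
    case True
    with hC[OF ij(1)] show ?thesis
      by (simp add: b_def power2_norm_eq_inner[symmetric] power2_eq_square)
  next
    case False
    then have "h i \<noteq> h j"
      using h ij by (auto simp: bij_betw_def inj_on_def)
    then have "h i \<bullet> h j = 0"
      using C(3) hC[OF ij(1)] hC[OF ij(2)] unfolding pairwise_def real_inner_class.orthogonal_def by blast
    with False show ?thesis by (simp add: b_def)
  qed
  then have "orthonormal (card ?C) b" by (simp add: orthonormal_def)
  moreover have "span (b ` {..<card ?C}) = F"
  proof -
    have "b ` {..<card ?C} \<subseteq> span C"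
      using hC by (auto simp: b_def intro!: span_scale intro: span_base)
    moreover have "C \<subseteq> span (b ` {..<card ?C})"
    proof
      fix c assume "c \<in> C"
      show "c \<in> span (b ` {..<card ?C})"
      proof (cases "c = 0")
        case False
        with \<open>c \<in> C\<close> have "c \<in> h ` {..<card ?C}"
          using h by (simp add: bij_betw_def)
        then obtain i where i: "i < card ?C" "c = h i" by blast
        have "c = norm (h i) *\<^sub>R b i"
          using False unfolding b_def i(2) by simp
        with i(1) show ?thesis by (simp add: span_scale span_base)
      qed (simp add: span_zero)
    qed
    ultimately have "span (b ` {..<card ?C}) = span C"
      by (metis span_minimal subspace_span subset_antisym)
    with C(2) spF show ?thesis by simp
  qed
  ultimately show ?thesis by (rule that)
qed

lemma oproj_in_span: "oproj n b u \<in> span (b ` {..<n})"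
  unfolding oproj_def by (intro span_sum span_scale span_base) auto

lemma oproj_orthogonal:
  assumes "orthonormal n b" shows "u - oproj n b u \<in> (span (b ` {..<n}))\<^sup>\<bottom>"
proof -
  have b: "b i \<bullet> (u - oproj n b u) = 0" if "i < n" for i
  proof -
    have "b i \<bullet> oproj n b u = (\<Sum>j<n. (u \<bullet> b j) * (if i = j then 1 else 0))"
      unfolding oproj_def inner_sum_right inner_scaleR_right
      using assms that by (intro sum.cong refl) (simp add: orthonormal_def)
    also have "\<dots> = b i \<bullet> u" using that by (simp add: inner_commute if_distrib cong: if_cong)
    finally show ?thesis by (simp add: inner_diff_right)
  qed
  have "y \<bullet> (u - oproj n b u) = 0" if "y \<in> span (b ` {..<n})" for y
    using that
  proof (induction rule: span_induct_alt)
    case (step c x y)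
    then show ?case using b by (auto simp: inner_add_left)
  qed simp
  then show ?thesis by (simp add: mem_orthogonal_comp)
qed

lemma orthogonal_comp_Int: "u \<in> F \<Longrightarrow> u \<in> F\<^sup>\<bottom> \<Longrightarrow> u = 0"
  by (auto simp: mem_orthogonal_comp)

lemma linear_oproj: "linear (oproj n b)"
  by (rule linearI) (simp_all add: oproj_def inner_add_left scaleR_add_left sum.distrib scaleR_sum_right)

lemma oproj_unique:
  assumes "orthonormal n b" "f \<in> span (b ` {..<n})" "u - f \<in> (span (b ` {..<n}))\<^sup>\<bottom>"
  shows "oproj n b u = f"
proof -
  have "oproj n b u - f \<in> span (b ` {..<n})"
    using assms(2) oproj_in_span by (intro span_diff)
  moreover have "oproj n b u - f = (u - f) - (u - oproj n b u)"
    by simp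
  then have "oproj n b u - f \<in> (span (b ` {..<n}))\<^sup>\<bottom>"
    using subspace_diff[OF subspace_orthogonal_comp assms(3) oproj_orthogonal[OF assms(1), of u]] by simp
  ultimately have "oproj n b u - f = 0"
    by (rule orthogonal_comp_Int)
  then show ?thesis by simp
qed

lemma orthogonal_decomposition:
  fixes F :: "'h::real_inner set"
  assumes "subspace F" "finite_dim F"
  obtains f w where "f \<in> F" "w \<in> F\<^sup>\<bottom>" "u = f + w"
proof -
  obtain n b where b: "orthonormal n b" "span (b ` {..<n}) = F"
    using assms by (rule orthonormal_basis_exists)
  show ?thesis
    by (rule that[of "oproj n b u" "u - oproj n b u"])
       (use oproj_in_span[of n b u] oproj_orthogonal[OF b(1), of u] b(2) in auto)
qed

text \<open>The Lax-Milgram argument: solutions of \<open>A x = y\<close> are the fixed points of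
  \<open>x - \<tau> *\<^sub>R (A x - y)\<close>, a contraction of the complete set \<open>W\<close>
  for a suitable \<open>\<tau>\<close>. Everything is required on \<open>W\<close> only, so that
  compressions of operators to a subspace are covered.\<close>

lemma coercive_surjective:
  fixes A :: "'h::{real_inner, complete_space} \<Rightarrow> 'h"
  assumes W: "subspace W" "closed W" and AW: "\<And>x. x \<in> W \<Longrightarrow> A x \<in> W"
    and diff: "\<And>x y. x \<in> W \<Longrightarrow> y \<in> W \<Longrightarrow> A (x - y) = A x - A y"
    and bdd: "\<And>x. x \<in> W \<Longrightarrow> norm (A x) \<le> M * norm x"
    and c: "c > 0" "\<And>x. x \<in> W \<Longrightarrow> A x \<bullet> x \<ge> c * (norm x)\<^sup>2"
    and y: "y \<in> W"
  shows "\<exists>x\<in>W. A x = y"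
proof -
  \<comment> \<open>Adding \<open>c\<close> gives \<open>0 < K\<close> and \<open>c \<le> K\<close>,
    which keeps the radicand in \<open>q\<close> nonnegative.\<close>
  define K where "K = \<bar>M\<bar> + c"
  have K: "K > 0" "c \<le> K" using c(1) by (auto simp: K_def)
  have bdd': "norm (A x) \<le> K * norm x" if "x \<in> W" for x
    using bdd[OF that] by (rule order_trans) (use c(1) in \<open>simp add: K_def mult_right_mono\<close>)
  \<comment> \<open>The minimiser of \<open>1 - 2 * \<tau> * c + \<tau>\<^sup>2 * K\<^sup>2\<close>,
    the bound for the squared contraction factor; the minimum is \<open>q\<^sup>2\<close>.\<close>
  define \<tau> where "\<tau> = c / K\<^sup>2"
  have \<tau>: "\<tau> > 0" using c K by (simp add: \<tau>_def)
  define q where "q = sqrt (1 - c\<^sup>2 / K\<^sup>2)"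
  have q1: "0 \<le> 1 - c\<^sup>2 / K\<^sup>2"
    using K c(1) by (simp add: field_simps power_mono)
  have q: "0 \<le> q" "q < 1" "q\<^sup>2 = 1 - c\<^sup>2 / K\<^sup>2"
    using q1 c(1) K by (auto simp: q_def)
  define \<Phi> where "\<Phi> x = x - \<tau> *\<^sub>R (A x - y)" for x
  have contr: "norm (x - \<tau> *\<^sub>R A x) \<le> q * norm x" if x: "x \<in> W" for x
  proof (rule power2_le_imp_le)
    have "(norm (x - \<tau> *\<^sub>R A x))\<^sup>2 = (norm x)\<^sup>2 - 2 * \<tau> * (A x \<bullet> x) + \<tau>\<^sup>2 * (norm (A x))\<^sup>2"
      unfolding power2_norm_eq_inner inner_diff_left inner_diff_right
      by (simp add: inner_commute power2_eq_square algebra_simps)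
    also have "\<dots> \<le> (norm x)\<^sup>2 - 2 * \<tau> * (c * (norm x)\<^sup>2) + \<tau>\<^sup>2 * (K * norm x)\<^sup>2"
      using c(2)[OF x] bdd'[OF x] \<tau>
      by (intro add_mono diff_mono mult_left_mono power_mono) auto
    also have "\<dots> = (1 - 2 * \<tau> * c + \<tau>\<^sup>2 * K\<^sup>2) * (norm x)\<^sup>2"
      by (simp add: algebra_simps power_mult_distrib)
    also have "1 - 2 * \<tau> * c + \<tau>\<^sup>2 * K\<^sup>2 = q\<^sup>2"
      unfolding q(3) using K(1) by (simp add: \<tau>_def field_simps power2_eq_square)
    finally show "(norm (x - \<tau> *\<^sub>R A x))\<^sup>2 \<le> (q * norm x)\<^sup>2"
      by (simp add: power_mult_distrib)
  qed (use q in auto)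
  have "\<exists>!x\<in>W. \<Phi> x = x"
  proof (rule Banach_fix)
    show "complete W" using W(2) by (simp add: complete_eq_closed)
    show "W \<noteq> {}" using y by blast
    show "\<Phi> ` W \<subseteq> W"
      unfolding \<Phi>_def using W(1) AW y by (intro image_subsetI subspace_diff subspace_scale)
    show "dist (\<Phi> x) (\<Phi> z) \<le> q * dist x z" if "x \<in> W" "z \<in> W" for x z
    proof -
      have "\<Phi> x - \<Phi> z = (x - z) - \<tau> *\<^sub>R A (x - z)"
        using that by (simp add: \<Phi>_def diff algebra_simps)
      then show ?thesis
        using contr[OF subspace_diff[OF W(1) that]] by (simp add: dist_norm)
    qed
  qed (use q in auto)
  then obtain x where "x \<in> W" "\<Phi> x = x" by blast
  with \<tau> show ?thesis by (auto simp: \<Phi>_def)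
qed

section \<open>Spectral gaps and their stability\<close>

text \<open>\<open>S\<close> itself need not be coercive, but its square is, because
  \<open>S (S x) \<bullet> x\<close> is the square of \<open>norm (S x)\<close>. Hence the square,
  and with it \<open>S\<close>, is surjective; the lower bound gives injectivity and the norm bound
  \<open>1 / c\<close> for the inverse.\<close>

lemma bounded_below_imp_invertible:
  fixes S :: "'h::{real_inner, complete_space} \<Rightarrow>\<^sub>L 'h"
  assumes sa: "selfadjoint S" and c: "c > 0" "\<And>u. norm (S u) \<ge> c * norm u"
  shows "\<exists>R. R o\<^sub>L S = id_blinfun \<and> S o\<^sub>L R = id_blinfun"
proof -
  have "\<exists>x. S x = y" for y
  proof -
    have "\<exists>x\<in>UNIV. S (S x) = y"
    proof (rule coercive_surjective)
      show "norm (S (S x)) \<le> (norm S * norm S) * norm x" for x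
        using norm_blinfun[of S "S x"] mult_left_mono[OF norm_blinfun[of S x] norm_ge_zero[of S]]
        by (simp add: mult.assoc)
      show "S (S x) \<bullet> x \<ge> c\<^sup>2 * (norm x)\<^sup>2" for x
      proof -
        have "(c * norm x)\<^sup>2 \<le> (norm (S x))\<^sup>2"
          using c by (intro power_mono) auto
        also have "\<dots> = S (S x) \<bullet> x"
          using sa unfolding selfadjoint_def power2_norm_eq_inner by metis
        finally show ?thesis by (simp add: power_mult_distrib)
      qed
    qed (use c(1) in \<open>simp_all add: blinfun.diff_right\<close>)
    then show ?thesis by blast
  qed
  then obtain g where g: "\<And>y. S (g y) = y" by metis
  have inj: "x = y" if "S x = S y" for x y
    using c(2)[of "x - y"] that c(1) by (simp add: blinfun.diff_right mult_le_0_iff)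
  have gS: "g (S x) = x" for x by (rule inj) (simp add: g)
  have "bounded_linear g"
  proof (rule bounded_linear_intro)
    show "g (x + y) = g x + g y" for x y
      by (rule inj) (simp add: g blinfun.add_right)
    show "g (r *\<^sub>R x) = r *\<^sub>R g x" for r x
      by (rule inj) (simp add: g blinfun.scaleR_right)
    show "norm (g x) \<le> norm x * (1 / c)" for x
      using c(2)[of "g x"] c(1) by (simp add: g field_simps)
  qed
  then have "blinfun_apply (Blinfun g) = g" by (rule bounded_linear_Blinfun_apply)
  then show ?thesis
    by (intro exI[of _ "Blinfun g"] conjI blinfun_eqI) (simp_all add: g gS)
qed

lemma bounded_below_not_in_op_spectrum:
  fixes T :: "'h::{real_inner, complete_space} \<Rightarrow>\<^sub>L 'h"
  assumes "selfadjoint T" "c > 0" "\<And>u. norm (T u - \<mu> *\<^sub>R u) \<ge> c * norm u"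
  shows "\<mu> \<notin> op_spectrum T"
  using bounded_below_imp_invertible[OF selfadjoint_shift[OF assms(1)] assms(2)] assms(3)
  by (simp add: op_spectrum_def)

lemma eigenvalue_in_op_spectrum:
  fixes T :: "'h::real_normed_vector \<Rightarrow>\<^sub>L 'h"
  assumes "T u = \<mu> *\<^sub>R u" "u \<noteq> 0"
  shows "\<mu> \<in> op_spectrum T"
proof -
  have False if R: "R o\<^sub>L (T - \<mu> *\<^sub>R id_blinfun) = id_blinfun" for R
  proof -
    have "u = (R o\<^sub>L (T - \<mu> *\<^sub>R id_blinfun)) u" by (simp add: R)
    also have "\<dots> = 0" using assms(1) by (simp add: blinfun.zero_right)
    finally show False using assms(2) by simp
  qed
  then show ?thesis by (auto simp: op_spectrum_def)
qed

text \<open>The form of \<open>T - \<mu>\<close> is at most \<open>- c\<close> on \<open>F\<close>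
  and at least \<open>c\<close> on the complement, so the shift is bounded below on each part. The
  images of the two parts are again orthogonal, by invariance of \<open>F\<close> and
  selfadjointness, and Pythagoras combines the bounds.\<close>

lemma bounded_below_in_gap:
  fixes T :: "'h::real_inner \<Rightarrow>\<^sub>L 'h"
  assumes sa: "selfadjoint T" and F: "subspace F" "finite_dim F" "\<And>f. f \<in> F \<Longrightarrow> T f \<in> F"
    and le: "\<And>f. f \<in> F \<Longrightarrow> T f \<bullet> f \<le> \<alpha> * (norm f)\<^sup>2"
    and ge: "\<And>w. w \<in> F\<^sup>\<bottom> \<Longrightarrow> T w \<bullet> w \<ge> \<beta> * (norm w)\<^sup>2"
    and c: "c \<ge> 0" "\<alpha> + c \<le> \<mu>" "\<mu> \<le> \<beta> - c"
  shows "norm (T u - \<mu> *\<^sub>R u) \<ge> c * norm u"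
proof (rule power2_le_imp_le)
  obtain f w where f: "f \<in> F" and w: "w \<in> F\<^sup>\<bottom>" and u: "u = f + w"
    using F(1,2) by (rule orthogonal_decomposition)
  let ?S = "T - \<mu> *\<^sub>R id_blinfun"
  have aux: "c * norm v \<le> norm (?S v)" if "c * (norm v)\<^sup>2 \<le> \<bar>?S v \<bullet> v\<bar>" for v
  proof (cases "v = 0")
    case False
    have "c * (norm v)\<^sup>2 \<le> norm (?S v) * norm v"
      using that Cauchy_Schwarz_ineq2[of "?S v" v] by linarith
    with False show ?thesis by (simp add: power2_eq_square)
  qed simp
  have cf: "c * norm f \<le> norm (?S f)"
  proof (rule aux)
    have "(\<alpha> + c) * (norm f)\<^sup>2 \<le> \<mu> * (norm f)\<^sup>2" by (intro mult_right_mono c) simp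
    with le[OF f] have "c * (norm f)\<^sup>2 \<le> \<mu> * (norm f)\<^sup>2 - T f \<bullet> f" by (simp add: algebra_simps)
    also have "\<dots> = - (?S f \<bullet> f)"
      unfolding shift_apply inner_diff_left inner_scaleR_left power2_norm_eq_inner by simp
    also have "\<dots> \<le> \<bar>?S f \<bullet> f\<bar>" by simp
    finally show "c * (norm f)\<^sup>2 \<le> \<bar>?S f \<bullet> f\<bar>" .
  qed
  have cw: "c * norm w \<le> norm (?S w)"
  proof (rule aux)
    have "\<mu> * (norm w)\<^sup>2 \<le> (\<beta> - c) * (norm w)\<^sup>2" by (intro mult_right_mono c) simp
    with ge[OF w] have "c * (norm w)\<^sup>2 \<le> T w \<bullet> w - \<mu> * (norm w)\<^sup>2" by (simp add: algebra_simps)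
    also have "\<dots> = ?S w \<bullet> w"
      unfolding shift_apply inner_diff_left inner_scaleR_left power2_norm_eq_inner by simp
    also have "\<dots> \<le> \<bar>?S w \<bullet> w\<bar>" by simp
    finally show "c * (norm w)\<^sup>2 \<le> \<bar>?S w \<bullet> w\<bar>" .
  qed
  have fw: "y \<bullet> w = 0" if "y \<in> F" for y
    using w that by (simp add: mem_orthogonal_comp)
  have Sf: "?S f \<in> F"
    unfolding shift_apply using F(1) F(3)[OF f] f by (intro subspace_diff subspace_scale)
  have "?S f \<bullet> ?S w = ?S (?S f) \<bullet> w"
    using selfadjoint_shift[OF sa] unfolding selfadjoint_def by metis
  moreover have "?S (?S f) \<in> F"
    unfolding shift_apply[of T \<mu> "?S f"] using F(1) F(3)[OF Sf] Sf by (intro subspace_diff subspace_scale)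
  ultimately have o: "?S f \<bullet> ?S w = 0" by (simp only: fw)
  have "(c * norm u)\<^sup>2 = (c * norm f)\<^sup>2 + (c * norm w)\<^sup>2"
    using fw[OF f] unfolding power_mult_distrib power2_norm_eq_inner u
    by (simp add: inner_add_left inner_add_right inner_commute algebra_simps)
  also have "\<dots> \<le> (norm (?S f))\<^sup>2 + (norm (?S w))\<^sup>2"
    using cf cw c(1) by (intro add_mono power_mono) auto
  also have "\<dots> = (norm (?S f + ?S w))\<^sup>2"
    using o unfolding power2_norm_eq_inner
    by (simp add: inner_add_left inner_add_right inner_commute del: shift_apply)
  also have "?S f + ?S w = T u - \<mu> *\<^sub>R u"
    by (simp add: u blinfun.add_right scaleR_add_right)
  finally show "(c * norm u)\<^sup>2 \<le> (norm (T u - \<mu> *\<^sub>R u))\<^sup>2" .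
qed simp

text \<open>On the complement of the kernel \<open>S\<close> is bounded below: otherwise unit
  vectors with images tending to 0 would accumulate at a unit vector lying both in the kernel and in
  its complement. The range is thus the image of a complete set under a map bounded below, hence
  complete.\<close>

lemma finite_codim_closed_range:
  fixes S :: "'h::{real_inner, complete_space} \<Rightarrow>\<^sub>L 'h"
  assumes sa: "selfadjoint S" and ker: "finite_dim {u. S u = 0}"
    and B: "finite B" "span (range S \<union> B) = UNIV"
  shows "closed (range S)"
proof -
  let ?N = "{u. S u = 0}"
  have N: "subspace ?N"
    by (auto intro!: subspaceI simp: blinfun.zero_right blinfun.add_right blinfun.scaleR_right)
  have "\<exists>e>0. \<forall>x\<in>?N\<^sup>\<bottom>. norm (S x) \<ge> e * norm x"
  proof (rule ccontr)
    assume not: "\<not> ?thesis"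
    have "\<exists>x. x \<in> ?N\<^sup>\<bottom> \<and> norm x = 1 \<and> norm (S x) < 1 / real (Suc n)" for n
    proof -
      have "\<not> (\<forall>x\<in>?N\<^sup>\<bottom>. norm (S x) \<ge> (1 / real (Suc n)) * norm x)"
        using not by (metis of_nat_0_less_iff zero_less_Suc zero_less_divide_1_iff)
      then obtain x where x: "x \<in> ?N\<^sup>\<bottom>" "norm (S x) < (1 / real (Suc n)) * norm x"
        by (auto simp: not_le)
      then have "x \<noteq> 0" by auto
      have "norm (S ((1 / norm x) *\<^sub>R x)) = norm (S x) / norm x"
        by (simp add: blinfun.scaleR_right)
      also have "\<dots> < 1 / real (Suc n)"
        using x(2) \<open>x \<noteq> 0\<close> by (simp add: pos_divide_less_eq)
      finally show ?thesis
        using \<open>x \<noteq> 0\<close> subspace_scale[OF subspace_orthogonal_comp x(1)]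
        by (intro exI[of _ "(1 / norm x) *\<^sub>R x"]) simp
    qed
    then have "\<exists>x. \<forall>n. x n \<in> ?N\<^sup>\<bottom> \<and> norm (x n) = 1 \<and> norm (S (x n)) < 1 / real (Suc n)"
      by (intro choice allI)
    then obtain x where x: "\<And>n. x n \<in> ?N\<^sup>\<bottom>" "\<And>n. norm (x n) = 1"
      "\<And>n. norm (S (x n)) < 1 / real (Suc n)" by blast
    have h: "(\<lambda>n. 1 / real (Suc n)) \<longlonglongrightarrow> 0"
      by (rule LIMSEQ_Suc[OF lim_1_over_n])
    have "(\<lambda>n. norm (S (x n))) \<longlonglongrightarrow> 0"
    proof (rule tendsto_sandwich[OF _ _ tendsto_const h])
      show "\<forall>\<^sub>F n in sequentially. norm (S (x n)) \<le> 1 / real (Suc n)"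
        using x(3) by (intro always_eventually allI less_imp_le)
    qed simp
    then have lim: "(\<lambda>n. S (x n)) \<longlonglongrightarrow> 0"
      by (rule tendsto_norm_zero_cancel)
    have bdd: "norm (x n) \<le> 1" for n using x(2) by simp
    obtain r l where r: "strict_mono (r :: nat \<Rightarrow> nat)" "(\<lambda>n. x (r n)) \<longlonglongrightarrow> l"
      by (rule finite_codim_approx_kernel_convergent[OF sa B bdd lim])
    have "(\<lambda>n. S (x (r n))) \<longlonglongrightarrow> S l"
      by (intro tendsto_intros r(2))
    moreover have "(\<lambda>n. S (x (r n))) \<longlonglongrightarrow> 0"
      using LIMSEQ_subseq_LIMSEQ[OF lim r(1)] by (simp add: o_def)
    ultimately have "S l = 0" by (rule LIMSEQ_unique)
    moreover have "l \<in> ?N\<^sup>\<bottom>"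
      using closed_orthogonal_comp x(1) r(2) by (rule closed_sequentially)
    ultimately have "l = 0" by (intro orthogonal_comp_Int[of l ?N]) simp_all
    with tendsto_norm[OF r(2)] show False by (simp add: x(2) LIMSEQ_const_iff)
  qed
  then obtain e where e: "e > 0" "\<forall>x\<in>?N\<^sup>\<bottom>. norm (S x) \<ge> e * norm x" by blast
  have "complete (S ` (?N\<^sup>\<bottom>))"
    by (rule complete_isometric_image[OF e(1) subspace_orthogonal_comp blinfun.bounded_linear_right e(2)])
       (simp add: complete_eq_closed closed_orthogonal_comp)
  moreover have "range S \<subseteq> S ` (?N\<^sup>\<bottom>)"
  proof (rule image_subsetI)
    fix x
    obtain f w where "f \<in> ?N" and w: "w \<in> ?N\<^sup>\<bottom>" "x = f + w"
      using N ker by (rule orthogonal_decomposition)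
    then have "S x = S w" by (simp add: blinfun.add_right)
    with w(1) show "S x \<in> S ` (?N\<^sup>\<bottom>)" by (intro image_eqI[of _ _ w])
  qed
  then have "S ` (?N\<^sup>\<bottom>) = range S"
    by (rule subset_antisym[OF image_mono[OF subset_UNIV]])
  ultimately show ?thesis by (simp add: complete_imp_closed)
qed

text \<open>The compression of \<open>S\<close> to the complement of \<open>F\<close> is coercive,
  hence onto, so every vector is in the range of \<open>S\<close> up to an element of
  \<open>F\<close>. The kernel meets the complement only in 0, so projection to \<open>F\<close>
  embeds it into a finite dimensional space. The criterion survives small perturbations, which is
  why it is used for operators near a given one.\<close>

lemma coercive_on_finite_codim_imp_fredholm:
  fixes S :: "'h::{real_inner, complete_space} \<Rightarrow>\<^sub>L 'h"
  assumes sa: "selfadjoint S" and F: "subspace F" "finite_dim F"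
    and c: "c > 0" "\<And>u. u \<in> F\<^sup>\<bottom> \<Longrightarrow> S u \<bullet> u \<ge> c * (norm u)\<^sup>2"
  shows "fredholm S"
proof -
  obtain n b where b: "orthonormal n b" and sp: "span (b ` {..<n}) = F"
    using F by (rule orthonormal_basis_exists)
  let ?P = "oproj n b" and ?B = "b ` {..<n}"
  have P: "linear ?P" "\<And>u. ?P u \<in> F" "\<And>u. u - ?P u \<in> F\<^sup>\<bottom>"
    using linear_oproj oproj_in_span[of n b] oproj_orthogonal[OF b] by (auto simp: sp)
  have o: "y \<bullet> x = 0" if "y \<in> F" "x \<in> F\<^sup>\<bottom>" for x y
    using that by (simp add: mem_orthogonal_comp)
  have surj: "\<exists>x\<in>F\<^sup>\<bottom>. S x - ?P (S x) = y" if y: "y \<in> F\<^sup>\<bottom>" for y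
  proof (rule coercive_surjective[OF subspace_orthogonal_comp closed_orthogonal_comp _ _ _ c(1) _ y])
    show "S x - ?P (S x) \<in> F\<^sup>\<bottom>" for x by (rule P)
    show "S (x - z) - ?P (S (x - z)) = S x - ?P (S x) - (S z - ?P (S z))" for x z
      by (simp add: blinfun.diff_right linear_diff[OF P(1)])
    show "norm (S x - ?P (S x)) \<le> norm S * norm x" for x
    proof -
      have "(norm (S x - ?P (S x)))\<^sup>2 \<le> (norm (S x - ?P (S x)))\<^sup>2 + (norm (?P (S x)))\<^sup>2" by simp
      also have "\<dots> = (norm (S x - ?P (S x) + ?P (S x)))\<^sup>2"
        using o[OF P(2) P(3), of "S x" "S x"] unfolding power2_norm_eq_inner inner_add_left inner_add_right
        by (simp add: inner_commute)
      finally have "(norm (S x - ?P (S x)))\<^sup>2 \<le> (norm (S x))\<^sup>2" by simp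
      then have "norm (S x - ?P (S x)) \<le> norm (S x)"
        by (rule power2_le_imp_le) simp
      with norm_blinfun[of S x] show ?thesis by linarith
    qed
    show "(S x - ?P (S x)) \<bullet> x \<ge> c * (norm x)\<^sup>2" if "x \<in> F\<^sup>\<bottom>" for x
      using c(2)[OF that] o[OF P(2) that] by (simp add: inner_diff_left)
  qed
  have "span (range S \<union> ?B) = UNIV"
  proof (intro antisym subset_UNIV subsetI)
    fix y
    obtain x where "S x - ?P (S x) = y - ?P y" using surj[OF P(3)] by blast
    then have "y = S x + (?P y - ?P (S x))" by (simp add: algebra_simps)
    moreover have "?P y - ?P (S x) \<in> span ?B"
      using P(2) F(1) unfolding sp by (intro subspace_diff)
    then have "?P y - ?P (S x) \<in> span (range S \<union> ?B)"
      using span_mono[of ?B "range S \<union> ?B"] by blast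
    moreover have "S x \<in> span (range S \<union> ?B)" by (intro span_base) simp
    ultimately show "y \<in> span (range S \<union> ?B)" by (metis span_add)
  qed
  moreover have "finite_dim {u. S u = 0}"
  proof -
    let ?N = "{u. S u = 0}"
    have N: "subspace ?N"
      by (auto intro!: subspaceI simp: blinfun.zero_right blinfun.add_right blinfun.scaleR_right)
    obtain I where I: "I \<subseteq> ?N" "independent I" "?N \<subseteq> span I"
      by (rule maximal_independent_subset)
    have spI: "span I \<subseteq> ?N" using I(1) N by (rule span_minimal)
    have "inj_on ?P (span I)"
    proof (rule inj_onI)
      fix x y assume xy: "x \<in> span I" "y \<in> span I" "?P x = ?P y"
      then have "?P (x - y) = 0" by (simp add: linear_diff[OF P(1)])
      with P(3)[of "x - y"] have "x - y \<in> F\<^sup>\<bottom>" by simp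
      then have "c * (norm (x - y))\<^sup>2 \<le> S (x - y) \<bullet> (x - y)" by (rule c(2))
      also have "S (x - y) = 0"
      proof -
        have "x \<in> ?N" "y \<in> ?N" using xy(1,2) spI by blast+
        then show ?thesis by (simp add: blinfun.diff_right)
      qed
      finally show "x = y" using c(1) by (simp add: mult_le_0_iff)
    qed
    then have "independent (?P ` I)" "inj_on ?P I"
      using I(2) linear_independent_injective_image[OF P(1)]
      by (auto intro: inj_on_subset[OF _ span_superset])
    moreover have "?P ` I \<subseteq> span ?B" using P(2) by (auto simp: sp)
    ultimately have "finite I"
      using independent_span_bound[of ?B "?P ` I"] by (auto intro: finite_imageD)
    with I(3) show ?thesis unfolding finite_dim_def by blast
  qed
  ultimately show ?thesis
    using finite_codim_closed_range[OF sa, of ?B] unfolding fredholm_def by blast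
qed

section \<open>The gap around zero for positive essential spectrum\<close>

lemma subspace_eigen_sum: "subspace (eigen_sum T M)"
  by (simp add: eigen_sum_def)

lemma eigen_sum_mono: "M \<subseteq> M' \<Longrightarrow> eigen_sum T M \<subseteq> eigen_sum T M'"
  unfolding eigen_sum_def by (intro span_mono UN_mono) auto

lemma finite_dim_subset: "finite_dim F \<Longrightarrow> E \<subseteq> F \<Longrightarrow> finite_dim E"
  unfolding finite_dim_def by blast

lemma FS_plus_fredholm: "T \<in> FS_plus \<Longrightarrow> \<mu> \<le> 0 \<Longrightarrow> fredholm (T - \<mu> *\<^sub>R id_blinfun)"
  by (force simp: FS_plus_def ess_spectrum_def)

lemma FS_plus_selfadjoint: "T \<in> FS_plus \<Longrightarrow> selfadjoint T"
  by (simp add: FS_plus_def FS_def)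

text \<open>Since 0 may be an eigenvalue, two splittings are used: at level \<open>{..0}\<close> to
  separate \<open>a\<close> from 0 and the spectrum above it, and at level \<open>{..<0}\<close> to
  separate \<open>- a\<close> from the negative eigenvalues and 0. The coercivity bound is stated
  with the same \<open>m\<close> because the perturbation argument needs both at once.\<close>

lemma FS_plus_spectral_gap:
  fixes T :: "'h::{real_inner, complete_space} \<Rightarrow>\<^sub>L 'h"
  assumes T: "T \<in> FS_plus"
  shows "\<exists>m>0. (\<forall>w\<in>(eigen_sum T {..0})\<^sup>\<bottom>. T w \<bullet> w \<ge> m * (norm w)\<^sup>2) \<and>
    (\<forall>a. 0 < a \<and> 2 * a \<le> m \<longrightarrow> (\<exists>c>0. \<forall>u. norm (T u - a *\<^sub>R u) \<ge> c * norm u \<and> norm (T u + a *\<^sub>R u) \<ge> c * norm u))"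
proof -
  note sa = FS_plus_selfadjoint[OF T]
  have fd: "finite_dim (eigen_sum T {..0})"
    by (rule finite_dim_eigen_sum[OF sa FS_plus_fredholm[OF T]])
  have sub: "eigen_sum T {..<0} \<subseteq> eigen_sum T {..0}"
    by (rule eigen_sum_mono) auto
  have fd': "finite_dim (eigen_sum T {..<0})"
    using fd sub by (rule finite_dim_subset)
  obtain m where m: "m \<notin> {..0}" "\<forall>w\<in>(eigen_sum T {..0})\<^sup>\<bottom>. T w \<bullet> w \<ge> m * (norm w)\<^sup>2"
    using rayleigh_above_eigen_sum[OF sa FS_plus_fredholm[OF T] order_refl] by blast
  have "{..<0} \<subseteq> {..0::real}" by auto
  then obtain m' where m': "m' \<notin> {..<0}" "\<forall>w\<in>(eigen_sum T {..<0})\<^sup>\<bottom>. T w \<bullet> w \<ge> m' * (norm w)\<^sup>2"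
    using rayleigh_above_eigen_sum[OF sa FS_plus_fredholm[OF T]] by blast
  obtain \<alpha> where \<alpha>: "\<alpha> < 0" "\<forall>f\<in>eigen_sum T {..<0}. T f \<bullet> f \<le> \<alpha> * (norm f)\<^sup>2"
    using eigen_sum_form_less[OF sa fd', of 0] by auto
  \<comment> \<open>With \<open>2 * a \<le> d\<close> the point \<open>a\<close> has distance at
    least \<open>a\<close> from 0 and from \<open>m\<close>, and \<open>- a\<close> has distance at
    least \<open>a\<close> from \<open>\<alpha>\<close> and from 0. So \<open>a\<close> itself
    serves as the lower bound \<open>c\<close>.\<close>
  define d where "d = min m (- \<alpha>)"
  have d: "d > 0" "d \<le> m" "d \<le> - \<alpha>"
    using m(1) \<alpha>(1) by (auto simp: d_def)
  have "\<exists>c>0. \<forall>u. norm (T u - a *\<^sub>R u) \<ge> c * norm u \<and> norm (T u + a *\<^sub>R u) \<ge> c * norm u"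
    if a: "0 < a" "2 * a \<le> d" for a
  proof (intro exI[of _ a] conjI allI a)
    fix u
    show "norm (T u - a *\<^sub>R u) \<ge> a * norm u"
    proof (rule bounded_below_in_gap[OF sa subspace_eigen_sum fd eigen_sum_invariant])
      show "T f \<bullet> f \<le> 0 * (norm f)\<^sup>2" if "f \<in> eigen_sum T {..0}" for f
        using sa that by (rule eigen_sum_form_le) simp
      show "T w \<bullet> w \<ge> m * (norm w)\<^sup>2" if "w \<in> (eigen_sum T {..0})\<^sup>\<bottom>" for w
        using m(2) that by blast
    qed (use a d in auto)
    have "norm (T u - (- a) *\<^sub>R u) \<ge> a * norm u"
    proof (rule bounded_below_in_gap[OF sa subspace_eigen_sum fd' eigen_sum_invariant])
      show "T f \<bullet> f \<le> \<alpha> * (norm f)\<^sup>2" if "f \<in> eigen_sum T {..<0}" for f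
        using \<alpha>(2) that by blast
      show "T w \<bullet> w \<ge> m' * (norm w)\<^sup>2" if "w \<in> (eigen_sum T {..<0})\<^sup>\<bottom>" for w
        using m'(2) that by blast
    qed (use a d m'(1) in auto)
    then show "norm (T u + a *\<^sub>R u) \<ge> a * norm u" by simp
  qed
  moreover have "T w \<bullet> w \<ge> d * (norm w)\<^sup>2" if "w \<in> (eigen_sum T {..0})\<^sup>\<bottom>" for w
  proof -
    have "d * (norm w)\<^sup>2 \<le> m * (norm w)\<^sup>2" using d(2) by (intro mult_right_mono) auto
    with m(2)[rule_format, OF that] show ?thesis by linarith
  qed
  ultimately show ?thesis using d(1) by blast
qed

section \<open>Stability under small perturbations\<close>

lemma form_perturbation:
  fixes T T' :: "'h::real_inner \<Rightarrow>\<^sub>L 'h"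
  shows "\<bar>T' u \<bullet> u - T u \<bullet> u\<bar> \<le> norm (T' - T) * (norm u)\<^sup>2"
proof -
  have "\<bar>T' u \<bullet> u - T u \<bullet> u\<bar> = \<bar>(T' - T) u \<bullet> u\<bar>"
    by (simp add: blinfun.diff_left inner_diff_left)
  also have "\<dots> \<le> norm ((T' - T) u) * norm u" by (rule Cauchy_Schwarz_ineq2)
  also have "\<dots> \<le> (norm (T' - T) * norm u) * norm u"
    by (intro mult_right_mono norm_blinfun) simp
  finally show ?thesis by (simp add: power2_eq_square mult.assoc)
qed

lemma bounded_below_perturbation:
  fixes T T' :: "'h::real_normed_vector \<Rightarrow>\<^sub>L 'h"
  assumes "norm (T u - v) \<ge> c * norm u" "norm (T' - T) \<le> c / 2"
  shows "norm (T' u - v) \<ge> c / 2 * norm u"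
proof -
  have "T u - v = (T' u - v) - (T' - T) u" by (simp add: blinfun.diff_left)
  then have "norm (T u - v) \<le> norm (T' u - v) + norm ((T' - T) u)"
    by (metis norm_triangle_ineq4)
  moreover have "norm ((T' - T) u) \<le> c / 2 * norm u"
    using norm_blinfun[of "T' - T" u] mult_right_mono[OF assms(2) norm_ge_zero[of u]] by linarith
  moreover have "c * norm u = c / 2 * norm u + c / 2 * norm u" by simp
  ultimately show ?thesis using assms(1) by linarith
qed

text \<open>One number \<open>a\<close> serves a whole neighbourhood, which is what a partition
  requires. The bounds for the shifts by \<open>a\<close> and \<open>- a\<close> survive with half
  the constant. Coercivity on the complement of the nonpositive eigenspaces of \<open>T\<close>, a
  subspace fixed while \<open>T'\<close> varies, makes all shifts of \<open>T'\<close> by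
  \<open>\<mu> \<le> a\<close> Fredholm.\<close>

lemma FS_plus_admissible_neighbourhood:
  fixes T :: "'h::{real_inner, complete_space} \<Rightarrow>\<^sub>L 'h"
  assumes T: "T \<in> FS_plus"
  shows "\<exists>a>0. \<exists>\<delta>>0. \<forall>T'. selfadjoint T' \<and> norm (T' - T) < \<delta> \<longrightarrow>
    a \<notin> op_spectrum T' \<and> - a \<notin> op_spectrum T' \<and> {- a..a} \<inter> ess_spectrum T' = {}"
proof -
  note sa = FS_plus_selfadjoint[OF T]
  obtain m where m: "m > 0" "\<forall>w\<in>(eigen_sum T {..0})\<^sup>\<bottom>. T w \<bullet> w \<ge> m * (norm w)\<^sup>2"
    "\<forall>a. 0 < a \<and> 2 * a \<le> m \<longrightarrow> (\<exists>c>0. \<forall>u. norm (T u - a *\<^sub>R u) \<ge> c * norm u \<and> norm (T u + a *\<^sub>R u) \<ge> c * norm u)"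
    using FS_plus_spectral_gap[OF T] by (elim exE conjE) (rule that)
  define a where "a = m / 2"
  have a: "a > 0" "2 * a \<le> m" using m(1) by (simp_all add: a_def)
  obtain c where c: "c > 0" "\<forall>u. norm (T u - a *\<^sub>R u) \<ge> c * norm u \<and> norm (T u + a *\<^sub>R u) \<ge> c * norm u"
    using m(3)[rule_format, OF conjI[OF a]] by blast
  \<comment> \<open>On the complement the form of \<open>T\<close> is at least \<open>2 * a\<close>;
    a perturbation costs at most \<open>a / 2\<close> and the shift at most \<open>a\<close>, which
    leaves \<open>a / 2\<close>.\<close>
  define \<delta> where "\<delta> = min (c / 2) (a / 2)"
  have \<delta>: "\<delta> > 0" using c a by (simp add: \<delta>_def)
  have key: "a \<notin> op_spectrum T' \<and> - a \<notin> op_spectrum T' \<and> {- a..a} \<inter> ess_spectrum T' = {}"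
    if "selfadjoint T' \<and> norm (T' - T) < \<delta>" for T'
  proof (intro conjI)
    have sa': "selfadjoint T'" and near: "norm (T' - T) < \<delta>" using that by simp_all
    have le: "norm (T' - T) \<le> c / 2" "norm (T' - T) \<le> a / 2"
      using near by (simp_all add: \<delta>_def)
    show "a \<notin> op_spectrum T'"
    proof (rule bounded_below_not_in_op_spectrum[OF sa'])
      show "norm (T' u - a *\<^sub>R u) \<ge> c / 2 * norm u" for u
        by (rule bounded_below_perturbation[OF _ le(1)]) (use c(2) in blast)
    qed (use c in simp)
    show "- a \<notin> op_spectrum T'"
    proof (rule bounded_below_not_in_op_spectrum[OF sa'])
      have "norm (T u - (- a) *\<^sub>R u) \<ge> c * norm u" for u
        using c(2) by simp
      then show "norm (T' u - (- a) *\<^sub>R u) \<ge> c / 2 * norm u" for u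
        by (rule bounded_below_perturbation[OF _ le(1)])
    qed (use c in simp)
    have "fredholm (T' - \<mu> *\<^sub>R id_blinfun)" if "\<mu> \<le> a" for \<mu>
    proof (rule coercive_on_finite_codim_imp_fredholm)
      show "selfadjoint (T' - \<mu> *\<^sub>R id_blinfun)" using sa' by (rule selfadjoint_shift)
      show "subspace (eigen_sum T {..0})" by (rule subspace_eigen_sum)
      show "finite_dim (eigen_sum T {..0})"
        by (rule finite_dim_eigen_sum[OF sa FS_plus_fredholm[OF T]])
      show "(T' - \<mu> *\<^sub>R id_blinfun) w \<bullet> w \<ge> a / 2 * (norm w)\<^sup>2" if "w \<in> (eigen_sum T {..0})\<^sup>\<bottom>" for w
      proof -
        have "(T' - \<mu> *\<^sub>R id_blinfun) w \<bullet> w = T' w \<bullet> w - \<mu> * (norm w)\<^sup>2"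
          unfolding shift_apply inner_diff_left inner_scaleR_left power2_norm_eq_inner by simp
        moreover have "\<bar>T' w \<bullet> w - T w \<bullet> w\<bar> \<le> a / 2 * (norm w)\<^sup>2"
          by (rule order_trans[OF form_perturbation mult_right_mono[OF le(2)]]) simp
        moreover have "T w \<bullet> w \<ge> 2 * a * (norm w)\<^sup>2"
          using m(2) that by (simp add: a_def)
        moreover have "\<mu> * (norm w)\<^sup>2 \<le> a * (norm w)\<^sup>2"
          using \<open>\<mu> \<le> a\<close> by (intro mult_right_mono) auto
        ultimately show ?thesis by argo
      qed
    qed (use a in simp)
    then show "{- a..a} \<inter> ess_spectrum T' = {}"
      unfolding ess_spectrum_def by fastforce
  qed
  show ?thesis
    by (rule exI[of _ a], rule conjI[OF a(1)], rule exI[of _ \<delta>], rule conjI[OF \<delta>], intro allI impI, rule key)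
qed

lemma Int_eq_zeroI:
  assumes "subspace A" "subspace B" "\<And>u. u \<in> A \<Longrightarrow> u \<in> B \<Longrightarrow> u = 0"
  shows "A \<inter> B = {0}"
  using assms subspace_0 by auto

text \<open>Two mechanisms produce the gap. Below, there are finitely many eigenvalues and none
  equals \<open>a\<close>, which is not in the spectrum; above, the Rayleigh bound on the complement
  lies outside \<open>{..a}\<close>.\<close>

lemma form_separation:
  fixes T :: "'h::{real_inner, complete_space} \<Rightarrow>\<^sub>L 'h"
  assumes sa: "selfadjoint T" and fr: "\<And>\<mu>. \<mu> \<le> a \<Longrightarrow> fredholm (T - \<mu> *\<^sub>R id_blinfun)"
    and a: "a \<notin> op_spectrum T"
  shows "\<exists>\<epsilon>>0. (\<forall>f\<in>eigen_sum T {..a}. T f \<bullet> f \<le> (a - \<epsilon>) * (norm f)\<^sup>2) \<and>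
    (\<forall>w\<in>(eigen_sum T {..a})\<^sup>\<bottom>. T w \<bullet> w \<ge> (a + \<epsilon>) * (norm w)\<^sup>2)"
proof -
  obtain m where m: "m \<notin> {..a}" "\<forall>w\<in>(eigen_sum T {..a})\<^sup>\<bottom>. T w \<bullet> w \<ge> m * (norm w)\<^sup>2"
    using rayleigh_above_eigen_sum[OF sa fr order_refl] by blast
  have less: "\<mu> < a" if "\<mu> \<in> {..a}" "T u = \<mu> *\<^sub>R u" "u \<noteq> 0" for \<mu> u
  proof -
    have "\<mu> \<noteq> a" using eigenvalue_in_op_spectrum[OF that(2,3)] a by metis
    with that(1) show ?thesis by simp
  qed
  have "\<exists>\<alpha><a. \<forall>f\<in>eigen_sum T {..a}. T f \<bullet> f \<le> \<alpha> * (norm f)\<^sup>2"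
    by (rule eigen_sum_form_less[OF sa finite_dim_eigen_sum[OF sa fr] less])
  then obtain \<alpha> where \<alpha>: "\<alpha> < a" "\<forall>f\<in>eigen_sum T {..a}. T f \<bullet> f \<le> \<alpha> * (norm f)\<^sup>2"
    by blast
  define \<epsilon> where "\<epsilon> = min (a - \<alpha>) (m - a)"
  have \<epsilon>: "\<epsilon> > 0" "\<alpha> \<le> a - \<epsilon>" "a + \<epsilon> \<le> m"
    using m(1) \<alpha>(1) by (auto simp: \<epsilon>_def)
  have "T f \<bullet> f \<le> (a - \<epsilon>) * (norm f)\<^sup>2" if "f \<in> eigen_sum T {..a}" for f
    by (rule order_trans[OF \<alpha>(2)[rule_format, OF that] mult_right_mono[OF \<epsilon>(2)]]) simp
  moreover have "T w \<bullet> w \<ge> (a + \<epsilon>) * (norm w)\<^sup>2" if "w \<in> (eigen_sum T {..a})\<^sup>\<bottom>" for w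
    by (rule order_trans[OF mult_right_mono[OF \<epsilon>(3)] m(2)[rule_format, OF that]]) simp
  ultimately show ?thesis using \<epsilon>(1) by blast
qed

text \<open>A vector in either intersection sees one operator below its gap and the other above its
  gap. The full gap \<open>\<delta>\<close> of \<open>T\<close> pays for the perturbation, so any
  positive gap of \<open>T'\<close> gives the contradiction and no uniformity in \<open>T'\<close>
  is needed.\<close>

lemma eigen_sum_transversal:
  fixes T :: "'h::{real_inner, complete_space} \<Rightarrow>\<^sub>L 'h"
  assumes sa: "selfadjoint T" and fr: "\<And>\<mu>. \<mu> \<le> a \<Longrightarrow> fredholm (T - \<mu> *\<^sub>R id_blinfun)"
    and a: "a \<notin> op_spectrum T"
  shows "\<exists>\<delta>>0. \<forall>T'. selfadjoint T' \<and> (\<forall>\<mu>\<le>a. fredholm (T' - \<mu> *\<^sub>R id_blinfun)) \<and>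
    a \<notin> op_spectrum T' \<and> norm (T' - T) < \<delta> \<longrightarrow>
    eigen_sum T {..a} \<inter> (eigen_sum T' {..a})\<^sup>\<bottom> = {0} \<and> eigen_sum T' {..a} \<inter> (eigen_sum T {..a})\<^sup>\<bottom> = {0}"
proof -
  obtain \<delta> where \<delta>: "\<delta> > 0" "\<forall>f\<in>eigen_sum T {..a}. T f \<bullet> f \<le> (a - \<delta>) * (norm f)\<^sup>2"
    "\<forall>w\<in>(eigen_sum T {..a})\<^sup>\<bottom>. T w \<bullet> w \<ge> (a + \<delta>) * (norm w)\<^sup>2"
    using form_separation[OF sa fr a] by blast
  have key: "eigen_sum T {..a} \<inter> (eigen_sum T' {..a})\<^sup>\<bottom> = {0} \<and> eigen_sum T' {..a} \<inter> (eigen_sum T {..a})\<^sup>\<bottom> = {0}"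
    if "selfadjoint T' \<and> (\<forall>\<mu>\<le>a. fredholm (T' - \<mu> *\<^sub>R id_blinfun)) \<and> a \<notin> op_spectrum T' \<and> norm (T' - T) < \<delta>" for T'
  proof -
    have T': "selfadjoint T'" "\<And>\<mu>. \<mu> \<le> a \<Longrightarrow> fredholm (T' - \<mu> *\<^sub>R id_blinfun)" "a \<notin> op_spectrum T'"
      and near: "norm (T' - T) < \<delta>" using that by simp_all
    obtain \<epsilon> where \<epsilon>: "\<epsilon> > 0" "\<forall>f\<in>eigen_sum T' {..a}. T' f \<bullet> f \<le> (a - \<epsilon>) * (norm f)\<^sup>2"
      "\<forall>w\<in>(eigen_sum T' {..a})\<^sup>\<bottom>. T' w \<bullet> w \<ge> (a + \<epsilon>) * (norm w)\<^sup>2"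
      using form_separation[OF T'] by blast
    have pert: "\<bar>T' u \<bullet> u - T u \<bullet> u\<bar> \<le> \<delta> * (norm u)\<^sup>2" for u
      by (rule order_trans[OF form_perturbation mult_right_mono]) (use near in auto)
    have "u = 0" if "u \<in> eigen_sum T {..a}" "u \<in> (eigen_sum T' {..a})\<^sup>\<bottom>" for u
    proof -
      \<comment> \<open>The form of \<open>T'\<close> is at least the left side, that of
        \<open>T\<close> at most the first summand on the right, and they differ by at most the
        second.\<close>
      have "(a + \<epsilon>) * (norm u)\<^sup>2 \<le> (a - \<delta>) * (norm u)\<^sup>2 + \<delta> * (norm u)\<^sup>2"
        using \<delta>(2)[rule_format, OF that(1)] \<epsilon>(3)[rule_format, OF that(2)] pert[of u]
        by linarith
      then have "\<epsilon> * (norm u)\<^sup>2 \<le> 0" by (simp add: algebra_simps)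
      with \<epsilon>(1) show ?thesis by (simp add: mult_le_0_iff)
    qed
    moreover have "u = 0" if "u \<in> eigen_sum T' {..a}" "u \<in> (eigen_sum T {..a})\<^sup>\<bottom>" for u
    proof -
      have "(a + \<delta>) * (norm u)\<^sup>2 \<le> (a - \<epsilon>) * (norm u)\<^sup>2 + \<delta> * (norm u)\<^sup>2"
        using \<delta>(3)[rule_format, OF that(2)] \<epsilon>(2)[rule_format, OF that(1)] pert[of u]
        by linarith
      then have "\<epsilon> * (norm u)\<^sup>2 \<le> 0" by (simp add: algebra_simps)
      with \<epsilon>(1) show ?thesis by (simp add: mult_le_0_iff)
    qed
    ultimately show ?thesis
      by (intro conjI Int_eq_zeroI subspace_eigen_sum subspace_orthogonal_comp)
  qed
  show ?thesis
    by (rule exI[of _ \<delta>], rule conjI[OF \<delta>(1)], intro allI impI, rule key)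
qed

section \<open>The Grothendieck group\<close>

text \<open>Cross-multiplication, with a stabilising summand \<open>w\<close> because the monoid is
  not assumed cancellative. This equation is the invariant along a zigzag of generating steps;
  conversely, two pairs satisfying it are both one step away from a common pair.\<close>

lemma groth_rel_iff:
  assumes M: "comm_monoid M" and uv: "u \<in> carrier M" "v \<in> carrier M"
  shows "((u, v), q) \<in> groth_rel M \<longleftrightarrow>
    (\<exists>u'\<in>carrier M. \<exists>v'\<in>carrier M. \<exists>w\<in>carrier M. q = (u', v') \<and> u \<otimes>\<^bsub>M\<^esub> v' \<otimes>\<^bsub>M\<^esub> w = u' \<otimes>\<^bsub>M\<^esub> v \<otimes>\<^bsub>M\<^esub> w)"
proof -
  interpret comm_monoid M by (rule M)
  let ?r = "\<lambda>p q. \<exists>u\<in>carrier M. \<exists>v\<in>carrier M. \<exists>w\<in>carrier M. p = (u, v) \<and> q = (u \<otimes>\<^bsub>M\<^esub> w, v \<otimes>\<^bsub>M\<^esub> w)"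
  show ?thesis
  proof
    assume "((u, v), q) \<in> groth_rel M"
    then have "equivclp ?r (u, v) q" by (simp add: groth_rel_def)
    then show "\<exists>u'\<in>carrier M. \<exists>v'\<in>carrier M. \<exists>w\<in>carrier M. q = (u', v') \<and> u \<otimes>\<^bsub>M\<^esub> v' \<otimes>\<^bsub>M\<^esub> w = u' \<otimes>\<^bsub>M\<^esub> v \<otimes>\<^bsub>M\<^esub> w"
    proof (induction rule: equivclp_induct)
      case base
      show ?case using uv by (intro bexI[of _ u] bexI[of _ v] bexI[of _ "\<one>\<^bsub>M\<^esub>"]) auto
    next
      case (step y z)
      from step(3) obtain x y' w where y: "y = (x, y')" "x \<in> carrier M" "y' \<in> carrier M" "w \<in> carrier M"
        "u \<otimes>\<^bsub>M\<^esub> y' \<otimes>\<^bsub>M\<^esub> w = x \<otimes>\<^bsub>M\<^esub> v \<otimes>\<^bsub>M\<^esub> w" by blast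
      from step(2) show ?case
      proof
        assume "?r y z"
        then obtain k where k: "k \<in> carrier M" "z = (x \<otimes>\<^bsub>M\<^esub> k, y' \<otimes>\<^bsub>M\<^esub> k)"
          using y(1) by blast
        have "u \<otimes>\<^bsub>M\<^esub> (y' \<otimes>\<^bsub>M\<^esub> k) \<otimes>\<^bsub>M\<^esub> w = (u \<otimes>\<^bsub>M\<^esub> y' \<otimes>\<^bsub>M\<^esub> w) \<otimes>\<^bsub>M\<^esub> k"
          using uv y k by (simp add: m_ac)
        also have "\<dots> = (x \<otimes>\<^bsub>M\<^esub> k) \<otimes>\<^bsub>M\<^esub> v \<otimes>\<^bsub>M\<^esub> w"
          unfolding y(5) using uv y(2-4) k(1) by (simp add: m_ac)
        finally show ?case using y k
          by (intro bexI[of _ "x \<otimes>\<^bsub>M\<^esub> k"] bexI[of _ "y' \<otimes>\<^bsub>M\<^esub> k"] bexI[of _ w]) auto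
      next
        \<comment> \<open>In this direction \<open>k\<close> cannot be cancelled and is absorbed
          into the stabilising summand.\<close>
        assume "?r z y"
        then obtain x1 y1 k where k: "x1 \<in> carrier M" "y1 \<in> carrier M" "k \<in> carrier M" "z = (x1, y1)"
          "x = x1 \<otimes>\<^bsub>M\<^esub> k" "y' = y1 \<otimes>\<^bsub>M\<^esub> k"
          using y(1) by blast
        have "u \<otimes>\<^bsub>M\<^esub> y1 \<otimes>\<^bsub>M\<^esub> (k \<otimes>\<^bsub>M\<^esub> w) = u \<otimes>\<^bsub>M\<^esub> y' \<otimes>\<^bsub>M\<^esub> w"
          using uv y(2-4) k by (simp add: m_ac)
        also have "\<dots> = x1 \<otimes>\<^bsub>M\<^esub> v \<otimes>\<^bsub>M\<^esub> (k \<otimes>\<^bsub>M\<^esub> w)"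
          unfolding y(5) using uv y(2-4) k by (simp add: m_ac)
        finally show ?case using y(2-4) k(1-4)
          by (intro bexI[of _ x1] bexI[of _ y1] bexI[of _ "k \<otimes>\<^bsub>M\<^esub> w"]) auto
      qed
    qed
  next
    assume "\<exists>u'\<in>carrier M. \<exists>v'\<in>carrier M. \<exists>w\<in>carrier M. q = (u', v') \<and> u \<otimes>\<^bsub>M\<^esub> v' \<otimes>\<^bsub>M\<^esub> w = u' \<otimes>\<^bsub>M\<^esub> v \<otimes>\<^bsub>M\<^esub> w"
    then obtain u' v' w where q: "u' \<in> carrier M" "v' \<in> carrier M" "w \<in> carrier M" "q = (u', v')"
      and eq: "u \<otimes>\<^bsub>M\<^esub> v' \<otimes>\<^bsub>M\<^esub> w = u' \<otimes>\<^bsub>M\<^esub> v \<otimes>\<^bsub>M\<^esub> w" by blast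
    \<comment> \<open>The common pair: it arises from \<open>(u, v)\<close> by adding
      \<open>v' \<otimes> w\<close> and, thanks to the equation, from \<open>(u', v')\<close> by
      adding \<open>v \<otimes> w\<close>.\<close>
    let ?p = "(u \<otimes>\<^bsub>M\<^esub> (v' \<otimes>\<^bsub>M\<^esub> w), v \<otimes>\<^bsub>M\<^esub> (v' \<otimes>\<^bsub>M\<^esub> w))"
    have 1: "?r (u, v) ?p"
      using uv q by (intro bexI[of _ u] bexI[of _ v] bexI[of _ "v' \<otimes>\<^bsub>M\<^esub> w"]) auto
    have 2: "?r q ?p"
    proof -
      have "u \<otimes>\<^bsub>M\<^esub> (v' \<otimes>\<^bsub>M\<^esub> w) = u' \<otimes>\<^bsub>M\<^esub> (v \<otimes>\<^bsub>M\<^esub> w)"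
        using eq uv q by (simp add: m_assoc)
      moreover have "v \<otimes>\<^bsub>M\<^esub> (v' \<otimes>\<^bsub>M\<^esub> w) = v' \<otimes>\<^bsub>M\<^esub> (v \<otimes>\<^bsub>M\<^esub> w)"
        using uv q by (simp add: m_lcomm)
      ultimately show ?thesis
        using uv q by (intro bexI[of _ u'] bexI[of _ v'] bexI[of _ "v \<otimes>\<^bsub>M\<^esub> w"]) auto
    qed
    have "equivclp ?r (u, v) q"
      using r_into_equivclp[of ?r, OF 1] converse_r_into_equivclp[of ?r, OF 2] by (rule equivclp_trans)
    then show "((u, v), q) \<in> groth_rel M" by (simp add: groth_rel_def)
  qed
qed

lemma formal_diff_eq_iff:
  assumes M: "comm_monoid M" and uv: "u \<in> carrier M" "v \<in> carrier M" "u' \<in> carrier M" "v' \<in> carrier M"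
  shows "formal_diff M u v = formal_diff M u' v' \<longleftrightarrow>
    (\<exists>w\<in>carrier M. u \<otimes>\<^bsub>M\<^esub> v' \<otimes>\<^bsub>M\<^esub> w = u' \<otimes>\<^bsub>M\<^esub> v \<otimes>\<^bsub>M\<^esub> w)"
proof -
  have "formal_diff M u v = formal_diff M u' v' \<longleftrightarrow> ((u, v), (u', v')) \<in> groth_rel M"
    unfolding formal_diff_def groth_rel_def
    by (auto intro: equivclp_trans equivclp_sym)
  also have "\<dots> \<longleftrightarrow> (\<exists>w\<in>carrier M. u \<otimes>\<^bsub>M\<^esub> v' \<otimes>\<^bsub>M\<^esub> w = u' \<otimes>\<^bsub>M\<^esub> v \<otimes>\<^bsub>M\<^esub> w)"
    unfolding groth_rel_iff[OF M uv(1,2)] using uv(3,4) by blast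
  finally show ?thesis .
qed

lemma mem_formal_diff:
  assumes "comm_monoid M" "u \<in> carrier M" "v \<in> carrier M" "(x, y) \<in> formal_diff M u v"
  shows "x \<in> carrier M" "y \<in> carrier M" "\<exists>w\<in>carrier M. u \<otimes>\<^bsub>M\<^esub> y \<otimes>\<^bsub>M\<^esub> w = x \<otimes>\<^bsub>M\<^esub> v \<otimes>\<^bsub>M\<^esub> w"
  using assms(4) groth_rel_iff[OF assms(1-3)] by (auto simp: formal_diff_def)

lemma self_mem_formal_diff: "(u, v) \<in> formal_diff M u v"
  by (simp add: formal_diff_def groth_rel_def)

section \<open>Arithmetic of formal differences\<close>

lemma carrier_grothendieck_group:
  "x \<in> carrier (grothendieck_group M) \<longleftrightarrow> (\<exists>u\<in>carrier M. \<exists>v\<in>carrier M. x = formal_diff M u v)"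
  by (auto simp: grothendieck_group_def quotient_def formal_diff_def)

text \<open>The product is a union over all representatives; since the class of the result does not
  depend on them, all members of the union coincide.\<close>

lemma mult_formal_diff:
  assumes M: "comm_monoid M"
    and uv: "u \<in> carrier M" "v \<in> carrier M" "u' \<in> carrier M" "v' \<in> carrier M"
  shows "formal_diff M u v \<otimes>\<^bsub>grothendieck_group M\<^esub> formal_diff M u' v' =
    formal_diff M (u \<otimes>\<^bsub>M\<^esub> u') (v \<otimes>\<^bsub>M\<^esub> v')"
proof -
  interpret comm_monoid M by (rule M)
  have eq: "formal_diff M (x \<otimes>\<^bsub>M\<^esub> x') (y \<otimes>\<^bsub>M\<^esub> y') = formal_diff M (u \<otimes>\<^bsub>M\<^esub> u') (v \<otimes>\<^bsub>M\<^esub> v')"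
    if xy: "(x, y) \<in> formal_diff M u v" "(x', y') \<in> formal_diff M u' v'" for x y x' y'
  proof -
    note a = mem_formal_diff[OF M uv(1,2) xy(1)] and b = mem_formal_diff[OF M uv(3,4) xy(2)]
    obtain w where w: "w \<in> carrier M" "u \<otimes>\<^bsub>M\<^esub> y \<otimes>\<^bsub>M\<^esub> w = x \<otimes>\<^bsub>M\<^esub> v \<otimes>\<^bsub>M\<^esub> w" using a(3) by blast
    obtain w' where w': "w' \<in> carrier M" "u' \<otimes>\<^bsub>M\<^esub> y' \<otimes>\<^bsub>M\<^esub> w' = x' \<otimes>\<^bsub>M\<^esub> v' \<otimes>\<^bsub>M\<^esub> w'" using b(3) by blast
    have "(x \<otimes>\<^bsub>M\<^esub> x') \<otimes>\<^bsub>M\<^esub> (v \<otimes>\<^bsub>M\<^esub> v') \<otimes>\<^bsub>M\<^esub> (w \<otimes>\<^bsub>M\<^esub> w') = (x \<otimes>\<^bsub>M\<^esub> v \<otimes>\<^bsub>M\<^esub> w) \<otimes>\<^bsub>M\<^esub> (x' \<otimes>\<^bsub>M\<^esub> v' \<otimes>\<^bsub>M\<^esub> w')"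
      using uv a(1,2) b(1,2) w(1) w'(1) by (simp add: m_ac)
    also have "\<dots> = (u \<otimes>\<^bsub>M\<^esub> u') \<otimes>\<^bsub>M\<^esub> (y \<otimes>\<^bsub>M\<^esub> y') \<otimes>\<^bsub>M\<^esub> (w \<otimes>\<^bsub>M\<^esub> w')"
      unfolding w(2)[symmetric] w'(2)[symmetric]
      using uv a(1,2) b(1,2) w(1) w'(1) by (simp add: m_ac)
    finally show ?thesis
      using uv a(1,2) b(1,2) w(1) w'(1) by (subst formal_diff_eq_iff[OF M]) auto
  qed
  have "formal_diff M u v \<otimes>\<^bsub>grothendieck_group M\<^esub> formal_diff M u' v' =
    (\<Union>p\<in>formal_diff M u v. \<Union>q\<in>formal_diff M u' v'. formal_diff M (fst p \<otimes>\<^bsub>M\<^esub> fst q) (snd p \<otimes>\<^bsub>M\<^esub> snd q))"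
    by (simp add: grothendieck_group_def case_prod_beta)
  also have "\<dots> = (\<Union>p\<in>formal_diff M u v. \<Union>q\<in>formal_diff M u' v'. formal_diff M (u \<otimes>\<^bsub>M\<^esub> u') (v \<otimes>\<^bsub>M\<^esub> v'))"
    by (intro SUP_cong refl eq) simp_all
  also have "\<dots> = formal_diff M (u \<otimes>\<^bsub>M\<^esub> u') (v \<otimes>\<^bsub>M\<^esub> v')"
    using self_mem_formal_diff[of u v M] self_mem_formal_diff[of u' v' M] by blast
  finally show ?thesis .
qed

lemma comm_monoid_grothendieck_group:
  assumes M: "comm_monoid M" shows "comm_monoid (grothendieck_group M)"
proof -
  interpret comm_monoid M by (rule M)
  let ?K = "grothendieck_group M"
  have one: "\<one>\<^bsub>?K\<^esub> = formal_diff M \<one>\<^bsub>M\<^esub> \<one>\<^bsub>M\<^esub>" by (simp add: grothendieck_group_def)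
  show ?thesis
  proof (rule comm_monoidI)
    fix x y assume x: "x \<in> carrier ?K" and y: "y \<in> carrier ?K"
    obtain a b where x: "a \<in> carrier M" "b \<in> carrier M" "x = formal_diff M a b"
      using x by (auto simp: carrier_grothendieck_group)
    obtain c d where y: "c \<in> carrier M" "d \<in> carrier M" "y = formal_diff M c d"
      using y by (auto simp: carrier_grothendieck_group)
    show "x \<otimes>\<^bsub>?K\<^esub> y \<in> carrier ?K"
      using x(1,2) y(1,2) unfolding x(3) y(3) mult_formal_diff[OF M x(1,2) y(1,2)] carrier_grothendieck_group
      by (intro bexI[of _ "a \<otimes>\<^bsub>M\<^esub> c"] bexI[of _ "b \<otimes>\<^bsub>M\<^esub> d"]) auto
    show "x \<otimes>\<^bsub>?K\<^esub> y = y \<otimes>\<^bsub>?K\<^esub> x"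
      unfolding x(3) y(3) mult_formal_diff[OF M x(1,2) y(1,2)] mult_formal_diff[OF M y(1,2) x(1,2)]
      using x(1,2) y(1,2) by (simp add: m_comm)
    fix z assume "z \<in> carrier ?K"
    then obtain e f where z: "e \<in> carrier M" "f \<in> carrier M" "z = formal_diff M e f"
      by (auto simp: carrier_grothendieck_group)
    show "(x \<otimes>\<^bsub>?K\<^esub> y) \<otimes>\<^bsub>?K\<^esub> z = x \<otimes>\<^bsub>?K\<^esub> (y \<otimes>\<^bsub>?K\<^esub> z)"
      using x(1,2) y(1,2) z(1,2) unfolding x(3) y(3) z(3)
      by (simp add: mult_formal_diff[OF M] m_assoc)
  next
    show "\<one>\<^bsub>?K\<^esub> \<in> carrier ?K" unfolding one carrier_grothendieck_group by blast
  next
    fix x assume "x \<in> carrier ?K"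
    then obtain a b where x: "a \<in> carrier M" "b \<in> carrier M" "x = formal_diff M a b"
      by (auto simp: carrier_grothendieck_group)
    show "\<one>\<^bsub>?K\<^esub> \<otimes>\<^bsub>?K\<^esub> x = x"
      using x(1,2) unfolding x(3) one by (simp add: mult_formal_diff[OF M])
  qed
qed

text \<open>In each step the term \<open>m N\<close> occurs on both sides of the difference and is
  removed by the relation itself, without cancellation in the monoid.\<close>

lemma finprod_formal_diff_telescope:
  fixes N :: nat
  assumes M: "comm_monoid M" and m: "\<And>i. i \<le> N \<Longrightarrow> m i \<in> carrier M"
  shows "finprod (grothendieck_group M) (\<lambda>i. formal_diff M (m (i - 1)) (m i)) {1..N} =
    formal_diff M (m 0) (m N)"
  using m
proof (induction N)
  case 0
  interpret comm_monoid M by (rule M)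
  interpret K: comm_monoid "grothendieck_group M" by (rule comm_monoid_grothendieck_group[OF M])
  have "formal_diff M \<one>\<^bsub>M\<^esub> \<one>\<^bsub>M\<^esub> = formal_diff M (m 0) (m 0)"
    using 0 by (subst formal_diff_eq_iff[OF M]) auto
  moreover have "\<one>\<^bsub>grothendieck_group M\<^esub> = formal_diff M \<one>\<^bsub>M\<^esub> \<one>\<^bsub>M\<^esub>"
    by (simp add: grothendieck_group_def)
  ultimately show ?case by simp
next
  case (Suc N)
  interpret comm_monoid M by (rule M)
  interpret K: comm_monoid "grothendieck_group M" by (rule comm_monoid_grothendieck_group[OF M])
  have fd: "formal_diff M (m (i - 1)) (m i) \<in> carrier (grothendieck_group M)" if "i \<le> Suc N" for i
    using Suc(2)[of "i - 1"] Suc(2)[OF that] that unfolding carrier_grothendieck_group by auto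
  have "{1..Suc N} = insert (Suc N) {1..N}" by auto
  then have "finprod (grothendieck_group M) (\<lambda>i. formal_diff M (m (i - 1)) (m i)) {1..Suc N} =
    formal_diff M (m N) (m (Suc N)) \<otimes>\<^bsub>grothendieck_group M\<^esub> formal_diff M (m 0) (m N)"
    using fd fd[of "Suc N"] Suc by (simp add: Pi_def)
  also have "\<dots> = formal_diff M (m N \<otimes>\<^bsub>M\<^esub> m 0) (m (Suc N) \<otimes>\<^bsub>M\<^esub> m N)"
    using Suc(2) by (intro mult_formal_diff[OF M]) auto
  also have "\<dots> = formal_diff M (m 0) (m (Suc N))"
    using Suc(2)[of 0] Suc(2)[of N] Suc(2)[of "Suc N"]
    by (subst formal_diff_eq_iff[OF M]) (auto intro!: bexI[of _ "\<one>\<^bsub>M\<^esub>"] simp: m_ac)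
  finally show ?case .
qed

section \<open>The monoid of matrix representations\<close>

lemma lie_group_group: "lie_group G X \<Longrightarrow> group G"
  and lie_group_topspace: "lie_group G X \<Longrightarrow> topspace X = carrier G"
  by (simp_all add: lie_group_def)

lemma matrix_reps_iff:
  "(n, \<rho>) \<in> matrix_reps G X \<longleftrightarrow>
     (\<forall>g\<in>carrier G. \<rho> g \<in> carrier_mat n n) \<and> \<rho> \<one>\<^bsub>G\<^esub> = 1\<^sub>m n \<and>
     (\<forall>g\<in>carrier G. \<forall>h\<in>carrier G. \<rho> (g \<otimes>\<^bsub>G\<^esub> h) = \<rho> g * \<rho> h) \<and>
     (\<forall>i<n. \<forall>j<n. continuous_map X euclideanreal (\<lambda>g. \<rho> g $$ (i, j)))"
  by (simp add: matrix_reps_def)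

lemma invertible_matE:
  assumes "invertible_mat P" "P \<in> carrier_mat n n"
  obtains Q where "Q \<in> carrier_mat n n" "P * Q = 1\<^sub>m n" "Q * P = 1\<^sub>m n"
proof -
  obtain Q where Q: "P * Q = 1\<^sub>m n" "Q * P = 1\<^sub>m (dim_row Q)"
    using assms by (auto simp: invertible_mat_def inverts_mat_def)
  have "dim_col Q = n" using arg_cong[OF Q(1), of dim_col] by simp
  moreover have "dim_row Q = n" using arg_cong[OF Q(2), of dim_col] assms(2) by simp
  ultimately show ?thesis using Q by (intro that[of Q]) auto
qed

lemma rep_isoI:
  assumes "(n, \<rho>) \<in> matrix_reps G X" "(n, \<sigma>) \<in> matrix_reps G X"
    and "P \<in> carrier_mat n n" "Q \<in> carrier_mat n n" "P * Q = 1\<^sub>m n" "Q * P = 1\<^sub>m n"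
    and "\<And>g. g \<in> carrier G \<Longrightarrow> P * \<rho> g = \<sigma> g * P"
  shows "((n, \<rho>), (n, \<sigma>)) \<in> rep_iso G X"
proof -
  have "invertible_mat P"
    using assms(3-6) by (auto simp: invertible_mat_def inverts_mat_def square_mat.simps intro!: exI[of _ Q])
  with assms show ?thesis by (auto simp: rep_iso_def intro!: bexI[of _ P])
qed

lemma rep_isoE:
  assumes "((n, \<rho>), (m, \<sigma>)) \<in> rep_iso G X"
  obtains P Q where "m = n" "(n, \<rho>) \<in> matrix_reps G X" "(n, \<sigma>) \<in> matrix_reps G X"
    "P \<in> carrier_mat n n" "Q \<in> carrier_mat n n" "P * Q = 1\<^sub>m n" "Q * P = 1\<^sub>m n"
    "\<forall>g\<in>carrier G. P * \<rho> g = \<sigma> g * P"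
proof -
  obtain P where P: "m = n" "(n, \<rho>) \<in> matrix_reps G X" "(n, \<sigma>) \<in> matrix_reps G X"
    "P \<in> carrier_mat n n" "invertible_mat P" "\<forall>g\<in>carrier G. P * \<rho> g = \<sigma> g * P"
    using assms by (auto simp: rep_iso_def)
  obtain Q where "Q \<in> carrier_mat n n" "P * Q = 1\<^sub>m n" "Q * P = 1\<^sub>m n"
    using P(5,4) by (rule invertible_matE)
  with P show ?thesis by (intro that[of P Q])
qed

lemma matrix_reps_carrier: "(n, \<rho>) \<in> matrix_reps G X \<Longrightarrow> g \<in> carrier G \<Longrightarrow> \<rho> g \<in> carrier_mat n n"
  by (simp add: matrix_reps_iff)

text \<open>The functions are arbitrary outside the carrier, so agreement on the carrier gives an
  isomorphism but not equality. The associativity and unit laws need this form.\<close>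

lemma rep_isoI_eq:
  assumes "(n, \<rho>) \<in> matrix_reps G X" "(n, \<sigma>) \<in> matrix_reps G X"
    and "\<And>g. g \<in> carrier G \<Longrightarrow> \<rho> g = \<sigma> g"
  shows "((n, \<rho>), (n, \<sigma>)) \<in> rep_iso G X"
proof (rule rep_isoI[OF assms(1,2), of "1\<^sub>m n" "1\<^sub>m n"])
  fix g assume g: "g \<in> carrier G"
  show "1\<^sub>m n * \<rho> g = \<sigma> g * 1\<^sub>m n"
    using left_mult_one_mat[OF matrix_reps_carrier[OF assms(1) g]]
      right_mult_one_mat[OF matrix_reps_carrier[OF assms(2) g]] assms(3)[OF g] by simp
qed simp_all

lemma equiv_rep_iso: "equiv (matrix_reps G X) (rep_iso G X)"
proof (rule equivI)
  show "rep_iso G X \<subseteq> matrix_reps G X \<times> matrix_reps G X"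
    by (auto simp: rep_iso_def)
  show "refl_on (matrix_reps G X) (rep_iso G X)"
  proof (rule refl_onI)
    fix r assume r: "r \<in> matrix_reps G X"
    obtain n \<rho> where n: "r = (n, \<rho>)" by fastforce
    have "((n, \<rho>), (n, \<rho>)) \<in> rep_iso G X"
      using r[unfolded n] by (intro rep_isoI_eq refl)
    then show "(r, r) \<in> rep_iso G X" by (simp add: n)
  qed
  show "sym (rep_iso G X)"
  proof (rule symI)
    fix r s assume rs: "(r, s) \<in> rep_iso G X"
    obtain n \<rho> m \<sigma> where nm: "r = (n, \<rho>)" "s = (m, \<sigma>)" by fastforce
    obtain P Q where P: "m = n" "(n, \<rho>) \<in> matrix_reps G X" "(n, \<sigma>) \<in> matrix_reps G X"
      "P \<in> carrier_mat n n" "Q \<in> carrier_mat n n" "P * Q = 1\<^sub>m n" "Q * P = 1\<^sub>m n"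
      "\<forall>g\<in>carrier G. P * \<rho> g = \<sigma> g * P"
      using rs unfolding nm by (rule rep_isoE)
    have "Q * \<sigma> g = \<rho> g * Q" if g: "g \<in> carrier G" for g
    proof -
      note c = matrix_reps_carrier[OF P(2) g] matrix_reps_carrier[OF P(3) g]
      have "Q * \<sigma> g = Q * (\<sigma> g * P) * Q"
        using c P(4-6) by (simp add: assoc_mult_mat[of _ n n _ n _ n])
      also have "\<dots> = Q * P * \<rho> g * Q"
        using c P(4-5) P(8) g by (simp add: assoc_mult_mat[of _ n n _ n _ n])
      also have "\<dots> = \<rho> g * Q" using c P(7) by simp
      finally show ?thesis .
    qed
    with P show "(s, r) \<in> rep_iso G X"
      unfolding nm P(1) by (intro rep_isoI[of _ _ _ _ _ Q P])
  qed
  show "trans (rep_iso G X)"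
  proof (rule transI)
    fix r s t assume rs: "(r, s) \<in> rep_iso G X" and st: "(s, t) \<in> rep_iso G X"
    obtain n \<rho> m \<sigma> k \<tau> where nm: "r = (n, \<rho>)" "s = (m, \<sigma>)" "t = (k, \<tau>)" by (metis surj_pair)
    obtain P Q where P: "m = n" "(n, \<rho>) \<in> matrix_reps G X" "(n, \<sigma>) \<in> matrix_reps G X"
      "P \<in> carrier_mat n n" "Q \<in> carrier_mat n n" "P * Q = 1\<^sub>m n" "Q * P = 1\<^sub>m n"
      "\<forall>g\<in>carrier G. P * \<rho> g = \<sigma> g * P"
      using rs unfolding nm by (rule rep_isoE)
    obtain P' Q' where P': "k = n" "(n, \<sigma>) \<in> matrix_reps G X" "(n, \<tau>) \<in> matrix_reps G X"
      "P' \<in> carrier_mat n n" "Q' \<in> carrier_mat n n" "P' * Q' = 1\<^sub>m n" "Q' * P' = 1\<^sub>m n"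
      "\<forall>g\<in>carrier G. P' * \<sigma> g = \<tau> g * P'"
      using st unfolding nm P(1) by (rule rep_isoE)
    have "((n, \<rho>), (n, \<tau>)) \<in> rep_iso G X"
    proof (rule rep_isoI[OF P(2) P'(3)])
      show "P' * P \<in> carrier_mat n n" "Q * Q' \<in> carrier_mat n n" using P P' by auto
      have "P' * P * (Q * Q') = P' * (P * Q) * Q'"
        using P(4,5) P'(4,5) by (simp add: assoc_mult_mat[of _ n n _ n _ n])
      then show "P' * P * (Q * Q') = 1\<^sub>m n" using P(6) P'(4-6) by simp
      have "Q * Q' * (P' * P) = Q * (Q' * P') * P"
        using P(4,5) P'(4,5) by (simp add: assoc_mult_mat[of _ n n _ n _ n])
      then show "Q * Q' * (P' * P) = 1\<^sub>m n" using P(4-7) P'(7) by simp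
      fix g assume g: "g \<in> carrier G"
      note c = matrix_reps_carrier[OF P(2) g] matrix_reps_carrier[OF P(3) g] matrix_reps_carrier[OF P'(3) g]
      have "P' * P * \<rho> g = P' * (\<sigma> g * P)"
        using c P(4,8) P'(4) g by (simp add: assoc_mult_mat[of _ n n _ n _ n])
      also have "\<dots> = (P' * \<sigma> g) * P"
        using c P(4) P'(4) by (simp add: assoc_mult_mat[of _ n n _ n _ n])
      also have "\<dots> = \<tau> g * (P' * P)"
        using c P(4) P'(4,8) g by (simp add: assoc_mult_mat[of _ n n _ n _ n])
      finally show "P' * P * \<rho> g = \<tau> g * (P' * P)" .
    qed
    then show "(r, t) \<in> rep_iso G X" unfolding nm P'(1) .
  qed
qed

section \<open>Direct sums of matrix representations\<close>

lemma block_diag_mult: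
  assumes "A \<in> carrier_mat n n" "A' \<in> carrier_mat n n" "D \<in> carrier_mat m m" "D' \<in> carrier_mat m m"
  shows "four_block_mat A (0\<^sub>m n m) (0\<^sub>m m n) D * four_block_mat A' (0\<^sub>m n m) (0\<^sub>m m n) D' =
    four_block_mat (A * A') (0\<^sub>m n m) (0\<^sub>m m n) (D * D' :: 'a::comm_ring_1 mat)"
  using assms by (subst mult_four_block_mat[of _ n n _ m _ m _ _ n _ m]) auto

lemma rep_sum_closed:
  assumes G: "lie_group G X" and r: "r \<in> matrix_reps G X" and s: "s \<in> matrix_reps G X"
  shows "rep_sum r s \<in> matrix_reps G X"
proof -
  interpret group G by (rule lie_group_group[OF G])
  obtain n \<rho> m \<sigma> where nm: "r = (n, \<rho>)" "s = (m, \<sigma>)" by fastforce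
  let ?\<tau> = "\<lambda>g. four_block_mat (\<rho> g) (0\<^sub>m n m) (0\<^sub>m m n) (\<sigma> g)"
  have \<rho>: "\<And>g. g \<in> carrier G \<Longrightarrow> \<rho> g \<in> carrier_mat n n" "\<rho> \<one>\<^bsub>G\<^esub> = 1\<^sub>m n"
    "\<And>g h. g \<in> carrier G \<Longrightarrow> h \<in> carrier G \<Longrightarrow> \<rho> (g \<otimes>\<^bsub>G\<^esub> h) = \<rho> g * \<rho> h"
    "\<And>i j. i < n \<Longrightarrow> j < n \<Longrightarrow> continuous_map X euclideanreal (\<lambda>g. \<rho> g $$ (i, j))"
    using r unfolding nm matrix_reps_iff by auto
  have \<sigma>: "\<And>g. g \<in> carrier G \<Longrightarrow> \<sigma> g \<in> carrier_mat m m" "\<sigma> \<one>\<^bsub>G\<^esub> = 1\<^sub>m m"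
    "\<And>g h. g \<in> carrier G \<Longrightarrow> h \<in> carrier G \<Longrightarrow> \<sigma> (g \<otimes>\<^bsub>G\<^esub> h) = \<sigma> g * \<sigma> h"
    "\<And>i j. i < m \<Longrightarrow> j < m \<Longrightarrow> continuous_map X euclideanreal (\<lambda>g. \<sigma> g $$ (i, j))"
    using s unfolding nm matrix_reps_iff by auto
  have "(n + m, ?\<tau>) \<in> matrix_reps G X"
    unfolding matrix_reps_iff
  proof (intro conjI ballI allI impI)
    show "?\<tau> g \<in> carrier_mat (n + m) (n + m)" if "g \<in> carrier G" for g
      using \<rho>(1)[OF that] \<sigma>(1)[OF that] by simp
    show "?\<tau> \<one>\<^bsub>G\<^esub> = 1\<^sub>m (n + m)" by (simp add: \<rho>(2) \<sigma>(2))
    show "?\<tau> (g \<otimes>\<^bsub>G\<^esub> h) = ?\<tau> g * ?\<tau> h" if g: "g \<in> carrier G" and h: "h \<in> carrier G" for g h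
      unfolding \<rho>(3)[OF g h] \<sigma>(3)[OF g h]
      by (rule block_diag_mult[symmetric]) (use \<rho>(1) \<sigma>(1) g h in auto)
    fix i j assume ij: "i < n + m" "j < n + m"
    let ?e = "\<lambda>g. if i < n then if j < n then \<rho> g $$ (i, j) else 0
      else if j < n then 0 else \<sigma> g $$ (i - n, j - n)"
    have "continuous_map X euclideanreal ?e"
      using ij \<rho>(4)[of i j] \<sigma>(4)[of "i - n" "j - n"] by (cases "i < n"; cases "j < n") auto
    then show "continuous_map X euclideanreal (\<lambda>g. ?\<tau> g $$ (i, j))"
    proof (rule continuous_map_eq)
      fix g assume "g \<in> topspace X"
      then have g: "g \<in> carrier G" by (simp add: lie_group_topspace[OF G])
      show "?e g = ?\<tau> g $$ (i, j)"
        using \<rho>(1)[OF g] \<sigma>(1)[OF g] ij by auto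
    qed
  qed
  then show ?thesis by (simp add: nm)
qed

lemma rep_sum_cong:
  assumes G: "lie_group G X" and r: "(r, r') \<in> rep_iso G X" and s: "(s, s') \<in> rep_iso G X"
  shows "(rep_sum r s, rep_sum r' s') \<in> rep_iso G X"
proof -
  obtain n \<rho> n' \<rho>' m \<sigma> m' \<sigma>' where nm: "r = (n, \<rho>)" "r' = (n', \<rho>')" "s = (m, \<sigma>)" "s' = (m', \<sigma>')"
    by (metis surj_pair)
  obtain P Q where P: "n' = n" "(n, \<rho>) \<in> matrix_reps G X" "(n, \<rho>') \<in> matrix_reps G X"
    "P \<in> carrier_mat n n" "Q \<in> carrier_mat n n" "P * Q = 1\<^sub>m n" "Q * P = 1\<^sub>m n"
    "\<forall>g\<in>carrier G. P * \<rho> g = \<rho>' g * P"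
    using r unfolding nm by (rule rep_isoE)
  obtain P' Q' where P': "m' = m" "(m, \<sigma>) \<in> matrix_reps G X" "(m, \<sigma>') \<in> matrix_reps G X"
    "P' \<in> carrier_mat m m" "Q' \<in> carrier_mat m m" "P' * Q' = 1\<^sub>m m" "Q' * P' = 1\<^sub>m m"
    "\<forall>g\<in>carrier G. P' * \<sigma> g = \<sigma>' g * P'"
    using s unfolding nm by (rule rep_isoE)
  let ?D = "\<lambda>A D. four_block_mat A (0\<^sub>m n m) (0\<^sub>m m n) D :: real mat"
  have "((n + m, \<lambda>g. ?D (\<rho> g) (\<sigma> g)), (n + m, \<lambda>g. ?D (\<rho>' g) (\<sigma>' g))) \<in> rep_iso G X"
  proof (rule rep_isoI)
    show "(n + m, \<lambda>g. ?D (\<rho> g) (\<sigma> g)) \<in> matrix_reps G X"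
      using rep_sum_closed[OF G P(2) P'(2)] by simp
    show "(n + m, \<lambda>g. ?D (\<rho>' g) (\<sigma>' g)) \<in> matrix_reps G X"
      using rep_sum_closed[OF G P(3) P'(3)] by simp
    show "?D P P' \<in> carrier_mat (n + m) (n + m)" "?D Q Q' \<in> carrier_mat (n + m) (n + m)"
      using P(4,5) P'(4,5) by auto
    show "?D P P' * ?D Q Q' = 1\<^sub>m (n + m)" "?D Q Q' * ?D P P' = 1\<^sub>m (n + m)"
      by (simp_all add: block_diag_mult[OF P(4,5) P'(4,5)] block_diag_mult[OF P(5,4) P'(5,4)] P(6,7) P'(6,7))
    fix g assume g: "g \<in> carrier G"
    note c = matrix_reps_carrier[OF P(2) g] matrix_reps_carrier[OF P(3) g]
      matrix_reps_carrier[OF P'(2) g] matrix_reps_carrier[OF P'(3) g]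
    show "?D P P' * ?D (\<rho> g) (\<sigma> g) = ?D (\<rho>' g) (\<sigma>' g) * ?D P P'"
      using P(8) P'(8) g
      by (simp add: block_diag_mult[OF P(4) c(1) P'(4) c(3)] block_diag_mult[OF c(2) P(4) c(4) P'(4)])
  qed
  then show ?thesis by (simp add: nm P(1) P'(1))
qed

lemma rep_sum_commute:
  assumes G: "lie_group G X" and r: "r \<in> matrix_reps G X" and s: "s \<in> matrix_reps G X"
  shows "(rep_sum r s, rep_sum s r) \<in> rep_iso G X"
proof -
  obtain n \<rho> m \<sigma> where nm: "r = (n, \<rho>)" "s = (m, \<sigma>)" by fastforce
  let ?D = "\<lambda>n m A D. four_block_mat A (0\<^sub>m n m) (0\<^sub>m m n) D :: real mat"
  \<comment> \<open>The matrix exchanging the two blocks; its inverse is the exchange with the sizes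
    swapped.\<close>
  let ?S = "\<lambda>n m. four_block_mat (0\<^sub>m m n) (1\<^sub>m m) (1\<^sub>m n) (0\<^sub>m n m) :: real mat"
  have S: "?S n m * ?S m n = 1\<^sub>m (n + m)" for n m
    by (subst mult_four_block_mat[of _ m n _ m _ n _ _ m _ n]) (auto simp: add.commute)
  have "((n + m, \<lambda>g. ?D n m (\<rho> g) (\<sigma> g)), (n + m, \<lambda>g. ?D m n (\<sigma> g) (\<rho> g))) \<in> rep_iso G X"
  proof (rule rep_isoI)
    show "(n + m, \<lambda>g. ?D n m (\<rho> g) (\<sigma> g)) \<in> matrix_reps G X"
      using rep_sum_closed[OF G r s] by (simp add: nm)
    show "(n + m, \<lambda>g. ?D m n (\<sigma> g) (\<rho> g)) \<in> matrix_reps G X"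
      using rep_sum_closed[OF G s r] by (simp add: nm add.commute)
    show "?S n m \<in> carrier_mat (n + m) (n + m)" "?S m n \<in> carrier_mat (n + m) (n + m)"
      by auto
    show "?S n m * ?S m n = 1\<^sub>m (n + m)" "?S m n * ?S n m = 1\<^sub>m (n + m)"
      using S[of n m] S[of m n] by (simp_all add: add.commute)
    fix g assume g: "g \<in> carrier G"
    have c: "\<rho> g \<in> carrier_mat n n" "\<sigma> g \<in> carrier_mat m m"
      using r s g unfolding nm by (auto dest: matrix_reps_carrier)
    have "?S n m * ?D n m (\<rho> g) (\<sigma> g) = four_block_mat (0\<^sub>m m n) (\<sigma> g) (\<rho> g) (0\<^sub>m n m)"
      using c by (subst mult_four_block_mat[of _ m n _ m _ n _ _ n _ m]) auto
    also have "\<dots> = ?D m n (\<sigma> g) (\<rho> g) * ?S n m"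
      using c by (subst mult_four_block_mat[of _ m m _ n _ n _ _ n _ m]) auto
    finally show "?S n m * ?D n m (\<rho> g) (\<sigma> g) = ?D m n (\<sigma> g) (\<rho> g) * ?S n m" .
  qed
  then show ?thesis by (simp add: nm add.commute)
qed

lemma rep_sum_assoc:
  assumes G: "lie_group G X" and r: "r \<in> matrix_reps G X" and s: "s \<in> matrix_reps G X" and t: "t \<in> matrix_reps G X"
  shows "(rep_sum (rep_sum r s) t, rep_sum r (rep_sum s t)) \<in> rep_iso G X"
proof -
  obtain n \<rho> m \<sigma> k \<tau> where nm: "r = (n, \<rho>)" "s = (m, \<sigma>)" "t = (k, \<tau>)" by (metis surj_pair)
  let ?n = "n + m + k"
  have 1: "(?n, snd (rep_sum (rep_sum r s) t)) \<in> matrix_reps G X"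
    using rep_sum_closed[OF G rep_sum_closed[OF G r s] t] by (simp add: nm)
  have 2: "(?n, snd (rep_sum r (rep_sum s t))) \<in> matrix_reps G X"
    using rep_sum_closed[OF G r rep_sum_closed[OF G s t]] by (simp add: nm add.assoc)
  have eq: "snd (rep_sum (rep_sum r s) t) g = snd (rep_sum r (rep_sum s t)) g" if g: "g \<in> carrier G" for g
  proof -
    have c: "\<rho> g \<in> carrier_mat n n" "\<sigma> g \<in> carrier_mat m m" "\<tau> g \<in> carrier_mat k k"
      using r s t g unfolding nm by (auto dest: matrix_reps_carrier)
    show ?thesis
      using assoc_four_block_mat[of "\<rho> g" "\<sigma> g" "\<tau> g"] c by (simp add: nm)
  qed
  have "((?n, snd (rep_sum (rep_sum r s) t)), (?n, snd (rep_sum r (rep_sum s t)))) \<in> rep_iso G X"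
    using 1 2 eq by (rule rep_isoI_eq)
  then show ?thesis by (simp add: nm add.assoc)
qed

lemma rep_sum_zero:
  assumes G: "lie_group G X" and r: "r \<in> matrix_reps G X"
  shows "(0, \<lambda>g. 1\<^sub>m 0) \<in> matrix_reps G X" "(rep_sum (0, \<lambda>g. 1\<^sub>m 0) r, r) \<in> rep_iso G X"
proof -
  show z: "(0, \<lambda>g. 1\<^sub>m 0) \<in> matrix_reps G X"
    by (simp add: matrix_reps_iff)
  obtain n \<rho> where n: "r = (n, \<rho>)" by fastforce
  have 1: "(n, snd (rep_sum (0, \<lambda>g. 1\<^sub>m 0) r)) \<in> matrix_reps G X"
    using rep_sum_closed[OF G z r] by (simp add: n)
  have 2: "(n, \<rho>) \<in> matrix_reps G X" using r by (simp add: n)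
  have "four_block_mat (1\<^sub>m 0) (0\<^sub>m 0 n) (0\<^sub>m n 0) (\<rho> g) = \<rho> g" if "g \<in> carrier G" for g
    using matrix_reps_carrier[OF 2 that] by (intro eq_matI) auto
  then have "((n, snd (rep_sum (0, \<lambda>g. 1\<^sub>m 0) r)), (n, \<rho>)) \<in> rep_iso G X"
    by (intro rep_isoI_eq[OF 1 2]) (simp add: n)
  then show "(rep_sum (0, \<lambda>g. 1\<^sub>m 0) r, r) \<in> rep_iso G X" by (simp add: n)
qed

text \<open>As for formal differences, independence of the representatives collapses the union that
  defines the product.\<close>

lemma rep_monoid_mult_class:
  assumes G: "lie_group G X" and r: "r \<in> matrix_reps G X" and s: "s \<in> matrix_reps G X"
  shows "rep_iso G X `` {r} \<otimes>\<^bsub>rep_monoid G X\<^esub> rep_iso G X `` {s} = rep_iso G X `` {rep_sum r s}"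
proof -
  have "rep_iso G X `` {rep_sum r' s'} = rep_iso G X `` {rep_sum r s}"
    if "r' \<in> rep_iso G X `` {r}" "s' \<in> rep_iso G X `` {s}" for r' s'
    using rep_sum_cong[OF G, of r r' s s'] that equiv_class_eq[OF equiv_rep_iso] by blast
  then have "(\<Union>r'\<in>rep_iso G X `` {r}. \<Union>s'\<in>rep_iso G X `` {s}. rep_iso G X `` {rep_sum r' s'}) =
    (\<Union>r'\<in>rep_iso G X `` {r}. \<Union>s'\<in>rep_iso G X `` {s}. rep_iso G X `` {rep_sum r s})"
    by (intro SUP_cong refl)
  also have "\<dots> = rep_iso G X `` {rep_sum r s}"
    using equiv_class_self[OF equiv_rep_iso r] equiv_class_self[OF equiv_rep_iso s] by blast
  finally show ?thesis by (simp add: rep_monoid_def)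
qed

lemma carrier_rep_monoid: "x \<in> carrier (rep_monoid G X) \<longleftrightarrow> (\<exists>r\<in>matrix_reps G X. x = rep_iso G X `` {r})"
  by (auto simp: rep_monoid_def quotient_def)

lemma comm_monoid_rep_monoid:
  assumes G: "lie_group G X" shows "comm_monoid (rep_monoid G X)"
proof -
  let ?M = "rep_monoid G X" and ?c = "\<lambda>r. rep_iso G X `` {r}"
  note eqI = equiv_class_eq[OF equiv_rep_iso]
  have one: "\<one>\<^bsub>?M\<^esub> = ?c (0, \<lambda>g. 1\<^sub>m 0)" by (simp add: rep_monoid_def)
  have z: "(0, \<lambda>g. 1\<^sub>m 0) \<in> matrix_reps G X" by (simp add: matrix_reps_iff)
  show ?thesis
  proof (rule comm_monoidI)
    fix x y assume "x \<in> carrier ?M" "y \<in> carrier ?M"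
    then obtain r s where r: "r \<in> matrix_reps G X" "x = ?c r" and s: "s \<in> matrix_reps G X" "y = ?c s"
      by (auto simp: carrier_rep_monoid)
    show "x \<otimes>\<^bsub>?M\<^esub> y \<in> carrier ?M"
      unfolding r(2) s(2) rep_monoid_mult_class[OF G r(1) s(1)] carrier_rep_monoid
      using rep_sum_closed[OF G r(1) s(1)] by blast
    show "x \<otimes>\<^bsub>?M\<^esub> y = y \<otimes>\<^bsub>?M\<^esub> x"
      unfolding r(2) s(2) rep_monoid_mult_class[OF G r(1) s(1)] rep_monoid_mult_class[OF G s(1) r(1)]
      by (rule eqI[OF rep_sum_commute[OF G r(1) s(1)]])
    fix w assume "w \<in> carrier ?M"
    then obtain t where t: "t \<in> matrix_reps G X" "w = ?c t"
      by (auto simp: carrier_rep_monoid)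
    show "(x \<otimes>\<^bsub>?M\<^esub> y) \<otimes>\<^bsub>?M\<^esub> w = x \<otimes>\<^bsub>?M\<^esub> (y \<otimes>\<^bsub>?M\<^esub> w)"
      unfolding r(2) s(2) t(2) rep_monoid_mult_class[OF G r(1) s(1)] rep_monoid_mult_class[OF G s(1) t(1)]
        rep_monoid_mult_class[OF G rep_sum_closed[OF G r(1) s(1)] t(1)]
        rep_monoid_mult_class[OF G r(1) rep_sum_closed[OF G s(1) t(1)]]
      by (rule eqI[OF rep_sum_assoc[OF G r(1) s(1) t(1)]])
  next
    show "\<one>\<^bsub>?M\<^esub> \<in> carrier ?M" unfolding one carrier_rep_monoid using z by blast
  next
    fix x assume "x \<in> carrier ?M"
    then obtain r where r: "r \<in> matrix_reps G X" "x = ?c r"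
      by (auto simp: carrier_rep_monoid)
    show "\<one>\<^bsub>?M\<^esub> \<otimes>\<^bsub>?M\<^esub> x = x"
      unfolding r(2) one rep_monoid_mult_class[OF G z r(1)]
      by (rule eqI[OF rep_sum_zero(2)[OF G r(1)]])
  qed
qed

section \<open>Representations on invariant subspaces\<close>

text \<open>Column \<open>j\<close> of \<open>A\<close>, read as coordinates with respect to
  \<open>b\<close>. The result is again a family of vectors, so iterating the construction
  corresponds to matrix multiplication and identities of matrices can be checked on basis
  vectors.\<close>

definition bcomb :: "nat \<Rightarrow> (nat \<Rightarrow> 'h::real_vector) \<Rightarrow> real mat \<Rightarrow> nat \<Rightarrow> 'h" where
  "bcomb n b A j = (\<Sum>i<n. A $$ (i, j) *\<^sub>R b i)"

definition is_basis :: "nat \<Rightarrow> (nat \<Rightarrow> 'h::real_vector) \<Rightarrow> 'h set \<Rightarrow> bool" where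
  "is_basis n b E \<longleftrightarrow> inj_on b {..<n} \<and> independent (b ` {..<n}) \<and> span (b ` {..<n}) = E"

section \<open>Finite bases and coordinates\<close>

lemma spanning_imp_independent:
  fixes S :: "'h::real_vector set"
  assumes I: "independent I" and S: "finite S" "card S \<le> card I" and sub: "I \<subseteq> span S"
  shows "independent S" "card S = card I"
proof -
  have fI: "finite I" and le: "card I \<le> card S"
    using independent_span_bound[OF S(1) I sub] by auto
  then show card: "card S = card I" using S(2) by simp
  show "independent S"
  proof
    assume "dependent S"
    then obtain a where a: "a \<in> S" "a \<in> span (S - {a})" unfolding dependent_def by blast
    have "S \<subseteq> span (S - {a})"
    proof
      fix x assume "x \<in> S"
      with a(2) show "x \<in> span (S - {a})" by (cases "x = a") (auto intro: span_base)
    qed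
    then have "span S \<subseteq> span (S - {a})" by (rule span_minimal) simp
    with sub have "I \<subseteq> span (S - {a})" by (rule subset_trans)
    then have "card I \<le> card (S - {a})"
      using independent_span_bound[OF _ I] S(1) by blast
    also have "\<dots> < card S" by (rule card_Diff1_less[OF S(1) a(1)])
    finally show False using card by simp
  qed
qed

text \<open>A vector of \<open>S\<close> outside the span would extend \<open>I\<close> to more than
  \<open>card S\<close> independent vectors in \<open>span S\<close>.\<close>

lemma independent_imp_spanning:
  fixes S :: "'h::real_vector set"
  assumes I: "independent I" and S: "finite S" "card S \<le> card I" and sub: "I \<subseteq> span S"
  shows "S \<subseteq> span I"
proof (rule ccontr)
  assume "\<not> S \<subseteq> span I"
  then obtain s where s: "s \<in> S" "s \<notin> span I" by blast
  have fI: "finite I" using independent_span_bound[OF S(1) I sub] by auto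
  have "independent (insert s I)" using I s(2) by (simp add: independent_insert)
  moreover have "insert s I \<subseteq> span S" using sub s(1) by (auto intro: span_base)
  ultimately have "card (insert s I) \<le> card S"
    using independent_span_bound[OF S(1)] by blast
  moreover have "s \<notin> I" using s(2) span_base by blast
  ultimately show False using fI S(2) by simp
qed

lemma is_basis_card: "is_basis n b E \<Longrightarrow> card (b ` {..<n}) = n"
  by (simp add: is_basis_def card_image)

lemma is_basis_transfer:
  assumes b: "is_basis n b E" and b': "span (b' ` {..<n}) = E"
  shows "is_basis n b' E"
proof -
  have I: "independent (b ` {..<n})" "b ` {..<n} \<subseteq> span (b' ` {..<n})"
    using b b' by (auto simp: is_basis_def intro: span_base)
  have "card (b' ` {..<n}) \<le> card (b ` {..<n})"
    unfolding is_basis_card[OF b] using card_image_le[of "{..<n}" b'] by simp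
  from spanning_imp_independent[OF I(1) _ this I(2)]
  have "independent (b' ` {..<n})" "card (b' ` {..<n}) = card {..<n}"
    using is_basis_card[OF b] by simp_all
  with b' show ?thesis by (auto simp: is_basis_def intro: eq_card_imp_inj_on)
qed

lemma is_basis_same_size:
  assumes "is_basis n b E" "is_basis m b' E"
  shows "m = n"
proof -
  have "dim E = n" "dim E = m"
    using assms is_basis_card[OF assms(1)] is_basis_card[OF assms(2)]
    by (metis is_basis_def dim_span_eq_card_independent)+
  then show ?thesis by simp
qed

lemma is_basis_coordinates:
  assumes b: "is_basis n b E" and y: "y \<in> E"
  shows "\<exists>c. y = (\<Sum>i<n. c i *\<^sub>R b i)"
proof -
  have "y \<in> range (\<lambda>u. \<Sum>v\<in>b ` {..<n}. u v *\<^sub>R v)"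
    using b y span_finite[of "b ` {..<n}"] by (simp add: is_basis_def)
  then obtain u where "y = (\<Sum>v\<in>b ` {..<n}. u v *\<^sub>R v)" by blast
  also have "\<dots> = (\<Sum>i<n. u (b i) *\<^sub>R b i)"
    using b by (subst sum.reindex) (auto simp: is_basis_def)
  finally show ?thesis by (intro exI[of _ "\<lambda>i. u (b i)"])
qed

lemma is_basis_zero_coordinates:
  assumes b: "is_basis n b E" and 0: "(\<Sum>i<n. c i *\<^sub>R b i) = 0" and i: "i < n"
  shows "c i = 0"
proof -
  have inj: "inj_on b {..<n}" and ind: "independent (b ` {..<n})" using b by (auto simp: is_basis_def)
  define u where "u v = c (inv_into {..<n} b v)" for v
  have ub: "u (b j) = c j" if "j < n" for j
    using inv_into_f_f[OF inj] that by (simp add: u_def)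
  have "(\<Sum>v\<in>b ` {..<n}. u v *\<^sub>R v) = (\<Sum>j<n. u (b j) *\<^sub>R b j)"
    using inj by (subst sum.reindex) auto
  also have "\<dots> = 0" using 0 ub by simp
  finally have "u (b i) = 0"
    using independentD[OF ind _ order_refl, of u "b i"] i by blast
  with ub[OF i] show ?thesis by simp
qed

lemma bcomb_exists:
  assumes b: "is_basis n b E" and v: "\<And>j. j < m \<Longrightarrow> v j \<in> E"
  obtains A where "A \<in> carrier_mat n m" "\<forall>j<m. bcomb n b A j = v j"
proof -
  have "\<forall>j. \<exists>c. j < m \<longrightarrow> v j = (\<Sum>i<n. c i *\<^sub>R b i)"
    using is_basis_coordinates[OF b v] by blast
  then obtain c where c: "\<forall>j. j < m \<longrightarrow> v j = (\<Sum>i<n. c j i *\<^sub>R b i)" by (rule choice[THEN exE])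
  show ?thesis
    by (rule that[of "mat n m (\<lambda>(i, j). c j i)"]) (use c in \<open>auto simp: bcomb_def\<close>)
qed

lemma bcomb_inject:
  assumes b: "is_basis n b E" and A: "A \<in> carrier_mat n m" "B \<in> carrier_mat n m"
    and eq: "\<And>j. j < m \<Longrightarrow> bcomb n b A j = bcomb n b B j"
  shows "A = B"
proof (rule eq_matI)
  fix i j assume ij: "i < dim_row B" "j < dim_col B"
  then have ij: "i < n" "j < m" using A by auto
  have "(\<Sum>i<n. (A $$ (i, j) - B $$ (i, j)) *\<^sub>R b i) = 0"
    using eq[OF ij(2)] by (simp add: bcomb_def scaleR_diff_left sum_subtractf)
  from is_basis_zero_coordinates[OF b this ij(1)] show "A $$ (i, j) = B $$ (i, j)" by simp
qed (use A in auto)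

lemma bcomb_bcomb:
  assumes A: "A \<in> carrier_mat n m" and B: "B \<in> carrier_mat m k" and j: "j < k"
  shows "bcomb m (bcomb n b A) B j = bcomb n b (A * B) j"
proof -
  have e: "(A * B) $$ (i, j) = (\<Sum>l<m. A $$ (i, l) * B $$ (l, j))" if "i < n" for i
    using A B j that by (simp add: scalar_prod_def atLeast0LessThan)
  have "bcomb m (bcomb n b A) B j = (\<Sum>l<m. \<Sum>i<n. (A $$ (i, l) * B $$ (l, j)) *\<^sub>R b i)"
    unfolding bcomb_def by (simp add: scaleR_sum_right mult.commute)
  also have "\<dots> = (\<Sum>i<n. \<Sum>l<m. (A $$ (i, l) * B $$ (l, j)) *\<^sub>R b i)"
    by (rule sum.swap)
  also have "\<dots> = bcomb n b (A * B) j"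
    unfolding bcomb_def by (intro sum.cong refl) (simp add: e scaleR_sum_left)
  finally show ?thesis .
qed

lemma bcomb_cong:
  assumes "\<And>i. i < n \<Longrightarrow> b i = b' i" shows "bcomb n b A j = bcomb n b' A j"
  unfolding bcomb_def using assms by (intro sum.cong) auto

lemma bcomb_one: "j < n \<Longrightarrow> bcomb n b (1\<^sub>m n) j = b j"
proof -
  assume j: "j < n"
  have "bcomb n b (1\<^sub>m n) j = (\<Sum>i<n. if i = j then b i else 0)"
    unfolding bcomb_def using j by (intro sum.cong) auto
  with j show ?thesis by simp
qed

lemma bcomb_in_span: "bcomb n b A j \<in> span (b ` {..<n})"
  unfolding bcomb_def by (intro span_sum span_scale span_base) auto

lemma linear_bcomb: "linear f \<Longrightarrow> f (bcomb n b A j) = bcomb n (\<lambda>i. f (b i)) A j"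
  unfolding bcomb_def by (simp add: linear_sum linear_scale)

section \<open>Matrix representations of invariant subspaces\<close>

lemma mem_rep_class:
  "(n, \<rho>) \<in> rep_class G X act E \<longleftrightarrow> (n, \<rho>) \<in> matrix_reps G X \<and>
     (\<exists>b. is_basis n b E \<and> (\<forall>g\<in>carrier G. \<forall>j<n. act g (b j) = bcomb n b (\<rho> g) j))"
  by (auto simp: rep_class_def is_basis_def bcomb_def)

text \<open>Matrices of the action in two bases are intertwined by the change of basis. Conversely,
  an intertwiner applied to a given basis yields a basis in which the other matrices appear. This
  makes the set of all matrices of the action an element of the monoid.\<close>

lemma rep_class_eq_rep_iso_class:
  fixes act :: "'g \<Rightarrow> 'h \<Rightarrow> 'h::real_vector"
  assumes lin: "\<And>g. g \<in> carrier G \<Longrightarrow> linear (act g)" and r: "r \<in> rep_class G X act E"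
  shows "rep_class G X act E = rep_iso G X `` {r}"
proof -
  obtain n \<rho> where n: "r = (n, \<rho>)" by fastforce
  obtain b where \<rho>: "(n, \<rho>) \<in> matrix_reps G X" and b: "is_basis n b E"
    "\<forall>g\<in>carrier G. \<forall>j<n. act g (b j) = bcomb n b (\<rho> g) j"
    using r unfolding n mem_rep_class by blast
  have 1: "(m, \<sigma>) \<in> rep_class G X act E \<Longrightarrow> ((n, \<rho>), (m, \<sigma>)) \<in> rep_iso G X" for m \<sigma>
  proof -
    assume "(m, \<sigma>) \<in> rep_class G X act E"
    then obtain b' where \<sigma>: "(m, \<sigma>) \<in> matrix_reps G X" and b': "is_basis m b' E"
      "\<forall>g\<in>carrier G. \<forall>j<m. act g (b' j) = bcomb m b' (\<sigma> g) j"
      unfolding mem_rep_class by blast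
    have m: "m = n" using b(1) b'(1) by (rule is_basis_same_size)
    note b' = b'[unfolded m] and \<sigma> = \<sigma>[unfolded m]
    have in_E: "b j \<in> E" "b' j \<in> E" if "j < n" for j
      using b(1) b'(1) that unfolding is_basis_def by (auto intro: span_base)
    obtain P where P: "P \<in> carrier_mat n n" "\<forall>j<n. bcomb n b' P j = b j"
      by (rule bcomb_exists[OF b'(1) in_E(1)])
    obtain Q where Q: "Q \<in> carrier_mat n n" "\<forall>j<n. bcomb n b Q j = b' j"
      by (rule bcomb_exists[OF b(1) in_E(2)])
    have QP: "Q * P = 1\<^sub>m n"
    proof (rule bcomb_inject[OF b(1)])
      fix j assume j: "j < n"
      have "bcomb n b (Q * P) j = bcomb n (bcomb n b Q) P j"
        by (rule bcomb_bcomb[OF Q(1) P(1) j, symmetric])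
      also have "\<dots> = bcomb n b' P j" using Q(2) by (intro bcomb_cong) simp
      finally show "bcomb n b (Q * P) j = bcomb n b (1\<^sub>m n) j" using P(2) j by (simp add: bcomb_one)
    qed (use P Q in auto)
    have PQ: "P * Q = 1\<^sub>m n"
    proof (rule bcomb_inject[OF b'(1)])
      fix j assume j: "j < n"
      have "bcomb n b' (P * Q) j = bcomb n (bcomb n b' P) Q j"
        by (rule bcomb_bcomb[OF P(1) Q(1) j, symmetric])
      also have "\<dots> = bcomb n b Q j" using P(2) by (intro bcomb_cong) simp
      finally show "bcomb n b' (P * Q) j = bcomb n b' (1\<^sub>m n) j" using Q(2) j by (simp add: bcomb_one)
    qed (use P Q in auto)
    show "((n, \<rho>), (m, \<sigma>)) \<in> rep_iso G X"
      unfolding m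
    proof (rule rep_isoI[OF \<rho> \<sigma> P(1) Q(1) PQ QP])
      fix g assume g: "g \<in> carrier G"
      note c = matrix_reps_carrier[OF \<rho> g] matrix_reps_carrier[OF \<sigma> g]
      show "P * \<rho> g = \<sigma> g * P"
      proof (rule bcomb_inject[OF b'(1)])
        fix j assume j: "j < n"
        have "bcomb n b' (P * \<rho> g) j = bcomb n (bcomb n b' P) (\<rho> g) j"
          by (rule bcomb_bcomb[OF P(1) c(1) j, symmetric])
        also have "\<dots> = bcomb n b (\<rho> g) j" using P(2) by (intro bcomb_cong) simp
        also have "\<dots> = act g (bcomb n b' P j)" using b(2) P(2) g j by simp
        also have "\<dots> = bcomb n (\<lambda>i. act g (b' i)) P j" by (rule linear_bcomb[OF lin[OF g]])
        also have "\<dots> = bcomb n (bcomb n b' (\<sigma> g)) P j" using b'(2) g by (intro bcomb_cong) simp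
        also have "\<dots> = bcomb n b' (\<sigma> g * P) j" by (rule bcomb_bcomb[OF c(2) P(1) j])
        finally show "bcomb n b' (P * \<rho> g) j = bcomb n b' (\<sigma> g * P) j" .
      qed (use P c in auto)
    qed
  qed
  have 2: "((n, \<rho>), (m, \<sigma>)) \<in> rep_iso G X \<Longrightarrow> (m, \<sigma>) \<in> rep_class G X act E" for m \<sigma>
  proof -
    assume "((n, \<rho>), (m, \<sigma>)) \<in> rep_iso G X"
    then obtain P Q where P: "m = n" "(n, \<rho>) \<in> matrix_reps G X" "(n, \<sigma>) \<in> matrix_reps G X"
      "P \<in> carrier_mat n n" "Q \<in> carrier_mat n n" "P * Q = 1\<^sub>m n" "Q * P = 1\<^sub>m n"
      "\<forall>g\<in>carrier G. P * \<rho> g = \<sigma> g * P"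
      by (rule rep_isoE)
    \<comment> \<open>The inverse \<open>Q\<close> gives the new basis, since
      \<open>P * \<rho> g = \<sigma> g * P\<close> amounts to
      \<open>\<rho> g * Q = Q * \<sigma> g\<close>.\<close>
    let ?b = "bcomb n b Q"
    have bP: "bcomb n ?b P j = b j" if "j < n" for j
      using bcomb_bcomb[OF P(5,4) that, of b] that by (simp add: P(7) bcomb_one)
    have "span (?b ` {..<n}) = E"
    proof (rule subset_antisym)
      show "span (?b ` {..<n}) \<subseteq> E"
        using b(1) bcomb_in_span[of n b Q] unfolding is_basis_def
        by (intro span_minimal) (auto simp: subspace_span)
      have "b ` {..<n} \<subseteq> span (?b ` {..<n})"
        using bP bcomb_in_span[of n ?b P] by (intro image_subsetI) (metis lessThan_iff)
      then show "E \<subseteq> span (?b ` {..<n})"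
        using b(1) unfolding is_basis_def by (metis span_minimal subspace_span)
    qed
    with b(1) have basis: "is_basis n ?b E" by (rule is_basis_transfer)
    have "act g (?b j) = bcomb n ?b (\<sigma> g) j" if g: "g \<in> carrier G" and j: "j < n" for g j
    proof -
      note c = matrix_reps_carrier[OF P(2) g] matrix_reps_carrier[OF P(3) g]
      have "\<rho> g * Q = Q * P * \<rho> g * Q" using c by (simp add: P(7))
      also have "\<dots> = Q * (\<sigma> g * P) * Q"
        using c P(4,5) P(8) g by (simp add: assoc_mult_mat[of _ n n _ n _ n])
      also have "\<dots> = Q * \<sigma> g"
        using c P(4,5,6) by (simp add: assoc_mult_mat[of _ n n _ n _ n])
      finally have eq: "\<rho> g * Q = Q * \<sigma> g" .
      have "act g (?b j) = bcomb n (\<lambda>i. act g (b i)) Q j" by (rule linear_bcomb[OF lin[OF g]])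
      also have "\<dots> = bcomb n (bcomb n b (\<rho> g)) Q j" using b(2) g by (intro bcomb_cong) simp
      also have "\<dots> = bcomb n b (\<rho> g * Q) j" by (rule bcomb_bcomb[OF c(1) P(5) j])
      also have "\<dots> = bcomb n ?b (\<sigma> g) j" unfolding eq by (rule bcomb_bcomb[OF P(5) c(2) j, symmetric])
      finally show ?thesis .
    qed
    with basis P(3) show "(m, \<sigma>) \<in> rep_class G X act E" unfolding P(1) mem_rep_class by blast
  qed
  show ?thesis unfolding n using 1 2 by auto
qed

lemma is_basisI_zero_coordinates:
  assumes 0: "\<And>c i. (\<Sum>i<n. c i *\<^sub>R b i) = 0 \<Longrightarrow> i < n \<Longrightarrow> c i = 0"
  shows "is_basis n b (span (b ` {..<n}))"
proof -
  have inj: "inj_on b {..<n}"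
  proof (rule inj_onI, rule ccontr)
    fix i j assume ij: "i \<in> {..<n}" "j \<in> {..<n}" "b i = b j" "i \<noteq> j"
    define c where "c k = (if k = i then 1 else 0) - (if k = j then 1 else (0::real))" for k
    have "(\<Sum>k<n. c k *\<^sub>R b k) = (\<Sum>k<n. if k = i then b k else 0) - (\<Sum>k<n. if k = j then b k else 0)"
      unfolding sum_subtractf[symmetric] by (intro sum.cong) (auto simp: c_def)
    also have "\<dots> = 0" using ij by simp
    finally have "c i = 0" using 0[of c i] ij(1) by simp
    with ij(4) show False by (simp add: c_def)
  qed
  have "independent (b ` {..<n})"
  proof (rule independent_if_scalars_zero)
    fix f x assume f: "(\<Sum>x\<in>b ` {..<n}. f x *\<^sub>R x) = 0" and x: "x \<in> b ` {..<n}"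
    have "(\<Sum>i<n. f (b i) *\<^sub>R b i) = 0"
      using f inj by (simp add: sum.reindex)
    with x show "f x = 0" using 0[of "\<lambda>i. f (b i)"] by auto
  qed simp
  with inj show ?thesis by (simp add: is_basis_def)
qed

lemma orthonormal_is_basis:
  assumes b: "orthonormal n b" shows "is_basis n b (span (b ` {..<n}))"
proof (rule is_basisI_zero_coordinates)
  fix c i assume c: "(\<Sum>i<n. c i *\<^sub>R b i) = 0" and i: "i < n"
  have "0 = (\<Sum>j<n. c j *\<^sub>R b j) \<bullet> b i" using c by simp
  also have "\<dots> = (\<Sum>j<n. if j = i then c j else 0)"
    unfolding inner_sum_left using b i by (intro sum.cong) (auto simp: orthonormal_def)
  also have "\<dots> = c i" using i by simp
  finally show "c i = 0" by simp
qed

section \<open>Subrepresentations of an orthogonal action\<close>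

lemma orthogonal_action_linear: "orthogonal_action G X act \<Longrightarrow> g \<in> carrier G \<Longrightarrow> linear (act g)"
  by (simp add: orthogonal_action_def orthogonal_transformation_def)

lemma orthogonal_action_inner:
  "orthogonal_action G X act \<Longrightarrow> g \<in> carrier G \<Longrightarrow> act g u \<bullet> act g v = u \<bullet> v"
  by (simp add: orthogonal_action_def orthogonal_transformation_def)

lemma orthogonal_action_mult:
  assumes "orthogonal_action G X act" "g \<in> carrier G" "h \<in> carrier G"
  shows "act (g \<otimes>\<^bsub>G\<^esub> h) u = act g (act h u)"
  using assms group_action.composition_rule[of G UNIV act u g h] by (simp add: orthogonal_action_def)

lemma orthogonal_action_one:
  assumes "orthogonal_action G X act" shows "act \<one>\<^bsub>G\<^esub> u = u"
proof -
  have "group_action G UNIV act" using assms by (simp add: orthogonal_action_def)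
  from group_action.id_eq_one[OF this] have "(\<lambda>x\<in>UNIV. x) u = act \<one>\<^bsub>G\<^esub> u" by metis
  then show ?thesis by simp
qed

lemma orthogonal_action_continuous:
  assumes "orthogonal_action G X act"
  shows "continuous_map X euclideanreal (\<lambda>g. act g u \<bullet> v)"
proof -
  have "continuous_map X (prod_topology X euclidean) (\<lambda>g. (g, u))"
    by (simp add: continuous_map_paired)
  moreover have "continuous_map (prod_topology X euclidean) euclidean (\<lambda>(g, u). act g u)"
    using assms by (simp add: orthogonal_action_def)
  ultimately have "continuous_map X euclidean ((\<lambda>(g, u). act g u) \<circ> (\<lambda>g. (g, u)))"
    by (rule continuous_map_compose)
  moreover have "continuous_map euclidean euclideanreal (\<lambda>w. w \<bullet> v)"
    by (simp add: continuous_on_inner continuous_on_id)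
  ultimately have "continuous_map X euclideanreal ((\<lambda>w. w \<bullet> v) \<circ> ((\<lambda>(g, u). act g u) \<circ> (\<lambda>g. (g, u))))"
    by (rule continuous_map_compose)
  then show ?thesis by (simp add: o_def)
qed

text \<open>In an orthonormal basis the matrix entries are the inner products
  \<open>act g (b j) \<bullet> b i\<close>, which depend continuously on \<open>g\<close>; the
  homomorphism laws are then read off from the coordinates.\<close>

lemma rep_class_nonempty:
  fixes act :: "'g \<Rightarrow> 'h \<Rightarrow> 'h::real_inner"
  assumes G: "lie_group G X" and act: "orthogonal_action G X act"
    and E: "subspace E" "finite_dim E" and inv: "\<And>g u. g \<in> carrier G \<Longrightarrow> u \<in> E \<Longrightarrow> act g u \<in> E"
  shows "\<exists>r. r \<in> rep_class G X act E"
proof -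
  interpret group G by (rule lie_group_group[OF G])
  obtain n b where b: "orthonormal n b" "span (b ` {..<n}) = E"
    using E by (rule orthonormal_basis_exists)
  have basis: "is_basis n b E" using orthonormal_is_basis[OF b(1)] b(2) by simp
  have bE: "b j \<in> E" if "j < n" for j using that unfolding b(2)[symmetric] by (intro span_base) simp
  define \<rho> where "\<rho> g = mat n n (\<lambda>(i, j). act g (b j) \<bullet> b i)" for g
  have c: "\<rho> g \<in> carrier_mat n n" for g by (simp add: \<rho>_def)
  have mat: "act g (b j) = bcomb n b (\<rho> g) j" if g: "g \<in> carrier G" and j: "j < n" for g j
  proof -
    have "oproj n b (act g (b j)) = act g (b j)"
    proof (rule oproj_unique[OF b(1)])
      show "act g (b j) \<in> span (b ` {..<n})" unfolding b(2) by (intro inv g bE j)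
      show "act g (b j) - act g (b j) \<in> (span (b ` {..<n}))\<^sup>\<bottom>"
        by (simp add: subspace_0 subspace_orthogonal_comp)
    qed
    then show ?thesis using j by (simp add: oproj_def bcomb_def \<rho>_def)
  qed
  have "(n, \<rho>) \<in> matrix_reps G X"
    unfolding matrix_reps_iff
  proof (intro conjI ballI allI impI c)
    show "\<rho> \<one>\<^bsub>G\<^esub> = 1\<^sub>m n"
    proof (rule bcomb_inject[OF basis c])
      show "bcomb n b (\<rho> \<one>\<^bsub>G\<^esub>) j = bcomb n b (1\<^sub>m n) j" if "j < n" for j
        using mat[OF one_closed that] that by (simp add: orthogonal_action_one[OF act] bcomb_one)
    qed simp
    fix g h assume g: "g \<in> carrier G" and h: "h \<in> carrier G"
    show "\<rho> (g \<otimes>\<^bsub>G\<^esub> h) = \<rho> g * \<rho> h"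
    proof (rule bcomb_inject[OF basis c])
      fix j assume j: "j < n"
      have "bcomb n b (\<rho> (g \<otimes>\<^bsub>G\<^esub> h)) j = act g (act h (b j))"
        using mat[OF m_closed[OF g h] j] by (simp add: orthogonal_action_mult[OF act g h])
      also have "\<dots> = bcomb n (\<lambda>i. act g (b i)) (\<rho> h) j"
        unfolding mat[OF h j] by (rule linear_bcomb[OF orthogonal_action_linear[OF act g]])
      also have "\<dots> = bcomb n (bcomb n b (\<rho> g)) (\<rho> h) j" by (rule bcomb_cong[OF mat[OF g]])
      also have "\<dots> = bcomb n b (\<rho> g * \<rho> h) j" by (rule bcomb_bcomb[OF c c j])
      finally show "bcomb n b (\<rho> (g \<otimes>\<^bsub>G\<^esub> h)) j = bcomb n b (\<rho> g * \<rho> h) j" .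
    qed (rule mult_carrier_mat[OF c c])
  next
    fix i j assume "i < n" "j < n"
    then show "continuous_map X euclideanreal (\<lambda>g. \<rho> g $$ (i, j))"
      using orthogonal_action_continuous[OF act, of "b j" "b i"] by (simp add: \<rho>_def)
  qed
  with basis mat show ?thesis
    by (intro exI[of _ "(n, \<rho>)"]) (auto simp: mem_rep_class)
qed

lemma sum_lessThan_add: "(\<Sum>i<n + m. f i) = (\<Sum>i<n. f i) + (\<Sum>j<m. f (n + j :: nat) :: 'a::comm_monoid_add)"
  by (induction m) (simp_all add: add.assoc)

text \<open>The bases are concatenated, the second one shifted by \<open>n\<close>; the trivial
  intersection makes the joint family independent, and the action becomes block diagonal.\<close>

lemma rep_sum_mem_rep_class:
  fixes act :: "'g \<Rightarrow> 'h \<Rightarrow> 'h::real_vector"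
  assumes G: "lie_group G X" and r: "r \<in> rep_class G X act E" and s: "s \<in> rep_class G X act E'"
    and int: "E \<inter> E' = {0}"
  shows "rep_sum r s \<in> rep_class G X act (span (E \<union> E'))"
proof -
  obtain n \<rho> m \<sigma> where nm: "r = (n, \<rho>)" "s = (m, \<sigma>)" by fastforce
  obtain b where \<rho>: "(n, \<rho>) \<in> matrix_reps G X" and b: "is_basis n b E"
    "\<forall>g\<in>carrier G. \<forall>j<n. act g (b j) = bcomb n b (\<rho> g) j"
    using r unfolding nm mem_rep_class by blast
  obtain b' where \<sigma>: "(m, \<sigma>) \<in> matrix_reps G X" and b': "is_basis m b' E'"
    "\<forall>g\<in>carrier G. \<forall>j<m. act g (b' j) = bcomb m b' (\<sigma> g) j"
    using s unfolding nm mem_rep_class by blast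
  define d where "d i = (if i < n then b i else b' (i - n))" for i
  have d: "d i = b i" if "i < n" for i
    using that by (simp add: d_def)
  have d': "d (n + j) = b' j" for j by (simp add: d_def)
  have split: "(\<Sum>i<n + m. f i *\<^sub>R d i) = (\<Sum>i<n. f i *\<^sub>R b i) + (\<Sum>j<m. f (n + j) *\<^sub>R b' j)" for f
  proof -
    have "(\<Sum>i<n. f i *\<^sub>R d i) = (\<Sum>i<n. f i *\<^sub>R b i)"
      by (intro sum.cong) (simp_all add: d)
    then show ?thesis by (simp add: sum_lessThan_add d')
  qed
  have img: "d ` {..<n + m} = b ` {..<n} \<union> b' ` {..<m}"
  proof -
    have "{..<n + m} = {..<n} \<union> (\<lambda>j. n + j) ` {..<m}"
    proof (intro equalityI subsetI)
      fix x assume "x \<in> {..<n + m}"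
      then show "x \<in> {..<n} \<union> (\<lambda>j. n + j) ` {..<m}"
        by (cases "x < n") (auto intro!: image_eqI[of _ _ "x - n"])
    qed auto
    then have "d ` {..<n + m} = d ` {..<n} \<union> (\<lambda>j. d (n + j)) ` {..<m}"
      by (simp add: image_Un image_image)
    then show ?thesis using d by (simp add: d' cong: image_cong_simp)
  qed
  have E: "span (b ` {..<n}) = E" "span (b' ` {..<m}) = E'"
    using b(1) b'(1) by (simp_all add: is_basis_def)
  have sp: "span (d ` {..<n + m}) = span (E \<union> E')"
  proof (rule subset_antisym)
    show "span (d ` {..<n + m}) \<subseteq> span (E \<union> E')"
      unfolding img by (intro span_mono) (auto simp: E[symmetric] intro: span_base)
    have "E \<union> E' \<subseteq> span (d ` {..<n + m})"
      unfolding img using span_mono[of "b ` {..<n}" "b ` {..<n} \<union> b' ` {..<m}"]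
        span_mono[of "b' ` {..<m}" "b ` {..<n} \<union> b' ` {..<m}"] by (simp add: E)
    then show "span (E \<union> E') \<subseteq> span (d ` {..<n + m})"
      by (rule span_minimal) simp
  qed
  have "is_basis (n + m) d (span (d ` {..<n + m}))"
  proof (rule is_basisI_zero_coordinates)
    fix c i assume c: "(\<Sum>i<n + m. c i *\<^sub>R d i) = 0" and i: "i < n + m"
    define x y where "x = (\<Sum>i<n. c i *\<^sub>R b i)" and "y = (\<Sum>j<m. c (n + j) *\<^sub>R b' j)"
    have "x + y = 0"
      using c by (simp add: split x_def y_def)
    moreover have xE: "x \<in> E" unfolding x_def E(1)[symmetric] by (intro span_sum span_scale span_base) auto
    moreover have yE: "y \<in> E'" unfolding y_def E(2)[symmetric] by (intro span_sum span_scale span_base) auto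
    moreover have "- y \<in> E'" using yE unfolding E(2)[symmetric] by (rule span_neg)
    ultimately have "x \<in> E \<inter> E'" by (simp add: add_eq_0_iff2)
    with int \<open>x + y = 0\<close> have "x = 0" "y = 0" by auto
    show "c i = 0"
    proof (cases "i < n")
      case True
      with is_basis_zero_coordinates[OF b(1)] \<open>x = 0\<close> show ?thesis by (simp add: x_def)
    next
      case False
      with i have "i - n < m" by simp
      with is_basis_zero_coordinates[OF b'(1) \<open>y = 0\<close>[unfolded y_def]] False show ?thesis by fastforce
    qed
  qed
  then have basis: "is_basis (n + m) d (span (E \<union> E'))" by (simp add: sp)
  let ?\<tau> = "\<lambda>g. four_block_mat (\<rho> g) (0\<^sub>m n m) (0\<^sub>m m n) (\<sigma> g)"
  have "act g (d k) = bcomb (n + m) d (?\<tau> g) k" if g: "g \<in> carrier G" and k: "k < n + m" for g k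
  proof -
    note c = carrier_matD[OF matrix_reps_carrier[OF \<rho> g]] carrier_matD[OF matrix_reps_carrier[OF \<sigma> g]]
    have "bcomb (n + m) d (?\<tau> g) k =
        (\<Sum>i<n. ?\<tau> g $$ (i, k) *\<^sub>R b i) + (\<Sum>j<m. ?\<tau> g $$ (n + j, k) *\<^sub>R b' j)"
      unfolding bcomb_def by (rule split)
    also have "\<dots> = act g (d k)"
    proof (cases "k < n")
      case True
      have "act g (d k) = (\<Sum>i<n. \<rho> g $$ (i, k) *\<^sub>R b i)"
        using b(2) g True by (simp add: d bcomb_def)
      moreover have "(\<Sum>i<n. ?\<tau> g $$ (i, k) *\<^sub>R b i) = (\<Sum>i<n. \<rho> g $$ (i, k) *\<^sub>R b i)"
        using True k by (intro sum.cong) (auto simp: c)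
      moreover have "(\<Sum>j<m. ?\<tau> g $$ (n + j, k) *\<^sub>R b' j) = 0"
        using True k by (intro sum.neutral) (auto simp: c)
      ultimately show ?thesis by simp
    next
      case False
      have "d k = b' (k - n)" using False by (simp add: d_def)
      then have "act g (d k) = (\<Sum>j<m. \<sigma> g $$ (j, k - n) *\<^sub>R b' j)"
        using b'(2) g False k by (simp add: bcomb_def)
      moreover have "(\<Sum>i<n. ?\<tau> g $$ (i, k) *\<^sub>R b i) = 0"
        using False k by (intro sum.neutral) (auto simp: c)
      moreover have "(\<Sum>j<m. ?\<tau> g $$ (n + j, k) *\<^sub>R b' j) = (\<Sum>j<m. \<sigma> g $$ (j, k - n) *\<^sub>R b' j)"
        using False k by (intro sum.cong) (auto simp: c)
      ultimately show ?thesis by simp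
    qed
    finally show ?thesis ..
  qed
  moreover have "(n + m, ?\<tau>) \<in> matrix_reps G X"
    using rep_sum_closed[OF G \<rho> \<sigma>] by simp
  ultimately show ?thesis using basis by (auto simp: nm mem_rep_class)
qed

text \<open>The kernel of the projection onto \<open>E'\<close> is the complement of
  \<open>E'\<close>, so the projection is injective on \<open>E\<close>. With the roles exchanged
  the same count gives the opposite inequality.\<close>

lemma transversal_card_le:
  fixes E E' :: "'h::real_inner set"
  assumes b: "is_basis n b E" and e: "orthonormal m e" "span (e ` {..<m}) = E'"
    and int: "E \<inter> E'\<^sup>\<bottom> = {0}"
  shows "independent ((\<lambda>i. oproj m e (b i)) ` {..<n})" "card ((\<lambda>i. oproj m e (b i)) ` {..<n}) = n"
    "n \<le> m"
proof -
  have sp: "span (b ` {..<n}) = E" and ind: "independent (b ` {..<n})"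
    using b by (simp_all add: is_basis_def)
  have inj: "inj_on (oproj m e) E"
  proof (rule inj_onI)
    fix x y assume xy: "x \<in> E" "y \<in> E" "oproj m e x = oproj m e y"
    then have "oproj m e (x - y) = 0" by (simp add: linear_diff[OF linear_oproj])
    then have "x - y \<in> E'\<^sup>\<bottom>" using oproj_orthogonal[OF e(1), of "x - y"] by (simp add: e(2))
    moreover have "x - y \<in> E" using xy unfolding sp[symmetric] by (intro span_diff)
    ultimately have "x - y = 0" using int by blast
    then show "x = y" by simp
  qed
  have img: "(\<lambda>i. oproj m e (b i)) ` {..<n} = oproj m e ` b ` {..<n}" by (simp add: image_image)
  show 1: "independent ((\<lambda>i. oproj m e (b i)) ` {..<n})"
    unfolding img by (rule linear_independent_injective_image[OF linear_oproj ind]) (simp add: sp inj)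
  have "inj_on (oproj m e) (b ` {..<n})"
    using inj by (rule inj_on_subset) (auto simp: sp[symmetric] intro: span_base)
  then show 2: "card ((\<lambda>i. oproj m e (b i)) ` {..<n}) = n"
    unfolding img by (simp add: card_image is_basis_card[OF b])
  have "(\<lambda>i. oproj m e (b i)) ` {..<n} \<subseteq> span (e ` {..<m})"
    using oproj_in_span by blast
  then have "n \<le> card (e ` {..<m})"
    using independent_span_bound[OF _ 1] 2 by (metis finite_imageI finite_lessThan)
  also have "\<dots> \<le> m" using card_image_le[of "{..<m}" e] by simp
  finally show "n \<le> m" .
qed

text \<open>Orthogonal projection onto \<open>E'\<close> restricts to an equivariant isomorphism \<open>E \<rightarrow> E'\<close>.\<close>

lemma rep_class_transversal:
  fixes act :: "'g \<Rightarrow> 'h \<Rightarrow> 'h::real_inner"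
  assumes G: "lie_group G X" and act: "orthogonal_action G X act"
    and E: "subspace E" "finite_dim E" "\<And>g u. g \<in> carrier G \<Longrightarrow> u \<in> E \<Longrightarrow> act g u \<in> E"
    and E': "subspace E'" "finite_dim E'" "\<And>g u. g \<in> carrier G \<Longrightarrow> u \<in> E' \<Longrightarrow> act g u \<in> E'"
    and int: "E \<inter> E'\<^sup>\<bottom> = {0}" "E' \<inter> E\<^sup>\<bottom> = {0}"
  shows "rep_class G X act E = rep_class G X act E'"
proof -
  interpret group G by (rule lie_group_group[OF G])
  obtain n \<rho> where r: "(n, \<rho>) \<in> rep_class G X act E"
    using rep_class_nonempty[OF G act E] by (metis surj_pair)
  then obtain b where \<rho>: "(n, \<rho>) \<in> matrix_reps G X" and b: "is_basis n b E"
    "\<forall>g\<in>carrier G. \<forall>j<n. act g (b j) = bcomb n b (\<rho> g) j"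
    unfolding mem_rep_class by blast
  obtain m e where e: "orthonormal m e" "span (e ` {..<m}) = E'"
    using E'(1,2) by (rule orthonormal_basis_exists)
  obtain k d where d: "orthonormal k d" "span (d ` {..<k}) = E"
    using E(1,2) by (rule orthonormal_basis_exists)
  have "is_basis k d E" using orthonormal_is_basis[OF d(1)] d(2) by simp
  then have k: "k = n" using b(1) is_basis_same_size by blast
  have eb: "is_basis m e E'" using orthonormal_is_basis[OF e(1)] e(2) by simp
  note tr = transversal_card_le[OF b(1) e int(1)]
  \<comment> \<open>The second transversality enters here; it upgrades injectivity of the projection
    to bijectivity.\<close>
  have "m \<le> n" using transversal_card_le(3)[OF eb d int(2)] k by simp
  let ?P = "oproj m e"
  let ?b = "\<lambda>i. ?P (b i)"
  have "e ` {..<m} \<subseteq> span (?b ` {..<n})"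
  proof (rule independent_imp_spanning[OF tr(1)])
    show "card (e ` {..<m}) \<le> card (?b ` {..<n})"
      using tr(2) \<open>m \<le> n\<close> card_image_le[of "{..<m}" e] by simp
    show "?b ` {..<n} \<subseteq> span (e ` {..<m})" using oproj_in_span by blast
  qed simp
  then have "E' \<subseteq> span (?b ` {..<n})"
    unfolding e(2)[symmetric] by (rule span_minimal) simp
  moreover have "span (?b ` {..<n}) \<subseteq> E'"
    using oproj_in_span[of m e] E'(1) unfolding e(2) by (intro span_minimal image_subsetI)
  ultimately have sp: "span (?b ` {..<n}) = E'" by (rule subset_antisym[rotated])
  have basis: "is_basis n ?b E'"
    using tr(1,2) sp by (auto simp: is_basis_def intro: eq_card_imp_inj_on)
  have "act g (?b j) = bcomb n ?b (\<rho> g) j" if g: "g \<in> carrier G" and j: "j < n" for g j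
  proof -
    have "?P (act g (b j)) = act g (?b j)"
    proof (rule oproj_unique[OF e(1)])
      have PE: "?P (b j) \<in> E'" using oproj_in_span[of m e] by (simp add: e(2))
      then show "act g (?b j) \<in> span (e ` {..<m})" unfolding e(2) by (rule E'(3)[OF g])
      have "y \<bullet> (act g (b j) - act g (?b j)) = 0" if y: "y \<in> E'" for y
      proof -
        \<comment> \<open>Pulling \<open>y\<close> back by \<open>g\<close> keeps it in the
          invariant subspace \<open>E'\<close>, and orthogonality of \<open>act g\<close> reduces
          the claim to the defining property of the projection at \<open>b j\<close>.\<close>
        have "y = act g (act (inv\<^bsub>G\<^esub> g) y)"
          using orthogonal_action_mult[OF act g inv_closed[OF g], of y]
          by (simp add: g r_inv orthogonal_action_one[OF act])
        then have "y \<bullet> (act g (b j) - act g (?b j)) = act g (act (inv\<^bsub>G\<^esub> g) y) \<bullet> act g (b j - ?b j)"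
          using linear_diff[OF orthogonal_action_linear[OF act g]] by simp
        also have "\<dots> = act (inv\<^bsub>G\<^esub> g) y \<bullet> (b j - ?b j)"
          by (rule orthogonal_action_inner[OF act g])
        also have "\<dots> = 0"
          using oproj_orthogonal[OF e(1), of "b j"] E'(3)[OF inv_closed[OF g] y]
          by (simp add: e(2) mem_orthogonal_comp)
        finally show ?thesis .
      qed
      then show "act g (b j) - act g (?b j) \<in> (span (e ` {..<m}))\<^sup>\<bottom>"
        by (simp add: e(2) mem_orthogonal_comp)
    qed
    then have "act g (?b j) = ?P (bcomb n b (\<rho> g) j)" using b(2) g j by simp
    also have "\<dots> = bcomb n ?b (\<rho> g) j" by (rule linear_bcomb[OF linear_oproj])
    finally show ?thesis .
  qed
  with basis \<rho> have r': "(n, \<rho>) \<in> rep_class G X act E'"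
    unfolding mem_rep_class by blast
  show ?thesis
    using rep_class_eq_rep_iso_class[OF orthogonal_action_linear[OF act] r]
      rep_class_eq_rep_iso_class[OF orthogonal_action_linear[OF act] r'] by simp
qed

section \<open>The equivariant spectral flow\<close>

lemma eigen_sum_equivariant:
  assumes act: "orthogonal_action G X act" and T: "T \<in> FS_G G act" and g: "g \<in> carrier G"
    and u: "u \<in> eigen_sum T M"
  shows "act g u \<in> eigen_sum T M"
  using u unfolding eigen_sum_def
proof (induction rule: span_induct_alt)
  case base
  then show ?case using linear_0[OF orthogonal_action_linear[OF act g]] by (simp add: span_zero)
next
  case (step c x y)
  then obtain \<mu> where \<mu>: "\<mu> \<in> M" "T x = \<mu> *\<^sub>R x" by blast
  have "T (act g x) = \<mu> *\<^sub>R act g x"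
    using T g \<mu>(2) linear_scale[OF orthogonal_action_linear[OF act g]] by (simp add: FS_G_def)
  with \<mu>(1) have "act g x \<in> span (\<Union>\<mu>\<in>M. {u. T u = \<mu> *\<^sub>R u})"
    by (intro span_base UN_I[of \<mu>]) simp_all
  with step(2) show ?case
    using linear_add[OF orthogonal_action_linear[OF act g]] linear_scale[OF orthogonal_action_linear[OF act g]]
    by (simp add: span_add span_scale)
qed

text \<open>Components for distinct eigenvalues are orthogonal, so a common vector is orthogonal to
  itself.\<close>

lemma eigen_sum_disjoint:
  assumes sa: "selfadjoint T" and MN: "M \<inter> N = {}"
  shows "eigen_sum T M \<inter> eigen_sum T N = {0}"
proof -
  have "u = 0" if uM: "u \<in> eigen_sum T M" and uN: "u \<in> eigen_sum T N" for u
  proof -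
    obtain J v where J: "J \<subseteq> M" "u = (\<Sum>\<mu>\<in>J. v \<mu>)" "\<forall>\<mu>\<in>J. T (v \<mu>) = \<mu> *\<^sub>R v \<mu>"
      using eigen_sum_decompose[OF uM] by metis
    obtain K w where K: "K \<subseteq> N" "u = (\<Sum>\<nu>\<in>K. w \<nu>)" "\<forall>\<nu>\<in>K. T (w \<nu>) = \<nu> *\<^sub>R w \<nu>"
      using eigen_sum_decompose[OF uN] by metis
    have "v \<mu> \<bullet> w \<nu> = 0" if "\<mu> \<in> J" "\<nu> \<in> K" for \<mu> \<nu>
      by (rule eigenvectors_orthogonal[OF sa J(3)[rule_format, OF that(1)] K(3)[rule_format, OF that(2)]])
         (use J(1) K(1) MN that in blast)
    then have "(\<Sum>\<mu>\<in>J. v \<mu>) \<bullet> (\<Sum>\<nu>\<in>K. w \<nu>) = 0"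
      unfolding inner_sum_left inner_sum_right by (intro sum.neutral ballI)
    then have "u \<bullet> u = 0" by (simp only: J(2)[symmetric] K(2)[symmetric])
    then show ?thesis by simp
  qed
  then show ?thesis by (intro Int_eq_zeroI subspace_eigen_sum)
qed

lemma eigen_sum_Un: "eigen_sum T (M \<union> N) = span (eigen_sum T M \<union> eigen_sum T N)"
  unfolding eigen_sum_def UN_Un by (simp add: span_Un span_span)

lemma rep_class_in_carrier:
  fixes act :: "'g \<Rightarrow> 'h \<Rightarrow> 'h::real_inner"
  assumes G: "lie_group G X" and act: "orthogonal_action G X act"
    and E: "subspace E" "finite_dim E" and inv: "\<And>g u. g \<in> carrier G \<Longrightarrow> u \<in> E \<Longrightarrow> act g u \<in> E"
  shows "rep_class G X act E \<in> carrier (rep_monoid G X)"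
proof -
  obtain r where r: "r \<in> rep_class G X act E"
    using rep_class_nonempty[OF G act E inv] by blast
  then have "r \<in> matrix_reps G X" by (auto simp: rep_class_def)
  with rep_class_eq_rep_iso_class[OF orthogonal_action_linear[OF act] r] show ?thesis
    by (auto simp: carrier_rep_monoid)
qed

lemma rep_class_direct_sum:
  fixes act :: "'g \<Rightarrow> 'h \<Rightarrow> 'h::real_inner"
  assumes G: "lie_group G X" and act: "orthogonal_action G X act"
    and E: "subspace E" "finite_dim E" "\<And>g u. g \<in> carrier G \<Longrightarrow> u \<in> E \<Longrightarrow> act g u \<in> E"
    and E': "subspace E'" "finite_dim E'" "\<And>g u. g \<in> carrier G \<Longrightarrow> u \<in> E' \<Longrightarrow> act g u \<in> E'"
    and int: "E \<inter> E' = {0}"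
  shows "rep_class G X act (span (E \<union> E')) =
    rep_class G X act E \<otimes>\<^bsub>rep_monoid G X\<^esub> rep_class G X act E'"
proof -
  have eq: "rep_class G X act F = rep_iso G X `` {q}" if "q \<in> rep_class G X act F" for F q
    using orthogonal_action_linear[OF act] that by (rule rep_class_eq_rep_iso_class)
  obtain r where r: "r \<in> rep_class G X act E"
    using rep_class_nonempty[OF G act E] by blast
  obtain s where s: "s \<in> rep_class G X act E'"
    using rep_class_nonempty[OF G act E'] by blast
  have rs: "r \<in> matrix_reps G X" "s \<in> matrix_reps G X"
    using r s by (auto simp: rep_class_def)
  show ?thesis
    unfolding eq[OF r] eq[OF s] eq[OF rep_sum_mem_rep_class[OF G r s int]]
    by (rule rep_monoid_mult_class[OF G rs, symmetric])
qed

text \<open>Positivity of the essential spectrum handles \<open>\<mu> \<le> 0\<close>, the window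
  handles \<open>0 < \<mu> \<le> a\<close>; together they supply the whole half line needed for the
  eigenspaces up to level \<open>a\<close>.\<close>

lemma admissible_fredholm:
  assumes "T \<in> FS_plus" "{- a..a} \<inter> ess_spectrum T = {}" "\<mu> \<le> a"
  shows "fredholm (T - \<mu> *\<^sub>R id_blinfun)"
proof (cases "\<mu> \<le> 0")
  case True
  with assms(1) show ?thesis by (rule FS_plus_fredholm)
next
  case False
  with assms(3) have "\<mu> \<in> {- a..a}" by simp
  with assms(2) have "\<mu> \<notin> ess_spectrum T" by blast
  then show ?thesis by (simp add: ess_spectrum_def)
qed

text \<open>All subspaces lie in the finite dimensional sum up to level \<open>a\<close>. The kernel
  is counted in the window \<open>{0..a}\<close>, in accordance with the strict bound in
  \<open>E_minus\<close>.\<close>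

lemma rep_class_eigen_sum_split:
  fixes T :: "'h::{real_inner, complete_space} \<Rightarrow>\<^sub>L 'h"
  assumes G: "lie_group G X" and act: "orthogonal_action G X act"
    and T: "T \<in> FS_G G act" "T \<in> FS_plus" and a: "a > 0" "{- a..a} \<inter> ess_spectrum T = {}"
  shows "rep_class G X act (eigen_sum T {0..a}) \<in> carrier (rep_monoid G X)"
    and "rep_class G X act (E_minus T) \<in> carrier (rep_monoid G X)"
    and "rep_class G X act (eigen_sum T {..a}) =
      rep_class G X act (eigen_sum T {0..a}) \<otimes>\<^bsub>rep_monoid G X\<^esub> rep_class G X act (E_minus T)"
proof -
  note sa = FS_plus_selfadjoint[OF T(2)]
  have fd: "finite_dim (eigen_sum T {..a})"
    by (rule finite_dim_eigen_sum[OF sa admissible_fredholm[OF T(2) a(2)]])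
  have fd1: "finite_dim (eigen_sum T {0..a})"
    by (rule finite_dim_subset[OF fd eigen_sum_mono]) auto
  have fd2: "finite_dim (eigen_sum T {..<0})"
    by (rule finite_dim_subset[OF fd eigen_sum_mono]) (use a(1) in auto)
  note inv = eigen_sum_equivariant[OF act T(1)]
  show "rep_class G X act (eigen_sum T {0..a}) \<in> carrier (rep_monoid G X)"
    by (rule rep_class_in_carrier[OF G act subspace_eigen_sum fd1 inv])
  show "rep_class G X act (E_minus T) \<in> carrier (rep_monoid G X)"
    unfolding E_minus_def by (rule rep_class_in_carrier[OF G act subspace_eigen_sum fd2 inv])
  have "{..a} = {0..a} \<union> {..<0}" using a(1) by auto
  then have "eigen_sum T {..a} = span (eigen_sum T {0..a} \<union> eigen_sum T {..<0})"
    by (simp only: eigen_sum_Un)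
  moreover have "eigen_sum T {0..a} \<inter> eigen_sum T {..<0} = {0}"
    by (rule eigen_sum_disjoint[OF sa]) auto
  ultimately show "rep_class G X act (eigen_sum T {..a}) =
      rep_class G X act (eigen_sum T {0..a}) \<otimes>\<^bsub>rep_monoid G X\<^esub> rep_class G X act (E_minus T)"
    unfolding E_minus_def
    using rep_class_direct_sum[OF G act subspace_eigen_sum fd1 inv subspace_eigen_sum fd2 inv] by simp
qed

text \<open>Having the same class is an equivalence relation on the parameters. Around each
  parameter transversality makes it hold on a relative neighbourhood, and on a connected interval
  such a relation has a single class.\<close>

lemma rep_class_eigen_sum_constant:
  fixes L :: "real \<Rightarrow> 'h::{real_inner, complete_space} \<Rightarrow>\<^sub>L 'h"
  assumes G: "lie_group G X" and act: "orthogonal_action G X act"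
    and cont: "continuous_on {p..q} L"
    and L: "\<And>s. s \<in> {p..q} \<Longrightarrow> L s \<in> FS_G G act \<inter> FS_plus"
    and a: "\<And>s. s \<in> {p..q} \<Longrightarrow> a \<notin> op_spectrum (L s) \<and> {- a..a} \<inter> ess_spectrum (L s) = {}"
    and st: "s \<in> {p..q}" "t \<in> {p..q}"
  shows "rep_class G X act (eigen_sum (L s) {..a}) = rep_class G X act (eigen_sum (L t) {..a})"
proof -
  define R where "R s t \<longleftrightarrow> rep_class G X act (eigen_sum (L s) {..a}) = rep_class G X act (eigen_sum (L t) {..a})" for s t
  have sa: "selfadjoint (L s)" and fr: "\<And>\<mu>. \<mu> \<le> a \<Longrightarrow> fredholm (L s - \<mu> *\<^sub>R id_blinfun)"
    and sp: "a \<notin> op_spectrum (L s)" and FG: "L s \<in> FS_G G act" if "s \<in> {p..q}" for s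
    using L[OF that] a[OF that] FS_plus_selfadjoint admissible_fredholm by blast+
  have fd: "finite_dim (eigen_sum (L s) {..a})" if "s \<in> {p..q}" for s
    by (rule finite_dim_eigen_sum[OF sa[OF that] fr[OF that]])
  have "R s t"
  proof (rule connected_equivalence_relation[of "{p..q}"])
    fix s assume s: "s \<in> {p..q}"
    have "\<exists>\<delta>>0. \<forall>T'. selfadjoint T' \<and> (\<forall>\<mu>\<le>a. fredholm (T' - \<mu> *\<^sub>R id_blinfun)) \<and>
      a \<notin> op_spectrum T' \<and> norm (T' - L s) < \<delta> \<longrightarrow>
      eigen_sum (L s) {..a} \<inter> (eigen_sum T' {..a})\<^sup>\<bottom> = {0} \<and> eigen_sum T' {..a} \<inter> (eigen_sum (L s) {..a})\<^sup>\<bottom> = {0}"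
      by (rule eigen_sum_transversal[OF sa[OF s] fr[OF s] sp[OF s]])
    then obtain \<delta> where \<delta>: "\<delta> > 0" "\<forall>T'. selfadjoint T' \<and> (\<forall>\<mu>\<le>a. fredholm (T' - \<mu> *\<^sub>R id_blinfun)) \<and>
      a \<notin> op_spectrum T' \<and> norm (T' - L s) < \<delta> \<longrightarrow>
      eigen_sum (L s) {..a} \<inter> (eigen_sum T' {..a})\<^sup>\<bottom> = {0} \<and> eigen_sum T' {..a} \<inter> (eigen_sum (L s) {..a})\<^sup>\<bottom> = {0}"
      by (elim exE conjE) (rule that)
    obtain d where d: "d > 0" "\<forall>t\<in>{p..q}. dist t s < d \<longrightarrow> dist (L t) (L s) < \<delta>"
      using cont s \<delta>(1) unfolding continuous_on_iff by meson
    have "R s t" if t: "t \<in> {p..q} \<inter> ball s d" for t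
    proof -
      have t': "t \<in> {p..q}" using t by blast
      have "dist t s < d" using t by (simp add: dist_commute)
      with d(2) t' have "norm (L t - L s) < \<delta>"
        unfolding dist_norm[symmetric] by blast
      then have tr: "eigen_sum (L s) {..a} \<inter> (eigen_sum (L t) {..a})\<^sup>\<bottom> = {0}"
        "eigen_sum (L t) {..a} \<inter> (eigen_sum (L s) {..a})\<^sup>\<bottom> = {0}"
        using \<delta>(2)[rule_format, of "L t"] sa[OF t'] fr[OF t'] sp[OF t'] by simp_all
      show ?thesis
        unfolding R_def
        by (rule rep_class_transversal[OF G act subspace_eigen_sum fd[OF s] eigen_sum_equivariant[OF act FG[OF s]]
              subspace_eigen_sum fd[OF t'] eigen_sum_equivariant[OF act FG[OF t']] tr])
    qed
    moreover have "openin (top_of_set {p..q}) ({p..q} \<inter> ball s d)"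
      by (simp add: openin_open_Int)
    moreover have "s \<in> {p..q} \<inter> ball s d" using s d(1) by simp
    ultimately show "\<exists>T. openin (top_of_set {p..q}) T \<and> s \<in> T \<and> (\<forall>t\<in>T. R s t)" by blast
  qed (use st in \<open>auto simp: R_def\<close>)
  then show ?thesis by (simp add: R_def)
qed

lemma sf_partition_range:
  assumes P: "sf_partition L N t a" and ij: "i \<le> j" "j \<le> N"
  shows "t i \<le> t j"
  using ij
proof (induction j)
  case (Suc j)
  show ?case
  proof (cases "i = Suc j")
    case False
    with Suc have "t i \<le> t j" by simp
    also have "\<dots> < t (Suc j)"
      using P Suc(3) unfolding sf_partition_def by (metis Suc_eq_plus1 add_diff_cancel_right' atLeastAtMost_iff le_add2)
    finally show ?thesis by simp
  qed simp
qed simp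

lemma sf_sum_eq:
  fixes L :: "real \<Rightarrow> 'h::{real_inner, complete_space} \<Rightarrow>\<^sub>L 'h"
  assumes G: "lie_group G X" and act: "orthogonal_action G X act"
    and cont: "continuous_on {0..1} L"
    and L: "\<And>s. s \<in> {0..1} \<Longrightarrow> L s \<in> FS_G G act \<inter> FS_plus"
    and P: "sf_partition L N t a"
  shows "sf_sum G X act L N t a = rep_diff G X act (E_minus (L 0)) (E_minus (L 1))"
    and "rep_diff G X act (E_minus (L 0)) (E_minus (L 1)) \<in> carrier (RO G X)"
proof -
  let ?M = "rep_monoid G X" and ?c = "rep_class G X act"
  note M = comm_monoid_rep_monoid[OF G]
  interpret comm_monoid ?M by (rule M)
  interpret K: comm_monoid "grothendieck_group ?M" by (rule comm_monoid_grothendieck_group[OF M])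
  have t01: "t i \<in> {0..1}" if "i \<le> N" for i
    using sf_partition_range[OF P, of 0 i] sf_partition_range[OF P that] that P
    by (simp add: sf_partition_def)
  have Pi: "t (i - 1) < t i" "a i > 0"
    "\<And>s. s \<in> {t (i - 1)..t i} \<Longrightarrow> a i \<notin> op_spectrum (L s) \<and> {- a i..a i} \<inter> ess_spectrum (L s) = {}"
    if "i \<in> {1..N}" for i
    using P that unfolding sf_partition_def by blast+
  have N: "N \<ge> 1" using P by (cases N) (auto simp: sf_partition_def)
  define m where "m i = ?c (E_minus (L (t i)))" for i
  have sub: "s \<in> {0..1}" if i: "i \<in> {1..N}" and s: "s \<in> {t (i - 1)..t i}" for i s
  proof -
    have "i - 1 \<le> N" "i \<le> N" using i by auto
    from t01[OF this(1)] t01[OF this(2)] s show ?thesis by auto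
  qed
  have carr: "m i \<in> carrier ?M" "m (i - 1) \<in> carrier ?M"
    "?c (eigen_sum (L (t i)) {0..a i}) \<in> carrier ?M" "?c (eigen_sum (L (t (i - 1))) {0..a i}) \<in> carrier ?M"
    and summand: "rep_diff G X act (eigen_sum (L (t i)) {0..a i}) (eigen_sum (L (t (i - 1))) {0..a i}) =
      formal_diff ?M (m (i - 1)) (m i)" if i: "i \<in> {1..N}" for i
  proof -
    have p: "t i \<in> {t (i - 1)..t i}" "t (i - 1) \<in> {t (i - 1)..t i}" using Pi(1)[OF i] by auto
    have L1: "L (t i) \<in> FS_G G act" "L (t i) \<in> FS_plus" using L[OF sub[OF i p(1)]] by auto
    have L0: "L (t (i - 1)) \<in> FS_G G act" "L (t (i - 1)) \<in> FS_plus" using L[OF sub[OF i p(2)]] by auto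
    note S1 = rep_class_eigen_sum_split[OF G act L1 Pi(2)[OF i] conjunct2[OF Pi(3)[OF i p(1)]]]
    note S0 = rep_class_eigen_sum_split[OF G act L0 Pi(2)[OF i] conjunct2[OF Pi(3)[OF i p(2)]]]
    show c: "m i \<in> carrier ?M" "m (i - 1) \<in> carrier ?M"
      "?c (eigen_sum (L (t i)) {0..a i}) \<in> carrier ?M" "?c (eigen_sum (L (t (i - 1))) {0..a i}) \<in> carrier ?M"
      using S1(1,2) S0(1,2) by (simp_all add: m_def)
    have "?c (eigen_sum (L (t i)) {..a i}) = ?c (eigen_sum (L (t (i - 1))) {..a i})"
    proof (rule rep_class_eigen_sum_constant[OF G act _ _ Pi(3)[OF i] p])
      show "continuous_on {t (i - 1)..t i} L"
        using cont by (rule continuous_on_subset) (use sub[OF i] in blast)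
      show "L s \<in> FS_G G act \<inter> FS_plus" if "s \<in> {t (i - 1)..t i}" for s
        by (rule L[OF sub[OF i that]])
    qed
    \<comment> \<open>The cross-multiplied form of the desired equality of formal differences; the
      stabilising summand is trivial.\<close>
    then have "?c (eigen_sum (L (t i)) {0..a i}) \<otimes>\<^bsub>?M\<^esub> m i = ?c (eigen_sum (L (t (i - 1))) {0..a i}) \<otimes>\<^bsub>?M\<^esub> m (i - 1)"
      unfolding m_def S1(3)[symmetric] S0(3)[symmetric] .
    then show "rep_diff G X act (eigen_sum (L (t i)) {0..a i}) (eigen_sum (L (t (i - 1))) {0..a i}) =
      formal_diff ?M (m (i - 1)) (m i)"
      using c unfolding rep_diff_def
      by (subst formal_diff_eq_iff[OF M]) (auto intro!: bexI[of _ "\<one>\<^bsub>?M\<^esub>"] simp: m_comm)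
  qed
  have mc: "m i \<in> carrier ?M" if "i \<le> N" for i
  proof (cases "i = 0")
    case True
    with carr(2)[of 1] N show ?thesis by simp
  next
    case False
    with carr(1)[of i] that show ?thesis by simp
  qed
  have fd: "formal_diff ?M (m i) (m j) \<in> carrier (grothendieck_group ?M)" if "i \<le> N" "j \<le> N" for i j
    using mc[OF that(1)] mc[OF that(2)] unfolding carrier_grothendieck_group by blast
  have "sf_sum G X act L N t a = finprod (grothendieck_group ?M) (\<lambda>i. formal_diff ?M (m (i - 1)) (m i)) {1..N}"
    unfolding sf_sum_def RO_def
    by (rule K.finprod_cong') (use summand fd in \<open>auto simp: Pi_def\<close>)
  also have "\<dots> = formal_diff ?M (m 0) (m N)"
    by (rule finprod_formal_diff_telescope[OF M mc])
  also have end_eq: "\<dots> = rep_diff G X act (E_minus (L 0)) (E_minus (L 1))"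
    using P by (simp add: rep_diff_def m_def sf_partition_def)
  finally show "sf_sum G X act L N t a = rep_diff G X act (E_minus (L 0)) (E_minus (L 1))" .
  show "rep_diff G X act (E_minus (L 0)) (E_minus (L 1)) \<in> carrier (RO G X)"
    using fd[of 0 N] unfolding end_eq RO_def by simp
qed

text \<open>Each parameter has a ball on which one number \<open>a\<close> is admissible; a Lebesgue
  number of this cover of the compact unit interval allows an equidistant partition.\<close>

lemma sf_partition_exists:
  fixes L :: "real \<Rightarrow> 'h::{real_inner, complete_space} \<Rightarrow>\<^sub>L 'h"
  assumes cont: "continuous_on {0..1} L" and L: "\<And>s. s \<in> {0..1} \<Longrightarrow> L s \<in> FS_plus"
  shows "\<exists>N t a. sf_partition L N t a"
proof -
  define adm where "adm a s \<longleftrightarrow> a \<notin> op_spectrum (L s) \<and> - a \<notin> op_spectrum (L s) \<and> {- a..a} \<inter> ess_spectrum (L s) = {}" for a s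
  have "\<exists>a d. a > 0 \<and> d > 0 \<and> (\<forall>t\<in>{0..1} \<inter> ball s d. adm a t)" if s: "s \<in> {0..1}" for s
  proof -
    obtain a \<delta> where a: "a > 0" "\<delta> > 0" "\<forall>T'. selfadjoint T' \<and> norm (T' - L s) < \<delta> \<longrightarrow>
      a \<notin> op_spectrum T' \<and> - a \<notin> op_spectrum T' \<and> {- a..a} \<inter> ess_spectrum T' = {}"
      using FS_plus_admissible_neighbourhood[OF L[OF s]] by (elim exE conjE) (rule that)
    obtain d where d: "d > 0" "\<forall>t\<in>{0..1}. dist t s < d \<longrightarrow> dist (L t) (L s) < \<delta>"
      using cont s a(2) unfolding continuous_on_iff by meson
    have "adm a t" if "t \<in> {0..1} \<inter> ball s d" for t
    proof -
      have "dist t s < d" "t \<in> {0..1}" using that by (simp_all add: dist_commute)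
      with d(2) have "norm (L t - L s) < \<delta>"
        unfolding dist_norm[symmetric] by blast
      moreover have "selfadjoint (L t)" using L[of t] that by (intro FS_plus_selfadjoint) simp
      ultimately show ?thesis using a(3)[rule_format, of "L t"] unfolding adm_def by simp
    qed
    with a(1) d(1) show ?thesis by blast
  qed
  then obtain \<alpha> d where \<alpha>: "\<forall>s\<in>{0..1}. \<alpha> s > 0 \<and> d s > 0 \<and> (\<forall>t\<in>{0..1} \<inter> ball s (d s). adm (\<alpha> s) t)"
    by metis
  obtain \<delta> where \<delta>: "\<delta> > 0"
    "\<And>T. T \<subseteq> {0..1::real} \<Longrightarrow> diameter T < \<delta> \<Longrightarrow> \<exists>B\<in>(\<lambda>s. ball s (d s)) ` {0..1}. T \<subseteq> B"
  proof (rule Lebesgue_number_lemma[of "{0..1::real}" "(\<lambda>s. ball s (d s)) ` {0..1}"])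
    show "{0..1} \<subseteq> \<Union> ((\<lambda>s. ball s (d s)) ` {0..1})" using \<alpha> by fastforce
  qed auto
  \<comment> \<open>A mesh below the Lebesgue number puts each closed subinterval, both endpoints
    included, into a single ball.\<close>
  obtain n where n: "1 / real (Suc n) < \<delta>"
    using nat_approx_posE[OF \<delta>(1)] by blast
  define t where "t i = real i / real (Suc n)" for i
  have step: "t i = t (i - 1) + 1 / real (Suc n)" if "i \<in> {1..Suc n}" for i
    using that by (simp add: t_def of_nat_diff diff_divide_distrib)
  have "\<exists>a>0. \<forall>s\<in>{t (i - 1)..t i}. adm a s" if i: "i \<in> {1..Suc n}" for i
  proof -
    have "0 \<le> t (i - 1)" "t i \<le> 1" using i by (simp_all add: t_def)
    then have sub: "{t (i - 1)..t i} \<subseteq> {0..1}" by auto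
    have "diameter {t (i - 1)..t i} < \<delta>" using step[OF i] n by simp
    from \<delta>(2)[OF sub this] obtain s where s: "s \<in> {0..1}" "{t (i - 1)..t i} \<subseteq> ball s (d s)" by blast
    with \<alpha> sub show ?thesis by (intro exI[of _ "\<alpha> s"]) blast
  qed
  then obtain a where a: "\<forall>i\<in>{1..Suc n}. a i > 0 \<and> (\<forall>s\<in>{t (i - 1)..t i}. adm (a i) s)" by metis
  have "sf_partition L (Suc n) t a"
    unfolding sf_partition_def
  proof (intro conjI ballI)
    show "t 0 = 0" "t (Suc n) = 1" by (simp_all add: t_def)
    show "t (i - 1) < t i" if "i \<in> {1..Suc n}" for i using step[OF that] by simp
  qed (use a in \<open>auto simp: adm_def\<close>)
  then show ?thesis by blast
qed

theorem proposition3p2: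
  fixes G :: "'g monoid" and X :: "'g topology"
    and act :: "'g \<Rightarrow> 'h \<Rightarrow> 'h::{real_inner, complete_space}"
    and L :: "real \<Rightarrow> 'h \<Rightarrow>\<^sub>L 'h"
  assumes "\<not> finite_dim (UNIV :: 'h set)"
    and "separable_space (euclidean :: 'h topology)"
    and "compact_lie_group G X"
    and "orthogonal_action G X act"
    and "continuous_on {0..1} L"
    and "\<And>s. s \<in> {0..1} \<Longrightarrow> L s \<in> FS_G G act \<inter> FS_plus"
  shows "sf_G G X act L \<in> carrier (RO G X) \<and>
         sf_G G X act L = rep_diff G X act (E_minus (L 0)) (E_minus (L 1))"
proof -
  have G: "lie_group G X" using assms(3) by (simp add: compact_lie_group_def)
  have sum_eq: "sf_sum G X act L N t a = rep_diff G X act (E_minus (L 0)) (E_minus (L 1))"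
    "rep_diff G X act (E_minus (L 0)) (E_minus (L 1)) \<in> carrier (RO G X)"
    if "sf_partition L N t a" for N t a
    using sf_sum_eq[OF G assms(4,5) _ that] assms(6) by blast+
  obtain N t a where P: "sf_partition L N t a"
    using sf_partition_exists[OF assms(5)] assms(6) by blast
  have "sf_G G X act L = rep_diff G X act (E_minus (L 0)) (E_minus (L 1))"
    unfolding sf_G_def
  proof (rule the_equality)
    show "\<exists>N t a. sf_partition L N t a \<and>
        rep_diff G X act (E_minus (L 0)) (E_minus (L 1)) = sf_sum G X act L N t a"
      using P sum_eq(1)[OF P] by metis
    \<comment> \<open>Two partitions need not be compared: each sum has been evaluated to the same
      class.\<close>
    show "x = rep_diff G X act (E_minus (L 0)) (E_minus (L 1))"
      if "\<exists>N t a. sf_partition L N t a \<and> x = sf_sum G X act L N t a" for x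
      using that sum_eq(1) by metis
  qed
  with sum_eq(2)[OF P] show ?thesis by simp
qed

end
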